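(* Consider the media agency problem with arbitrary transfers (with either the GSP or the VCG mechanism), under the assumption that there exists a bidding strategy $b^c\in[0,1]^{n_c}$ with $\tilde r_i(b^c)-\tilde\pi_i(b^c)\ge t_i$ for all $i\in N_c$. There exists an algorithm that, given an instance and $\varepsilon>0$, runs in time polynomial in the instance size and $\frac1\varepsilon$, and returns a pair $(\gamma,q)$ that is $\varepsilon$-IC and IR, i.e. $$\mathbb{E}_{b^c\sim\gamma}[\tilde r_i(b^c)]-q_i\ge t_i-\varepsilon\quad\forall i\in N_c,\qquad \sum_{i\in N_c}q_i\ge\sum_{i\in N_c}\mathbb{E}_{b^c\sim\gamma}[\tilde\pi_i(b^c)],$$ and whose value satisfies $\sum_{i\in N_c}\mathbb{E}_{b^c\sim\gamma}[\tilde r_i(b^c)-\tilde\pi_i(b^c)]\ge OPT-\varepsilon$, where $OPT$ is the optimal value of the media agency problem with arbitrary transfers (with the exact IC constraints).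
   Context: Ad auction. There are colluders $N_c=\{1,\dots,n_c\}$ and external agents $N_e=\{1,\dots,n_e\}$, $n=n_c+n_e$ agents in total, and slots $\{1,\dots,m\}$, $m\le n$, with click-through rates $1\ge\lambda_1\ge\dots\ge\lambda_m\ge 0$; set $\lambda_k=0$ for $k>m$. Agent $i$ has valuation $v_i\in[0,1]$; the valuations of the colluders are known. A bidding strategy is a vector $b^c\in B^c:=[0,1]^{n_c}$ of colluders' bids; $b^e\in[0,1]^{n_e}$ is the vector of external bids. Given the full bid profile $b=(b^c,b^e)$, agents are ranked by decreasing bid, and the agent ranked $k$-th gets slot $k$ for $k\le m$ (agents ranked below $m$ get no slot). Ties between a colluder and an external agent are broken in favor of the colluder; ties among colluders are broken by index, with colluders indexed so that $v_1\ge\dots\ge v_{n_c}$. Write $b_{(k)}$ for the $k$-th highest bid ($b_{(n+1)}=0$). An agent $i$ ranked $k$-th has expected revenue $r_i(b)=\lambda_k v_i$, and expected payment - GSP mechanism: $\pi_i(b)=\lambda_k b_{(k+1)}$; - VCG mechanism: $\pi_i(b)=\sum_{j=k+1}^{m+1}b_{(j)}(\lambda_{j-1}-\lambda_j)$ if $k\le m$, and $0$ otherwise. The external profile $b^e$ is drawn from a probability distribution $\gamma^e$ in whose support all bids are representable with $M$ bits (i.e. are integer multiples of $2^{-M}$); $\tilde r_i(b^c)=\mathbb{E}_{b^e\sim\gamma^e}[r_i(b^c,b^e)]$ and $\tilde\pi_i(b^c)=\mathbb{E}_{b^e\sim\gamma^e}[\pi_i(b^c,b^e)]$. Media agency problem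 with arbitrary transfers. Given $t_i\in[0,1]$ for $i\in N_c$, choose a probability distribution $\gamma$ over $B^c$ (randomized bidding strategy) and transfers $q=(q_i)_{i\in N_c}\in\mathbb{R}^{n_c}$ (possibly negative) to maximize $\sum_{i\in N_c}\mathbb{E}_{b^c\sim\gamma}[\tilde r_i(b^c)-\tilde\pi_i(b^c)]$ subject to IC: $\mathbb{E}_{b^c\sim\gamma}[\tilde r_i(b^c)]-q_i\ge t_i$ for all $i\in N_c$, and IR: $\sum_{i\in N_c}q_i\ge\sum_{i\in N_c}\mathbb{E}_{b^c\sim\gamma}[\tilde\pi_i(b^c)]$. Computational model: the algorithm has access to an oracle that, on input $b^c\in B^c$, returns $\tilde r_i(b^c)$ and $\tilde\pi_i(b^c)$ for $i\in N_c$, and it can compute exactly the probabilities $\mathbb{P}_{b^e\sim\gamma^e}\{\exists j\in N_e: b^e_j\in(\alpha,\beta]\}$ for intervals $(\alpha,\beta]\subseteq[0,1]$ (unit cost each). The instance size includes $n$, $m$, $M$ and the binary encoding of the numerical data. *)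

theory Defs
  imports "HOL-Probability.Probability" "HOL-Library.Log_Nat"
begin

section \<open>The ad auction\<close>

text \<open>
  Colluders are \<open>0, \<dots>, n_col - 1\<close> and external agents \<open>0, \<dots>, n_ext - 1\<close>; ranks and slots
  are counted from 1. The valuations of the external agents do not enter the problem.
  The numerical data are rational because the instance size counts their binary encoding;
  the probabilities of the external bid profiles, which the algorithm can access only through
  its oracles, are arbitrary reals. Since external bids are multiples of \<open>2^-precision\<close> in
  \<open>[0,1]\<close>, their distribution is discrete.
\<close>

record auction =
  n_col :: nat
  n_ext :: nat
  n_slots :: nat
  precision :: nat
  slot_rate :: "nat \<Rightarrow> rat"
  val :: "nat \<Rightarrow> rat"
  target :: "nat \<Rightarrow> rat"
  ext_dist :: "(nat \<Rightarrow> real) pmf"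

definition valid_auction :: "auction \<Rightarrow> bool" where
  "valid_auction A \<longleftrightarrow>
     n_slots A \<le> n_col A + n_ext A \<and>
     (\<forall>k\<in>{1..n_slots A}. 0 \<le> slot_rate A k \<and> slot_rate A k \<le> 1) \<and>
     (\<forall>k l. 1 \<le> k \<and> k \<le> l \<and> l \<le> n_slots A \<longrightarrow> slot_rate A l \<le> slot_rate A k) \<and>
     (\<forall>i<n_col A. 0 \<le> val A i \<and> val A i \<le> 1) \<and>
     (\<forall>i j. i \<le> j \<and> j < n_col A \<longrightarrow> val A j \<le> val A i) \<and>
     (\<forall>i<n_col A. 0 \<le> target A i \<and> target A i \<le> 1) \<and>
     (\<forall>be\<in>set_pmf (ext_dist A).
        be \<in> ({..<n_ext A} \<rightarrow>\<^sub>E {0..1}) \<and>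
        (\<forall>j<n_ext A. \<exists>z::int. be j = of_int z / 2 ^ precision A))"

definition ctr :: "auction \<Rightarrow> nat \<Rightarrow> real" where
  "ctr A k = (if 1 \<le> k \<and> k \<le> n_slots A then of_rat (slot_rate A k) else 0)"

type_synonym agent = "nat + nat" \<comment> \<open>\<open>Inl\<close>: colluders, \<open>Inr\<close>: external agents\<close>

definition agents :: "auction \<Rightarrow> agent set" where
  "agents A = Inl ` {..<n_col A} \<union> Inr ` {..<n_ext A}"

text \<open>
  The order among tied external agents is immaterial for the colluders; it is by index.
\<close>

fun tie_before :: "agent \<Rightarrow> agent \<Rightarrow> bool" where
  "tie_before (Inl i) (Inl i') = (i < i')"
| "tie_before (Inl i) (Inr j) = True"
| "tie_before (Inr j) (Inl i) = False"
| "tie_before (Inr j) (Inr j') = (j < j')"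

definition outranks :: "(agent \<Rightarrow> real) \<Rightarrow> agent \<Rightarrow> agent \<Rightarrow> bool" where
  "outranks b x y \<longleftrightarrow> b x > b y \<or> b x = b y \<and> tie_before x y"

definition rank_of :: "auction \<Rightarrow> (agent \<Rightarrow> real) \<Rightarrow> agent \<Rightarrow> nat" where
  "rank_of A b x = Suc (card {y \<in> agents A. outranks b y x})"

definition sorted_bids :: "auction \<Rightarrow> (agent \<Rightarrow> real) \<Rightarrow> real list" where
  "sorted_bids A b =
     rev (sort (map (b \<circ> Inl) [0..<n_col A] @ map (b \<circ> Inr) [0..<n_ext A]))"

definition kth_bid :: "auction \<Rightarrow> (agent \<Rightarrow> real) \<Rightarrow> nat \<Rightarrow> real" where
  "kth_bid A b k =
     (if 1 \<le> k \<and> k \<le> n_col A + n_ext A then sorted_bids A b ! (k - 1) else 0)"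

datatype mechanism = GSP | VCG

definition revenue :: "auction \<Rightarrow> (agent \<Rightarrow> real) \<Rightarrow> nat \<Rightarrow> real" where
  "revenue A b i = ctr A (rank_of A b (Inl i)) * of_rat (val A i)"

fun payment :: "mechanism \<Rightarrow> auction \<Rightarrow> (agent \<Rightarrow> real) \<Rightarrow> nat \<Rightarrow> real" where
  "payment GSP A b i =
     (let k = rank_of A b (Inl i) in ctr A k * kth_bid A b (k + 1))"
| "payment VCG A b i =
     (let k = rank_of A b (Inl i) in
      if k \<le> n_slots A
      then \<Sum>j = k + 1..n_slots A + 1. kth_bid A b j * (ctr A (j - 1) - ctr A j)
      else 0)"

definition exp_revenue :: "auction \<Rightarrow> (nat \<Rightarrow> real) \<Rightarrow> nat \<Rightarrow> real" where
  "exp_revenue A bc i =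
     measure_pmf.expectation (ext_dist A) (\<lambda>be. revenue A (case_sum bc be) i)"

definition exp_payment :: "mechanism \<Rightarrow> auction \<Rightarrow> (nat \<Rightarrow> real) \<Rightarrow> nat \<Rightarrow> real" where
  "exp_payment mech A bc i =
     measure_pmf.expectation (ext_dist A) (\<lambda>be. payment mech A (case_sum bc be) i)"


section \<open>The media agency problem with arbitrary transfers\<close>

definition bid_space :: "auction \<Rightarrow> (nat \<Rightarrow> real) measure" where
  "bid_space A = (\<Pi>\<^sub>M i\<in>{..<n_col A}. restrict_space borel {0..1})"

abbreviation bid_vectors :: "auction \<Rightarrow> (nat \<Rightarrow> real) set" where
  "bid_vectors A \<equiv> {..<n_col A} \<rightarrow>\<^sub>E {0..1}"

definition randomized_strategy :: "auction \<Rightarrow> (nat \<Rightarrow> real) measure \<Rightarrow> bool" where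
  "randomized_strategy A \<gamma> \<longleftrightarrow> prob_space \<gamma> \<and> sets \<gamma> = sets (bid_space A)"

definition agency_value :: "mechanism \<Rightarrow> auction \<Rightarrow> (nat \<Rightarrow> real) measure \<Rightarrow> real" where
  "agency_value mech A \<gamma> =
     (\<Sum>i<n_col A. LINT bc|\<gamma>. exp_revenue A bc i - exp_payment mech A bc i)"

definition eps_IC :: "auction \<Rightarrow> real \<Rightarrow> (nat \<Rightarrow> real) measure \<Rightarrow> (nat \<Rightarrow> real) \<Rightarrow> bool" where
  "eps_IC A \<epsilon> \<gamma> q \<longleftrightarrow>
     (\<forall>i<n_col A. (LINT bc|\<gamma>. exp_revenue A bc i) - q i \<ge> of_rat (target A i) - \<epsilon>)"

definition IR :: "mechanism \<Rightarrow> auction \<Rightarrow> (nat \<Rightarrow> real) measure \<Rightarrow> (nat \<Rightarrow> real) \<Rightarrow> bool" where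
  "IR mech A \<gamma> q \<longleftrightarrow>
     (\<Sum>i<n_col A. q i) \<ge> (\<Sum>i<n_col A. LINT bc|\<gamma>. exp_payment mech A bc i)"

definition OPT :: "mechanism \<Rightarrow> auction \<Rightarrow> real" where
  "OPT mech A =
     Sup {agency_value mech A \<gamma> | \<gamma> q.
            randomized_strategy A \<gamma> \<and> eps_IC A 0 \<gamma> q \<and> IR mech A \<gamma> q}"

definition rat_bits :: "rat \<Rightarrow> nat" where
  "rat_bits x = (case quotient_of x of (a, b) \<Rightarrow> nat (bitlen \<bar>a\<bar>) + nat (bitlen b) + 1)"

definition instance_size :: "auction \<Rightarrow> nat" where
  "instance_size A =
     n_col A + n_ext A + n_slots A + precision A +
     (\<Sum>k=1..n_slots A. rat_bits (slot_rate A k)) +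
     (\<Sum>i<n_col A. rat_bits (val A i)) + (\<Sum>i<n_col A. rat_bits (target A i))"


section \<open>Algorithms with oracles\<close>

text \<open>
  An algorithm is a program of a while language with two-dimensional arrays of natural
  numbers and of exact numbers (a scalar is the entry \<open>(0,0)\<close> of an array). Exact numbers are
  real, since oracle answers are exact expectations and probabilities for an arbitrary external
  distribution. Every executed assignment and test costs one unit; the expressions in a fixed
  program have constant size.

  The arithmetic is restricted to addition, subtraction, halving and comparison, and the only
  real constants are 0 and 1. Without multiplication and rounding, the usual objections to unit
  cost arithmetic do not apply: after \<open>T\<close> steps every exact number is a linear combination of
  \<open>O(T)\<close> input numbers and oracle answers whose coefficients are dyadic with \<open>O(T)\<close> bits, and
  every natural number (in particular every array index) has \<open>O(T)\<close> bits more than the inputs.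
  So unit cost is polynomially related to bit cost whenever \<open>\<epsilon>\<close> and the oracle answers are
  rationals of polynomial length.
\<close>

type_synonym name = string

datatype nexp =
    NConst nat
  | NVar name nexp nexp
  | NAdd nexp nexp
  | NSub nexp nexp

datatype rexp =
    RZero
  | ROne
  | RVar name nexp nexp
  | RAdd rexp rexp
  | RSub rexp rexp
  | RHalf rexp
  | AskRevenue name nexp nexp
  | AskPayment name nexp nexp
  | AskProb rexp rexp

datatype bexp =
    NLess nexp nexp
  | RLess rexp rexp
  | BNot bexp
  | BAnd bexp bexp

datatype com =
    Skip
  | NAssign name nexp nexp nexp
  | RAssign name nexp nexp rexp
  | Seq com com
  | Cond bexp com com
  | While bexp com

record state =
  nmem :: "name \<Rightarrow> nat \<Rightarrow> nat \<Rightarrow> nat"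
  rmem :: "name \<Rightarrow> nat \<Rightarrow> nat \<Rightarrow> real"

record oracles =
  revenue_answer :: "(nat \<Rightarrow> real) \<Rightarrow> nat \<Rightarrow> real"
  payment_answer :: "(nat \<Rightarrow> real) \<Rightarrow> nat \<Rightarrow> real"
  prob_answer :: "real \<Rightarrow> real \<Rightarrow> real"

primrec nval :: "state \<Rightarrow> nexp \<Rightarrow> nat" where
  "nval s (NConst k) = k"
| "nval s (NVar x e f) = nmem s x (nval s e) (nval s f)"
| "nval s (NAdd e f) = nval s e + nval s f"
| "nval s (NSub e f) = nval s e - nval s f"

text \<open>
  \<open>AskRevenue x e f\<close> submits row \<open>e\<close> of array \<open>x\<close> as the colluders' bid vector and returns the
  expected revenue of colluder \<open>f\<close>; \<open>AskPayment\<close> is analogous. \<open>AskProb\<close> returns the probability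
  that some external bid lies in a half-open interval.
\<close>

primrec rval :: "oracles \<Rightarrow> state \<Rightarrow> rexp \<Rightarrow> real" where
  "rval W s RZero = 0"
| "rval W s ROne = 1"
| "rval W s (RVar x e f) = rmem s x (nval s e) (nval s f)"
| "rval W s (RAdd e f) = rval W s e + rval W s f"
| "rval W s (RSub e f) = rval W s e - rval W s f"
| "rval W s (RHalf e) = rval W s e / 2"
| "rval W s (AskRevenue x e f) = revenue_answer W (rmem s x (nval s e)) (nval s f)"
| "rval W s (AskPayment x e f) = payment_answer W (rmem s x (nval s e)) (nval s f)"
| "rval W s (AskProb e f) = prob_answer W (rval W s e) (rval W s f)"

primrec bval :: "oracles \<Rightarrow> state \<Rightarrow> bexp \<Rightarrow> bool" where
  "bval W s (NLess e f) = (nval s e < nval s f)"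
| "bval W s (RLess e f) = (rval W s e < rval W s f)"
| "bval W s (BNot e) = (\<not> bval W s e)"
| "bval W s (BAnd e f) = (bval W s e \<and> bval W s f)"

definition update :: "(name \<Rightarrow> nat \<Rightarrow> nat \<Rightarrow> 'a) \<Rightarrow> name \<Rightarrow> nat \<Rightarrow> nat \<Rightarrow> 'a \<Rightarrow>
    (name \<Rightarrow> nat \<Rightarrow> nat \<Rightarrow> 'a)" where
  "update mem x i j a = mem(x := (mem x)(i := (mem x i)(j := a)))"

text \<open>\<open>runs W c s T s'\<close>: started in \<open>s\<close>, the program \<open>c\<close> halts in \<open>s'\<close> after \<open>T\<close> steps.\<close>

inductive runs :: "oracles \<Rightarrow> com \<Rightarrow> state \<Rightarrow> nat \<Rightarrow> state \<Rightarrow> bool" for W where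
  runs_Skip: "runs W Skip s 1 s"
| runs_NAssign: "runs W (NAssign x e f g) s 1
    (s\<lparr>nmem := update (nmem s) x (nval s e) (nval s f) (nval s g)\<rparr>)"
| runs_RAssign: "runs W (RAssign x e f g) s 1
    (s\<lparr>rmem := update (rmem s) x (nval s e) (nval s f) (rval W s g)\<rparr>)"
| runs_Seq: "runs W c s T s' \<Longrightarrow> runs W d s' T' s'' \<Longrightarrow> runs W (Seq c d) s (T + T') s''"
| runs_CondT: "bval W s b \<Longrightarrow> runs W c s T s' \<Longrightarrow> runs W (Cond b c d) s (T + 1) s'"
| runs_CondF: "\<not> bval W s b \<Longrightarrow> runs W d s T s' \<Longrightarrow> runs W (Cond b c d) s (T + 1) s'"
| runs_WhileF: "\<not> bval W s b \<Longrightarrow> runs W (While b c) s 1 s"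
| runs_WhileT: "bval W s b \<Longrightarrow> runs W c s T s' \<Longrightarrow> runs W (While b c) s' T' s'' \<Longrightarrow>
    runs W (While b c) s (T + T' + 1) s''"

text \<open>Calls outside the domain of an oracle are answered by 0.\<close>

definition auction_oracles :: "mechanism \<Rightarrow> auction \<Rightarrow> oracles" where
  "auction_oracles mech A =
    \<lparr> revenue_answer = (\<lambda>b i. let bc = restrict b {..<n_col A} in
        if bc \<in> bid_vectors A \<and> i < n_col A then exp_revenue A bc i else 0),
      payment_answer = (\<lambda>b i. let bc = restrict b {..<n_col A} in
        if bc \<in> bid_vectors A \<and> i < n_col A then exp_payment mech A bc i else 0),
      prob_answer = (\<lambda>\<alpha> \<beta>. if 0 \<le> \<alpha> \<and> \<alpha> \<le> \<beta> \<and> \<beta> \<le> 1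
        then measure_pmf.prob (ext_dist A) {be. \<exists>j<n_ext A. be j \<in> {\<alpha><..\<beta>}} else 0) \<rparr>"

definition input_state :: "auction \<Rightarrow> real \<Rightarrow> state" where
  "input_state A \<epsilon> =
    \<lparr> nmem = (\<lambda>x i j.
        if i \<noteq> 0 \<or> j \<noteq> 0 then 0
        else if x = ''n_col'' then n_col A
        else if x = ''n_ext'' then n_ext A
        else if x = ''n_slots'' then n_slots A
        else if x = ''precision'' then precision A
        else 0),
      rmem = (\<lambda>x i j.
        if i \<noteq> 0 then 0
        else if x = ''epsilon'' \<and> j = 0 then \<epsilon>
        else if x = ''slot_rate'' \<and> 1 \<le> j \<and> j \<le> n_slots A then of_rat (slot_rate A j)
        else if x = ''val'' \<and> j < n_col A then of_rat (val A j)
        else if x = ''target'' \<and> j < n_col A then of_rat (target A j)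
        else 0) \<rparr>"

text \<open>
  The returned distribution is given by its atoms: atom \<open>k < n_atoms\<close> is row \<open>k\<close> of
  \<open>''bids''\<close> and has probability \<open>''prob'' (0,k)\<close>.
\<close>

abbreviation out_atoms :: "state \<Rightarrow> nat" where
  "out_atoms s \<equiv> nmem s ''n_atoms'' 0 0"

abbreviation out_prob :: "state \<Rightarrow> nat \<Rightarrow> real" where
  "out_prob s k \<equiv> rmem s ''prob'' 0 k"

abbreviation out_bids :: "auction \<Rightarrow> state \<Rightarrow> nat \<Rightarrow> nat \<Rightarrow> real" where
  "out_bids A s k \<equiv> restrict (rmem s ''bids'' k) {..<n_col A}"

definition returns :: "auction \<Rightarrow> state \<Rightarrow> (nat \<Rightarrow> real) measure \<Rightarrow> (nat \<Rightarrow> real) \<Rightarrow> bool" where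
  "returns A s \<gamma> q \<longleftrightarrow>
     (\<forall>k<out_atoms s. 0 \<le> out_prob s k \<and> out_bids A s k \<in> bid_vectors A) \<and>
     (\<Sum>k<out_atoms s. out_prob s k) = 1 \<and>
     \<gamma> = distr (point_measure {..<out_atoms s} (\<lambda>k. ennreal (out_prob s k)))
           (bid_space A) (out_bids A s) \<and>
     q = rmem s ''transfer'' 0"

end

theory Submission
  imports Defs
begin

text \<open>
  With arbitrary transfers, IC can be made tight and IR then says that the expected coalition
  utility is at least the sum of the targets. Hence it suffices to find one bid vector whose
  coalition utility is within \<open>\<epsilon>\<close> of the maximum; the slack \<open>\<epsilon>\<close> in each IC constraint pays for
  the loss in IR.

  By the rearrangement inequality the bids may be assumed to decrease with the index of the
  colluder. Rounding them down to a grid can only lower the payments as long as no external bid is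
  jumped over, so the loss is at most \<open>2 n\<^sup>2 \<delta>\<close> (with \<open>n\<close> colluders) if every interval between a
  bid and its rounding contains an external bid with probability at most \<open>\<delta>\<close>. Such a grid of size
  linear in the product of the number of external agents, the precision and \<open>1/\<delta>\<close> is found by bisecting dyadic
  intervals. Finally, for decreasing bids
  \<open>b\<^sub>0 \<ge> \<dots> \<ge> b\<^sub>n\<^sub>-\<^sub>1\<close> the utility \<open>U(b)\<close> is \<open>U(b\<^sub>0,\<dots>,b\<^sub>0)\<close> plus the sum over \<open>0 < i < n\<close> of
  \<open>U(b\<^sub>i\<^sub>-\<^sub>1,\<dots>,b\<^sub>i\<^sub>-\<^sub>1,b\<^sub>i,\<dots>,b\<^sub>i) - U(b\<^sub>i\<^sub>-\<^sub>1,\<dots>,b\<^sub>i\<^sub>-\<^sub>1)\<close>, where the first vector has \<open>i\<close> entries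
  \<open>b\<^sub>i\<^sub>-\<^sub>1\<close>. So maximizing over the grid is a longest path problem whose edge lengths are obtained from
  the oracles.
\<close>

section \<open>Ranks, bids and payments\<close>

text \<open>Utility jumps when a bid crosses an external bid, so no grid of fixed spacing comparable
  to \<open>\<epsilon>\<close> is good enough, while the multiples of \<open>2^-M\<close>, which
  would do, are exponentially many. Hence the grid depends on the distribution and is refined only
  where the oracle reports a probability above \<open>\<delta>\<close>. That answer concerns a union
  of events and is not additive over intervals; splits are therefore counted against the sum of the
  individual probabilities over the external agents, which is additive, dominates the answer and
  totals at most \<open>n_ext A\<close>. A second obstacle is that the payment of one colluder
  depends on the bids of the others. The path decomposition is possible because the bid of colluder
  \<open>i - 1\<close> fixes a rank that separates the profile: lowering the bids behind it changes
  each colluder's utility by an amount that does not depend on the bids ahead of it, so this change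
  may be computed with all those bids set to \<open>b\<^sub>i\<^sub>-\<^sub>1\<close>.\<close>

lemma nth_ge_iff_length_filter:
  fixes ys :: "'a::linorder list"
  assumes "sorted_wrt (\<ge>) ys" "k < length ys"
  shows "z \<le> ys ! k \<longleftrightarrow> k < length (filter (\<lambda>x. z \<le> x) ys)"
  using assms
proof (induction ys arbitrary: k)
  case Nil
  then show ?case by simp
next
  case (Cons y ys)
  have *: "filter (\<lambda>x. z \<le> x) ys = []" if "\<not> z \<le> y"
    using that Cons.prems(1) by (auto simp: filter_empty_conv)
  show ?case
  proof (cases k)
    case 0
    then show ?thesis using * by auto
  next
    case (Suc l)
    with Cons show ?thesis using * by (auto dest: nth_mem)
  qed
qed

lemma card_agents_Collect:
  "card {y \<in> agents A. P y} = card {i. i < n_col A \<and> P (Inl i)} + card {j. j < n_ext A \<and> P (Inr j)}"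
proof -
  have "{y \<in> agents A. P y} =
      Inl ` {i. i < n_col A \<and> P (Inl i)} \<union> Inr ` {j. j < n_ext A \<and> P (Inr j)}"
    by (auto simp: agents_def)
  then show ?thesis
    by (subst (asm) eq_commute, subst card_Un_disjoint[symmetric, of "Inl ` _" "Inr ` _", simplified card_image inj_Inl inj_Inr])
      (auto simp: card_image)
qed

definition num_ge :: "auction \<Rightarrow> (nat \<Rightarrow> real) \<Rightarrow> (nat \<Rightarrow> real) \<Rightarrow> real \<Rightarrow> nat" where
  "num_ge A b be z = card {i. i < n_col A \<and> z \<le> b i} + card {j. j < n_ext A \<and> z \<le> be j}"

text \<open>The inequality is strict because a colluder wins ties against external agents.\<close>

definition ext_above :: "auction \<Rightarrow> (nat \<Rightarrow> real) \<Rightarrow> real \<Rightarrow> nat" where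
  "ext_above A be x = card {j. j < n_ext A \<and> x < be j}"

abbreviation kth :: "auction \<Rightarrow> (nat \<Rightarrow> real) \<Rightarrow> (nat \<Rightarrow> real) \<Rightarrow> nat \<Rightarrow> real" where
  "kth A b be \<equiv> kth_bid A (case_sum b be)"

lemma length_filter_upt: "length (filter P [0..<n]) = card {i. i < n \<and> P i}"
  by (simp add: length_filter_conv_card cong: conj_cong)

text \<open>Counting replaces sorting: this equivalence determines the order statistics, and later
  facts about them become comparisons of the level counts \<open>num_ge\<close>.\<close>

lemma kth_ge_iff:
  assumes "1 \<le> k" "k \<le> n_col A + n_ext A"
  shows "z \<le> kth A b be k \<longleftrightarrow> k \<le> num_ge A b be z"
proof -
  let ?xs = "map b [0..<n_col A] @ map be [0..<n_ext A]"
  have sb: "sorted_bids A (case_sum b be) = rev (sort ?xs)"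
    by (simp add: sorted_bids_def comp_def)
  have "sorted_wrt (\<ge>) (rev (sort ?xs))"
    by (simp add: sorted_wrt_rev)
  then have "z \<le> rev (sort ?xs) ! (k - 1) \<longleftrightarrow> k - 1 < length (filter (\<lambda>x. z \<le> x) (rev (sort ?xs)))"
    using assms by (intro nth_ge_iff_length_filter) auto
  also have "length (filter (\<lambda>x. z \<le> x) (rev (sort ?xs))) = length (filter (\<lambda>x. z \<le> x) ?xs)"
    by (metis mset_filter mset_rev mset_sort size_mset)
  also have "\<dots> = num_ge A b be z"
    by (simp add: num_ge_def filter_map comp_def length_filter_upt)
  finally show ?thesis
    using assms by (auto simp: kth_bid_def sb)
qed

lemma kth_outside: "\<not> (1 \<le> k \<and> k \<le> n_col A + n_ext A) \<Longrightarrow> kth_bid A b k = 0"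
  by (auto simp: kth_bid_def)

text \<open>Indirect inequality: take for \<open>z\<close> the left-hand side itself. Outside the
  valid ranks both sides have the default value 0.\<close>

lemma kth_le_kthI:
  assumes "\<And>z. k \<le> num_ge A b be z \<Longrightarrow> k \<le> num_ge A b' be' z"
  shows "kth A b be k \<le> kth A b' be' k"
  using kth_ge_iff[of k A] assms kth_outside[of k A]
  by (cases "1 \<le> k \<and> k \<le> n_col A + n_ext A") force+

lemma kth_eqI:
  assumes "\<And>z. k \<le> num_ge A b be z \<longleftrightarrow> k \<le> num_ge A b' be' z"
  shows "kth A b be k = kth A b' be' k"
  using assms by (intro antisym kth_le_kthI) auto

lemma kth_mono:
  assumes "\<And>i. i < n_col A \<Longrightarrow> b i \<le> b' i"
  shows "kth A b be k \<le> kth A b' be k"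
proof (rule kth_le_kthI)
  fix z
  have "card {i. i < n_col A \<and> z \<le> b i} \<le> card {i. i < n_col A \<and> z \<le> b' i}"
    using assms by (intro card_mono) force+
  then show "k \<le> num_ge A b be z \<Longrightarrow> k \<le> num_ge A b' be z"
    by (simp add: num_ge_def)
qed

lemma kth_bounds:
  assumes "\<And>i. i < n_col A \<Longrightarrow> b i \<in> {0..1}" "\<And>j. j < n_ext A \<Longrightarrow> be j \<in> {0..1}"
  shows "0 \<le> kth A b be k" "kth A b be k \<le> 1"
proof -
  have "0 \<le> kth A b be k \<and> kth A b be k \<le> 1"
  proof (cases "1 \<le> k \<and> k \<le> n_col A + n_ext A")
    case True
    have "{i. i < n_col A \<and> 0 \<le> b i} = {..<n_col A}" "{j. j < n_ext A \<and> 0 \<le> be j} = {..<n_ext A}"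
      using assms by auto
    then have "0 \<le> kth A b be k"
      using True kth_ge_iff[of k A 0 b be] by (simp add: num_ge_def)
    moreover have "kth A b be k \<le> 1"
    proof (rule ccontr)
      let ?z = "kth A b be k"
      assume "\<not> ?z \<le> 1"
      then have "{i. i < n_col A \<and> ?z \<le> b i} = {}" "{j. j < n_ext A \<and> ?z \<le> be j} = {}"
        using assms by force+
      then have "num_ge A b be ?z = 0"
        unfolding num_ge_def by (metis add_0 card.empty)
      then show False
        using True kth_ge_iff[of k A ?z b be] by simp
    qed
    ultimately show ?thesis by simp
  qed (auto simp: kth_outside)
  then show "0 \<le> kth A b be k" "kth A b be k \<le> 1" by auto
qed

abbreviation decreasing_on :: "nat \<Rightarrow> (nat \<Rightarrow> real) \<Rightarrow> bool" where
  "decreasing_on n b \<equiv> \<forall>i j. i \<le> j \<and> j < n \<longrightarrow> b j \<le> b i"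

lemma rank_of_colluder:
  "rank_of A (case_sum b be) (Inl i) =
     Suc (card {i'. i' < n_col A \<and> (b i < b i' \<or> b i = b i' \<and> i' < i)} + ext_above A be (b i))"
  unfolding rank_of_def card_agents_Collect ext_above_def outranks_def
  by (simp add: eq_commute[of "b i"])

text \<open>With decreasing bids the colluders ahead of \<open>i\<close> are exactly those of
  smaller index, because ties among colluders also go to the smaller index.\<close>

lemma rank_of_decreasing:
  assumes "decreasing_on (n_col A) b" "i < n_col A"
  shows "rank_of A (case_sum b be) (Inl i) = Suc (i + ext_above A be (b i))"
proof -
  have "i' < n_col A \<and> (b i < b i' \<or> b i = b i' \<and> i' < i) \<longleftrightarrow> i' < i" for i'
  proof (cases "i' < i")
    case True
    then have "b i \<le> b i'" using assms by simp
    then show ?thesis using True assms(2) by auto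
  next
    case False
    then have "i' < n_col A \<Longrightarrow> b i' \<le> b i" using assms(1) by simp
    then show ?thesis using False by auto
  qed
  then have "{i'. i' < n_col A \<and> (b i < b i' \<or> b i = b i' \<and> i' < i)} = {..<i}"
    by (simp add: lessThan_def)
  then show ?thesis by (simp add: rank_of_colluder)
qed

lemma ext_above_antimono: "x \<le> y \<Longrightarrow> ext_above A be y \<le> ext_above A be x"
  unfolding ext_above_def by (intro card_mono) auto

text \<open>Separates the rank from the ordered bids, so that either can be varied alone. An agent
  without a slot needs no case of its own under VCG: the sum is then empty.\<close>

fun rank_payment :: "mechanism \<Rightarrow> auction \<Rightarrow> (nat \<Rightarrow> real) \<Rightarrow> nat \<Rightarrow> real" where
  "rank_payment GSP A f k = ctr A k * f (k + 1)"
| "rank_payment VCG A f k = (\<Sum>j = k + 1..n_slots A + 1. f j * (ctr A (j - 1) - ctr A j))"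

lemma payment_eq:
  "payment mech A b i = rank_payment mech A (kth_bid A b) (rank_of A b (Inl i))"
  by (cases mech) (auto simp: Let_def)

lemma rank_payment_cong:
  assumes "\<And>l. k < l \<Longrightarrow> f l = g l"
  shows "rank_payment mech A f k = rank_payment mech A g k"
  using assms by (cases mech) (auto intro!: sum.cong)

text \<open>
  Moving the bids at ranks beyond \<open>\<kappa>\<close> changes the payments at all earlier ranks by the same
  amount, and this amount depends only on the bids at ranks beyond \<open>\<kappa>\<close>.
\<close>

lemma rank_payment_diff:
  assumes "\<And>l. l \<le> \<kappa> \<Longrightarrow> f l = g l" "\<And>l. l \<le> \<kappa> \<Longrightarrow> f' l = g' l"
    and "\<And>l. \<kappa> < l \<Longrightarrow> f l = f' l" "\<And>l. \<kappa> < l \<Longrightarrow> g l = g' l"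
    and "k < \<kappa>" "k' < \<kappa>"
  shows "rank_payment mech A f k - rank_payment mech A g k =
         rank_payment mech A f' k' - rank_payment mech A g' k'"
proof (cases mech)
  case GSP
  then show ?thesis using assms by simp
next
  case VCG
  let ?d = "\<lambda>j. ctr A (j - 1) - ctr A j"
  have *: "(\<Sum>j = k + 1..n_slots A + 1. f j * ?d j) - (\<Sum>j = k + 1..n_slots A + 1. g j * ?d j) =
      (\<Sum>j = \<kappa> + 1..n_slots A + 1. f j * ?d j - g j * ?d j)"
    if "\<And>l. l \<le> \<kappa> \<Longrightarrow> f l = g l" "k < \<kappa>" for f g k
    unfolding sum_subtractf[symmetric]
  proof (rule sum.mono_neutral_right)
    show "\<forall>i\<in>{k + 1..n_slots A + 1} - {\<kappa> + 1..n_slots A + 1}. f i * ?d i - g i * ?d i = 0"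
    proof
      fix i assume "i \<in> {k + 1..n_slots A + 1} - {\<kappa> + 1..n_slots A + 1}"
      then have "i \<le> \<kappa>" by auto
      then show "f i * ?d i - g i * ?d i = 0" using that(1)[of i] by simp
    qed
  qed (use that in auto)
  show ?thesis
    using VCG *[of f g k] *[of f' g' k'] assms
    by (auto intro!: sum.cong)
qed

locale valid_instance =
  fixes A :: auction
  assumes valid: "valid_auction A"
begin

lemma ctr_nonneg: "0 \<le> ctr A k" and ctr_le_1: "ctr A k \<le> 1"
  using valid by (auto simp: ctr_def valid_auction_def)

lemma ctr_antimono: "1 \<le> k \<Longrightarrow> k \<le> l \<Longrightarrow> ctr A l \<le> ctr A k"
  using valid by (auto simp: ctr_def valid_auction_def of_rat_less_eq)

lemma val_bounds: "i < n_col A \<Longrightarrow> 0 \<le> val A i" "i < n_col A \<Longrightarrow> val A i \<le> 1"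
  using valid by (auto simp: valid_auction_def)

lemma val_antimono: "i \<le> j \<Longrightarrow> j < n_col A \<Longrightarrow> val A j \<le> val A i"
  using valid by (auto simp: valid_auction_def)

lemma ext_bid_bounds:
  "be \<in> set_pmf (ext_dist A) \<Longrightarrow> j < n_ext A \<Longrightarrow> be j \<in> {0..1}"
  using valid by (fastforce simp: valid_auction_def PiE_iff)

lemma finite_ext_support: "finite (set_pmf (ext_dist A))"
proof (rule finite_subset)
  let ?G = "(\<lambda>z. of_int z / 2 ^ precision A :: real) ` {0..2 ^ precision A}"
  show "set_pmf (ext_dist A) \<subseteq> {..<n_ext A} \<rightarrow>\<^sub>E ?G"
  proof
    fix be assume be: "be \<in> set_pmf (ext_dist A)"
    have "be j \<in> ?G" if "j < n_ext A" for j
    proof -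
      from valid have "\<forall>be\<in>set_pmf (ext_dist A). \<forall>j<n_ext A. \<exists>z::int. be j = of_int z / 2 ^ precision A"
        by (simp add: valid_auction_def)
      with be that obtain z :: int where z: "be j = of_int z / 2 ^ precision A"
        by blast
      have "0 \<le> be j" "be j \<le> 1" using ext_bid_bounds[OF be that] by auto
      moreover have "real_of_int z = be j * 2 ^ precision A"
        by (simp add: z)
      ultimately have "0 \<le> (of_int z :: real)" "(of_int z :: real) \<le> of_int (2 ^ precision A)"
        by (simp_all add: mult_left_le_one_le)
      then have "z \<in> {0..2 ^ precision A}"
        unfolding of_int_le_iff of_int_0_le_iff by auto
      then show ?thesis using z by auto
    qed
    moreover have "be \<in> {..<n_ext A} \<rightarrow>\<^sub>E {0..1}"
      using valid be by (auto simp: valid_auction_def)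
    ultimately show "be \<in> {..<n_ext A} \<rightarrow>\<^sub>E ?G"
      by (auto simp: PiE_iff)
  qed
  show "finite ({..<n_ext A} \<rightarrow>\<^sub>E ?G)"
    by (intro finite_PiE) auto
qed

lemma rank_payment_mono:
  assumes "1 \<le> k" "\<And>l. f l \<le> g l"
  shows "rank_payment mech A f k \<le> rank_payment mech A g k"
proof (cases mech)
  case GSP
  then show ?thesis using assms ctr_nonneg by (simp add: mult_left_mono)
next
  case VCG
  have "f j * (ctr A (j - 1) - ctr A j) \<le> g j * (ctr A (j - 1) - ctr A j)"
    if "j \<in> {k + 1..n_slots A + 1}" for j
    \<comment> \<open>\<open>1 \<le> k\<close> keeps \<open>j - 1\<close> among the genuine ranks.
      Since \<open>ctr A 0\<close> is 0, the weight at \<open>j = 1\<close> could be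
      negative.\<close>
    using assms that by (intro mult_right_mono) (auto intro!: ctr_antimono)
  then show ?thesis
    unfolding VCG rank_payment.simps by (rule sum_mono)
qed

text \<open>Monotonicity reduces both bounds to constant bid sequences; for the constant 1 the VCG
  weights telescope to a difference of two rates.\<close>

lemma rank_payment_bounds:
  assumes "1 \<le> k" "\<And>l. 0 \<le> f l" "\<And>l. f l \<le> 1"
  shows "0 \<le> rank_payment mech A f k" "rank_payment mech A f k \<le> 1"
proof -
  have "rank_payment mech A (\<lambda>_. 0) k \<le> rank_payment mech A f k"
    "rank_payment mech A f k \<le> rank_payment mech A (\<lambda>_. 1) k"
    using assms by (auto intro!: rank_payment_mono)
  moreover have "rank_payment mech A (\<lambda>_. 0) k = 0"
    by (cases mech) auto
  moreover have "rank_payment mech A (\<lambda>_. 1) k \<le> 1"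
  proof (cases mech)
    case VCG
    show ?thesis
    proof (cases "k \<le> n_slots A")
      case True
      have "(\<Sum>j = Suc k..Suc (n_slots A). ctr A (j - 1) - ctr A j) =
          (\<Sum>j = k..n_slots A. ctr A j - ctr A (Suc j))"
        by (simp only: sum.shift_bounds_cl_Suc_ivl) simp
      also have "\<dots> = ctr A k - ctr A (Suc (n_slots A))"
        using sum_Suc_diff[of k "n_slots A" "\<lambda>j. - ctr A j"] True by simp
      also have "\<dots> \<le> 1"
        using ctr_le_1[of k] ctr_nonneg[of "Suc (n_slots A)"] by simp
      finally show ?thesis using VCG by simp
    qed (use VCG in simp)
  qed (use ctr_le_1 in simp)
  ultimately show "0 \<le> rank_payment mech A f k" "rank_payment mech A f k \<le> 1" by auto
qed

end

section \<open>Ordered bids on either side of a cut in the profile\<close>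

lemma num_ge_lower:
  assumes "z \<le> x" "i \<le> n_col A" "\<And>j. j < i \<Longrightarrow> x \<le> q j"
  shows "i + ext_above A be x \<le> num_ge A q be z"
proof -
  have "card {..<i} \<le> card {l. l < n_col A \<and> z \<le> q l}"
    using assms by (intro card_mono) (auto intro: order_trans)
  moreover have "ext_above A be x \<le> card {j. j < n_ext A \<and> z \<le> be j}"
    unfolding ext_above_def using assms(1) by (intro card_mono) auto
  ultimately show ?thesis by (simp add: num_ge_def)
qed

lemma num_ge_upper:
  assumes "x < z" "\<And>j. i \<le> j \<Longrightarrow> j < n_col A \<Longrightarrow> q j \<le> x"
  shows "num_ge A q be z \<le> i + ext_above A be x"
proof -
  have "j < i" if "j < n_col A" "z \<le> q j" for j
    using assms(2)[of j] assms(1) that by (cases "i \<le> j") auto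
  then have "card {l. l < n_col A \<and> z \<le> q l} \<le> card {..<i}"
    by (intro card_mono) auto
  moreover have "card {j. j < n_ext A \<and> z \<le> be j} \<le> ext_above A be x"
    unfolding ext_above_def using assms(1) by (intro card_mono) auto
  ultimately show ?thesis by (simp add: num_ge_def)
qed

lemma num_ge_cong:
  assumes "\<And>l. l < n_col A \<Longrightarrow> z \<le> q l \<longleftrightarrow> z \<le> q' l"
  shows "num_ge A q be z = num_ge A q' be z"
proof -
  have "{l. l < n_col A \<and> z \<le> q l} = {l. l < n_col A \<and> z \<le> q' l}"
    using assms by blast
  then show ?thesis by (simp add: num_ge_def)
qed

text \<open>Rank \<open>i + ext_above A be x\<close> is the cut. Thresholds up to \<open>x\<close>
  are met by at least that many bids in either profile; above \<open>x\<close> only the first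
  \<open>i\<close> colluders and the external agents can count, and there the profiles
  agree.\<close>

lemma kth_eq_above:
  assumes "i \<le> n_col A" "\<And>j. j < i \<Longrightarrow> x \<le> q j" "\<And>j. j < i \<Longrightarrow> q j = q' j"
    and "\<And>j. i \<le> j \<Longrightarrow> j < n_col A \<Longrightarrow> q j \<le> x" "\<And>j. i \<le> j \<Longrightarrow> j < n_col A \<Longrightarrow> q' j \<le> x"
    and "l \<le> i + ext_above A be x"
  shows "kth A q be l = kth A q' be l"
proof (rule kth_eqI)
  fix z
  show "l \<le> num_ge A q be z \<longleftrightarrow> l \<le> num_ge A q' be z"
  proof (cases "z \<le> x")
    case True
    have "i + ext_above A be x \<le> num_ge A q be z" "i + ext_above A be x \<le> num_ge A q' be z"
      using assms True by (auto intro!: num_ge_lower)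
    then show ?thesis using assms(6) by auto
  next
    case False
    have "num_ge A q be z = num_ge A q' be z"
    proof (rule num_ge_cong)
      fix l assume "l < n_col A"
      then show "z \<le> q l \<longleftrightarrow> z \<le> q' l"
        using assms(3)[of l] assms(4)[of l] assms(5)[of l] False by (cases "l < i") auto
    qed
    then show ?thesis by simp
  qed
qed

text \<open>Mirror image: thresholds above \<open>x\<close> are met by too few bids to matter beyond
  the cut, and for those up to \<open>x\<close> the first \<open>i\<close> colluders all count in
  both profiles.\<close>

lemma kth_eq_below:
  assumes "\<And>j. j < i \<Longrightarrow> x \<le> q j" "\<And>j. j < i \<Longrightarrow> x \<le> q' j"
    and "\<And>j. i \<le> j \<Longrightarrow> j < n_col A \<Longrightarrow> q j \<le> x"
    and "\<And>j. i \<le> j \<Longrightarrow> j < n_col A \<Longrightarrow> q j = q' j"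
    and "i + ext_above A be x < l"
  shows "kth A q be l = kth A q' be l"
proof (rule kth_eqI)
  fix z
  show "l \<le> num_ge A q be z \<longleftrightarrow> l \<le> num_ge A q' be z"
  proof (cases "z \<le> x")
    case False
    then have "num_ge A q be z \<le> i + ext_above A be x" "num_ge A q' be z \<le> i + ext_above A be x"
      using assms by (auto intro!: num_ge_upper)
    then show ?thesis using assms(5) by auto
  next
    case True
    have "num_ge A q be z = num_ge A q' be z"
    proof (rule num_ge_cong)
      fix l assume "l < n_col A"
      then show "z \<le> q l \<longleftrightarrow> z \<le> q' l"
        using assms(1)[of l] assms(2)[of l] assms(4)[of l] True by (cases "l < i") auto
    qed
    then show ?thesis by simp
  qed
qed

section \<open>Coalition utility of an outcome\<close>

definition outcome_utility ::
    "mechanism \<Rightarrow> auction \<Rightarrow> (nat \<Rightarrow> real) \<Rightarrow> (nat \<Rightarrow> real) \<Rightarrow> real" where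
  "outcome_utility mech A b be =
     (\<Sum>i<n_col A. revenue A (case_sum b be) i - payment mech A (case_sum b be) i)"

definition coalition_utility :: "mechanism \<Rightarrow> auction \<Rightarrow> (nat \<Rightarrow> real) \<Rightarrow> real" where
  "coalition_utility mech A b = (\<Sum>i<n_col A. exp_revenue A b i - exp_payment mech A b i)"

abbreviation step_bids :: "nat \<Rightarrow> real \<Rightarrow> real \<Rightarrow> nat \<Rightarrow> real" where
  "step_bids i x y \<equiv> \<lambda>j. if j < i then x else y"

text \<open>
  The profiles below agree either above or below the bid \<open>x\<close> of colluder \<open>i - 1\<close>, whose rank
  is the same in all of them.
\<close>

lemma outcome_utility_exchange:
  assumes i: "0 < i" "i \<le> n_col A" and p: "decreasing_on i p" and x: "x = p (i - 1)" and yx: "y \<le> x"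
  defines "pre \<equiv> \<lambda>y j. if j < i then p j else y"
  shows "outcome_utility mech A (pre y) be - outcome_utility mech A (pre x) be =
    outcome_utility mech A (step_bids i x y) be - outcome_utility mech A (\<lambda>_. x) be"
proof -
  let ?n = "n_col A" and ?K = "i + ext_above A be x"
  let ?E = "ext_above A be" and ?s = "step_bids i x y" and ?c = "\<lambda>_::nat. x"
  have px: "x \<le> p j" if "j < i" for j
    using p i that by (auto simp: x)
  have pd: "decreasing_on ?n (pre z)" if "z \<le> x" for z
    unfolding pre_def using p px that by (auto intro: order_trans)
  have sd: "decreasing_on ?n ?s" "decreasing_on ?n ?c"
    using yx by auto
  have above: "kth A (pre y) be l = kth A (pre x) be l" "kth A ?s be l = kth A ?c be l"
    if "l \<le> ?K" for l
    by (rule kth_eq_above[where x = x and i = i]; use that i px yx in \<open>force simp: pre_def\<close>)+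
  have below: "kth A (pre y) be l = kth A ?s be l" "kth A (pre x) be l = kth A ?c be l"
    if "?K < l" for l
    by (rule kth_eq_below[where x = x and i = i]; use that i px yx in \<open>force simp: pre_def\<close>)+
  let ?u = "\<lambda>b j. revenue A (case_sum b be) j - payment mech A (case_sum b be) j"
  have "?u (pre y) j - ?u (pre x) j = ?u ?s j - ?u ?c j" if j: "j < ?n" for j
  proof -
    \<comment> \<open>\<open>?K\<close> is the common rank of colluder \<open>i - 1\<close>. Earlier
      colluders have a smaller rank, which may differ between \<open>pre\<close> and the step
      profile but is the same for both tails. Later ones have a larger rank and see only the ranks
      beyond the cut, where \<open>pre\<close> and the step profile agree.\<close>
    consider "j < i - 1" | "j = i - 1" | "i \<le> j" by linarith
    then show ?thesis
    proof cases
      case 1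
      have "?E (p j) \<le> ?E x" using 1 px by (intro ext_above_antimono) auto
      then have k: "Suc (j + ?E (p j)) < ?K" "Suc (j + ?E x) < ?K" using 1 by auto
      have "rank_payment mech A (kth A (pre y) be) (Suc (j + ?E (p j)))
          - rank_payment mech A (kth A (pre x) be) (Suc (j + ?E (p j))) =
        rank_payment mech A (kth A ?s be) (Suc (j + ?E x)) - rank_payment mech A (kth A ?c be) (Suc (j + ?E x))"
        by (rule rank_payment_diff[where \<kappa> = ?K]; use above below k in force)
      moreover have "j < i" using 1 by simp
      ultimately show ?thesis
        using j pd[OF yx] pd[of x] sd
        by (simp add: payment_eq revenue_def rank_of_decreasing pre_def)
    next
      case 2
      have "rank_payment mech A (kth A (pre y) be) ?K = rank_payment mech A (kth A ?s be) ?K"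
        "rank_payment mech A (kth A (pre x) be) ?K = rank_payment mech A (kth A ?c be) ?K"
        by (rule rank_payment_cong; use below in force)+
      then show ?thesis
        using 2 i j pd[OF yx] pd[of x] sd
        by (simp add: payment_eq revenue_def rank_of_decreasing pre_def x)
    next
      case 3
      have "?E x \<le> ?E y" using yx by (rule ext_above_antimono)
      then have "?K < Suc (j + ?E y)" "?K < Suc (j + ?E x)" using 3 by auto
      then have "rank_payment mech A (kth A (pre y) be) (Suc (j + ?E y))
          = rank_payment mech A (kth A ?s be) (Suc (j + ?E y))"
        "rank_payment mech A (kth A (pre x) be) (Suc (j + ?E x))
          = rank_payment mech A (kth A ?c be) (Suc (j + ?E x))"
        by (intro rank_payment_cong below; linarith)+
      then show ?thesis
        using 3 j pd[OF yx] pd[of x] sd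
        by (simp add: payment_eq revenue_def rank_of_decreasing pre_def)
    qed
  qed
  then show ?thesis
    unfolding outcome_utility_def sum_subtractf[symmetric] by (intro sum.cong) auto
qed

section \<open>Rearrangement and sorting of the colluders' bids\<close>

lemma sum_antimono_le_initial:
  fixes v :: "nat \<Rightarrow> real"
  assumes "decreasing_on n v" "S \<subseteq> {..<n}"
  shows "sum v S \<le> sum v {..<card S}"
  using assms(2)
proof (induction "card S" arbitrary: S)
  case 0
  then have "S = {}" using finite_subset[of S] by auto
  then show ?case by simp
next
  case (Suc k)
  have fin: "finite S" using Suc.prems by (rule finite_subset) simp
  have ne: "S \<noteq> {}" using Suc.hyps(2) by auto
  let ?m = "Max S"
  have m: "?m \<in> S" using fin ne by simp
  \<comment> \<open>A set of \<open>Suc k\<close> indices has maximum at least \<open>k\<close>, so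
    the value removed with it is at most \<open>v k\<close>, the last value of the initial
    segment.\<close>
  have "S \<subseteq> {..?m}" using fin by auto
  then have "card S \<le> Suc ?m" using card_mono[of "{..?m}" S] by simp
  then have "v ?m \<le> v k" using Suc.hyps(2) m Suc.prems assms(1) by auto
  moreover have "sum v (S - {?m}) \<le> sum v {..<card (S - {?m})}"
    using Suc.hyps Suc.prems m fin by (intro Suc.hyps(1)) auto
  moreover have "card (S - {?m}) = k" using Suc.hyps(2) m fin by simp
  ultimately show ?case
    using m fin Suc.hyps(2)[symmetric] by (simp add: sum.remove)
qed

text \<open>Abel summation: with decreasing weights and nonnegative partial sums, \<open>w k\<close>
  times the partial sum stays below the weighted sum at every stage. The vanishing total makes this
  lower bound 0 at the end.\<close>

lemma abel_sum_nonneg: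
  fixes w d :: "nat \<Rightarrow> real"
  assumes "decreasing_on n w" "\<And>k. k \<le> n \<Longrightarrow> 0 \<le> (\<Sum>j<k. d j)" "(\<Sum>j<n. d j) = 0"
  shows "0 \<le> (\<Sum>j<n. w j * d j)"
proof -
  have "w k * (\<Sum>j<Suc k. d j) \<le> (\<Sum>j<Suc k. w j * d j)" if "k < n" for k
    using that
  proof (induction k)
    case 0
    then show ?case by simp
  next
    case (Suc k)
    have "w (Suc k) * (\<Sum>j<Suc k. d j) \<le> w k * (\<Sum>j<Suc k. d j)"
      using Suc.prems assms(1) assms(2)[of "Suc k"] by (intro mult_right_mono) auto
    with Suc show ?case by (simp add: algebra_simps)
  qed
  from this[of "n - 1"] show ?thesis
    using assms(3) by (cases n) auto
qed

text \<open>The differences \<open>v j - v (\<tau> j)\<close> have nonnegative partial sums, since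
  an initial segment maximizes the sum of \<open>v\<close> among the sets of its size, and their
  total is 0.\<close>

lemma rearrangement:
  fixes w v :: "nat \<Rightarrow> real"
  assumes w: "decreasing_on n w" and v: "decreasing_on n v" and \<tau>: "bij_betw \<tau> {..<n} {..<n}"
  shows "(\<Sum>j<n. w j * v (\<tau> j)) \<le> (\<Sum>j<n. w j * v j)"
proof -
  have "(\<Sum>j<k. v (\<tau> j)) \<le> (\<Sum>j<k. v j)" if "k \<le> n" for k
  proof -
    have inj: "inj_on \<tau> {..<k}"
      using bij_betw_imp_inj_on[OF \<tau>] by (rule inj_on_subset) (use that in auto)
    have "\<tau> ` {..<k} \<subseteq> {..<n}"
      using \<tau> that by (auto simp: bij_betw_def)
    from sum_antimono_le_initial[OF v this] show ?thesis
      by (simp add: sum.reindex[OF inj] card_image[OF inj])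
  qed
  moreover have "(\<Sum>j<n. v (\<tau> j)) = (\<Sum>j<n. v j)"
    by (rule sum.reindex_bij_betw[OF \<tau>])
  ultimately have "0 \<le> (\<Sum>j<n. w j * (v j - v (\<tau> j)))"
    by (intro abel_sum_nonneg[OF w]) (auto simp: sum_subtractf)
  then show ?thesis by (simp add: right_diff_distrib sum_subtractf)
qed

text \<open>\<open>S i\<close> collects the predecessors of \<open>i\<close> in a strict linear
  order, so its cardinality is the position of \<open>i\<close>; this map is injective, hence a
  permutation, and \<open>\<tau>\<close> is its inverse. The last clause has the form of the count
  in \<open>rank_of_colluder\<close>, ties included.\<close>

lemma ex_sorting:
  fixes b :: "nat \<Rightarrow> real"
  obtains \<tau> where "bij_betw \<tau> {..<n} {..<n}" "decreasing_on n (b \<circ> \<tau>)"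
    "\<And>j. j < n \<Longrightarrow> card {i'. i' < n \<and> (b (\<tau> j) < b i' \<or> b (\<tau> j) = b i' \<and> i' < \<tau> j)} = j"
proof -
  define S where "S i = {i'. i' < n \<and> (b i < b i' \<or> b i = b i' \<and> i' < i)}" for i
  have fin: "finite (S i)" for i by (simp add: S_def)
  have less: "card (S i) < card (S i')" if "i \<in> S i'" for i i'
  proof (rule psubset_card_mono[OF fin])
    have "S i \<subseteq> S i'" using that by (force simp: S_def)
    moreover have "i \<notin> S i" by (simp add: S_def)
    ultimately show "S i \<subset> S i'" using that by blast
  qed
  have total: "i \<in> S i' \<or> i' \<in> S i" if "i < n" "i' < n" "i \<noteq> i'" for i i'
    using that by (auto simp: S_def)
  have "inj_on (\<lambda>i. card (S i)) {..<n}"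
    using total less by (force intro!: inj_onI)
  moreover have "(\<lambda>i. card (S i)) ` {..<n} \<subseteq> {..<n}"
  proof
    fix k assume "k \<in> (\<lambda>i. card (S i)) ` {..<n}"
    then obtain i where i: "i < n" "k = card (S i)" by auto
    have "S i \<subset> {..<n}" using i by (auto simp: S_def)
    from psubset_card_mono[OF _ this] show "k \<in> {..<n}" using i by simp
  qed
  ultimately have bij: "bij_betw (\<lambda>i. card (S i)) {..<n} {..<n}"
    by (simp add: bij_betw_def endo_inj_surj)
  define \<tau> where "\<tau> = inv_into {..<n} (\<lambda>i. card (S i))"
  have \<tau>: "bij_betw \<tau> {..<n} {..<n}"
    unfolding \<tau>_def by (rule bij_betw_inv_into[OF bij])
  have pos: "card (S (\<tau> j)) = j" if "j < n" for j
    using bij_betw_inv_into_right[OF bij, of j] that by (simp add: \<tau>_def)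
  have "b (\<tau> j) \<le> b (\<tau> i)" if "i \<le> j" "j < n" for i j
  proof (rule ccontr)
    assume "\<not> b (\<tau> j) \<le> b (\<tau> i)"
    moreover have "\<tau> j < n" using \<tau> that by (auto simp: bij_betw_def)
    ultimately have "\<tau> j \<in> S (\<tau> i)" by (simp add: S_def)
    from less[OF this] show False using pos that by simp
  qed
  with \<tau> pos show thesis by (intro that[of \<tau>]) (auto simp: S_def)
qed

context valid_instance
begin

text \<open>Permuting the colluders' bids permutes the ranks held by the coalition and leaves the
  ordered bids alone, so the total payment is unchanged, and rearrangement gives the better slots to
  the higher valuations. The permutation depends on \<open>b\<close> only, so one \<open>b'\<close>
  serves all external profiles.\<close>

lemma outcome_utility_sort:
  obtains b' where "decreasing_on (n_col A) b'" "\<And>i. i < n_col A \<Longrightarrow> b' i \<in> b ` {..<n_col A}"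
    "\<And>be. outcome_utility mech A b be \<le> outcome_utility mech A b' be"
proof -
  let ?n = "n_col A"
  obtain \<tau> where \<tau>: "bij_betw \<tau> {..<?n} {..<?n}" and dec: "decreasing_on ?n (b \<circ> \<tau>)" and
    pos: "\<And>j. j < ?n \<Longrightarrow> card {i'. i' < ?n \<and> (b (\<tau> j) < b i' \<or> b (\<tau> j) = b i' \<and> i' < \<tau> j)} = j"
    using ex_sorting[of ?n b] by blast
  have mem: "\<tau> j < ?n" if "j < ?n" for j
    using \<tau> that by (auto simp: bij_betw_def)
  have "outcome_utility mech A b be \<le> outcome_utility mech A (b \<circ> \<tau>) be" for be
  proof -
    let ?k = "\<lambda>j. Suc (j + ext_above A be (b (\<tau> j)))"
    have r: "rank_of A (case_sum b be) (Inl (\<tau> j)) = ?k j"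
      "rank_of A (case_sum (b \<circ> \<tau>) be) (Inl j) = ?k j" if "j < ?n" for j
      using rank_of_colluder[of A b be "\<tau> j"] rank_of_decreasing[OF dec that] pos[OF that] by (auto simp: o_def)
    have kth: "kth A (b \<circ> \<tau>) be = kth A b be"
    proof
      fix k
      show "kth A (b \<circ> \<tau>) be k = kth A b be k"
      proof (rule kth_eqI)
        fix z
        have "bij_betw \<tau> {j. j < ?n \<and> z \<le> b (\<tau> j)} {j. j < ?n \<and> z \<le> b j}"
        proof (rule bij_betw_imageI)
          show "inj_on \<tau> {j. j < ?n \<and> z \<le> b (\<tau> j)}"
            using bij_betw_imp_inj_on[OF \<tau>] by (rule inj_on_subset) auto
          have "\<tau> ` {..<?n} = {..<?n}"
            using \<tau> by (simp add: bij_betw_def)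
          moreover have "\<tau> ` {j. j < ?n \<and> z \<le> b (\<tau> j)} = \<tau> ` {..<?n} \<inter> {j. z \<le> b j}"
            by blast
          ultimately show "\<tau> ` {j. j < ?n \<and> z \<le> b (\<tau> j)} = {j. j < ?n \<and> z \<le> b j}"
            by auto
        qed
        then show "k \<le> num_ge A (b \<circ> \<tau>) be z \<longleftrightarrow> k \<le> num_ge A b be z"
          by (simp add: num_ge_def bij_betw_same_card)
      qed
    qed
    have "outcome_utility mech A b be =
        (\<Sum>j<?n. revenue A (case_sum b be) (\<tau> j) - payment mech A (case_sum b be) (\<tau> j))"
      unfolding outcome_utility_def by (rule sum.reindex_bij_betw[OF \<tau>, symmetric])
    also have "\<dots> = (\<Sum>j<?n. ctr A (?k j) * of_rat (val A (\<tau> j)))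
        - (\<Sum>j<?n. rank_payment mech A (kth A b be) (?k j))"
      by (simp add: sum_subtractf[symmetric] revenue_def payment_eq r)
    also have "(\<Sum>j<?n. ctr A (?k j) * of_rat (val A (\<tau> j))) \<le> (\<Sum>j<?n. ctr A (?k j) * of_rat (val A j))"
    proof (rule rearrangement[OF _ _ \<tau>])
      show "decreasing_on ?n (\<lambda>j. of_rat (val A j))"
        using val_antimono by (simp add: of_rat_less_eq)
      show "decreasing_on ?n (\<lambda>j. ctr A (?k j))"
        using dec by (auto intro!: ctr_antimono add_mono ext_above_antimono)
    qed
    also have "\<dots> - (\<Sum>j<?n. rank_payment mech A (kth A b be) (?k j)) = outcome_utility mech A (b \<circ> \<tau>) be"
      by (simp add: outcome_utility_def sum_subtractf[symmetric] revenue_def payment_eq r kth)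
    finally show ?thesis by simp
  qed
  with dec mem show thesis by (intro that[of "b \<circ> \<tau>"]) auto
qed

text \<open>No external bid lies between a bid and its rounding, so ranks and revenues stay, while
  the ordered bids and with them the payments can only fall.\<close>

lemma outcome_utility_round_le:
  assumes "decreasing_on (n_col A) b" "decreasing_on (n_col A) b'"
    and "\<And>i. i < n_col A \<Longrightarrow> b' i \<le> b i"
    and "\<And>i j. i < n_col A \<Longrightarrow> j < n_ext A \<Longrightarrow> be j \<notin> {b' i<..b i}"
  shows "outcome_utility mech A b be \<le> outcome_utility mech A b' be"
  unfolding outcome_utility_def
proof (rule sum_mono)
  fix i assume i: "i \<in> {..<n_col A}"
  then have "{j. j < n_ext A \<and> b i < be j} = {j. j < n_ext A \<and> b' i < be j}"
    using assms(3)[of i] assms(4)[of i] by force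
  then have "ext_above A be (b i) = ext_above A be (b' i)"
    by (simp add: ext_above_def)
  then have r: "rank_of A (case_sum b be) (Inl i) = rank_of A (case_sum b' be) (Inl i)"
    using i assms by (simp add: rank_of_decreasing)
  moreover have "rank_payment mech A (kth A b' be) (rank_of A (case_sum b' be) (Inl i))
      \<le> rank_payment mech A (kth A b be) (rank_of A (case_sum b' be) (Inl i))"
    using assms(3) by (intro rank_payment_mono kth_mono) (auto simp: rank_of_def)
  ultimately show "revenue A (case_sum b be) i - payment mech A (case_sum b be) i
      \<le> revenue A (case_sum b' be) i - payment mech A (case_sum b' be) i"
    by (simp add: revenue_def payment_eq)
qed

lemma outcome_bounds:
  assumes "be \<in> set_pmf (ext_dist A)" "\<And>i. i < n_col A \<Longrightarrow> b i \<in> {0..1}" "i < n_col A"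
  shows "revenue A (case_sum b be) i \<in> {0..1}" "payment mech A (case_sum b be) i \<in> {0..1}"
proof -
  show "revenue A (case_sum b be) i \<in> {0..1}"
    using val_bounds[OF assms(3)] ctr_nonneg ctr_le_1
    by (auto simp: revenue_def intro!: mult_le_one)
  have "0 \<le> kth A b be l" "kth A b be l \<le> 1" for l
    using kth_bounds[of A b be l] assms(2) ext_bid_bounds[OF assms(1)] by auto
  then show "payment mech A (case_sum b be) i \<in> {0..1}"
    unfolding payment_eq by (auto intro!: rank_payment_bounds simp: rank_of_def)
qed

lemma outcome_utility_bounds:
  assumes "be \<in> set_pmf (ext_dist A)" "\<And>i. i < n_col A \<Longrightarrow> b i \<in> {0..1}"
  shows "\<bar>outcome_utility mech A b be\<bar> \<le> n_col A"
proof -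
  have "\<bar>outcome_utility mech A b be\<bar> \<le>
      (\<Sum>i<n_col A. \<bar>revenue A (case_sum b be) i - payment mech A (case_sum b be) i\<bar>)"
    unfolding outcome_utility_def by (rule sum_abs)
  also have "\<dots> \<le> (\<Sum>i<n_col A. 1)"
  proof (rule sum_mono)
    fix i assume "i \<in> {..<n_col A}"
    then have "revenue A (case_sum b be) i \<in> {0..1}" "payment mech A (case_sum b be) i \<in> {0..1}"
      using outcome_bounds(1)[OF assms, where i = i] outcome_bounds(2)[OF assms, where i = i]
      by auto
    then show "\<bar>revenue A (case_sum b be) i - payment mech A (case_sum b be) i\<bar> \<le> 1"
      by auto
  qed
  finally show ?thesis by simp
qed

lemma coalition_utility_expectation:
  "coalition_utility mech A b = measure_pmf.expectation (ext_dist A) (outcome_utility mech A b)"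
  unfolding coalition_utility_def outcome_utility_def exp_revenue_def exp_payment_def
  by (simp add: integrable_measure_pmf_finite finite_ext_support)

lemma coalition_utility_mono:
  assumes "\<And>be. outcome_utility mech A b be \<le> outcome_utility mech A b' be"
  shows "coalition_utility mech A b \<le> coalition_utility mech A b'"
  unfolding coalition_utility_expectation using assms
  by (intro integral_mono integrable_measure_pmf_finite finite_ext_support)

lemma coalition_utility_exchange:
  assumes "0 < i" "i \<le> n_col A" "decreasing_on i p" "x = p (i - 1)" "y \<le> x"
  shows "coalition_utility mech A (\<lambda>j. if j < i then p j else y)
      - coalition_utility mech A (\<lambda>j. if j < i then p j else x) =
    coalition_utility mech A (step_bids i x y) - coalition_utility mech A (\<lambda>_. x)"
proof -
  have int: "integrable (ext_dist A) f" for f :: "_ \<Rightarrow> real"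
    by (intro integrable_measure_pmf_finite finite_ext_support)
  show ?thesis
    unfolding coalition_utility_expectation
    by (simp only: Bochner_Integration.integral_diff[OF int int, symmetric]
        outcome_utility_exchange[OF assms])
qed

abbreviation ext_prob :: "real \<Rightarrow> real \<Rightarrow> real" where
  "ext_prob \<alpha> \<beta> \<equiv> measure_pmf.prob (ext_dist A) {be. \<exists>j<n_ext A. be j \<in> {\<alpha><..\<beta>}}"

text \<open>The bad event is that some external bid falls between some bid and its rounding. Its
  probability is at most \<open>n \<delta>\<close> by a union bound over the \<open>n\<close>
  colluders, and on it the two utilities, each of absolute value at most \<open>n\<close>, differ by
  at most \<open>2 n\<close>.\<close>

lemma coalition_utility_round:
  assumes b: "decreasing_on (n_col A) b" "\<And>i. i < n_col A \<Longrightarrow> b i \<in> {0..1}"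
    and b': "decreasing_on (n_col A) b'" "\<And>i. i < n_col A \<Longrightarrow> b' i \<in> {0..1}"
    and le: "\<And>i. i < n_col A \<Longrightarrow> b' i \<le> b i"
    and close: "\<And>i. i < n_col A \<Longrightarrow> ext_prob (b' i) (b i) \<le> \<delta>"
  shows "coalition_utility mech A b \<le> coalition_utility mech A b' + 2 * (real (n_col A))\<^sup>2 * \<delta>"
proof -
  let ?n = "n_col A"
  have int: "integrable (ext_dist A) f" for f :: "_ \<Rightarrow> real"
    by (intro integrable_measure_pmf_finite finite_ext_support)
  let ?B = "\<Union>i<?n. {be. \<exists>j<n_ext A. be j \<in> {b' i<..b i}}"
  have "measure_pmf.expectation (ext_dist A) (outcome_utility mech A b) \<le>
      measure_pmf.expectation (ext_dist A) (\<lambda>be. outcome_utility mech A b' be + 2 * ?n * indicat_real ?B be)"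
  proof (rule integral_mono_AE[OF int int], unfold AE_measure_pmf_iff, rule ballI)
    fix be assume be: "be \<in> set_pmf (ext_dist A)"
    show "outcome_utility mech A b be \<le> outcome_utility mech A b' be + 2 * ?n * indicat_real ?B be"
    proof (cases "be \<in> ?B")
      case True
      have "\<bar>outcome_utility mech A b be\<bar> \<le> ?n" "\<bar>outcome_utility mech A b' be\<bar> \<le> ?n"
        using be b(2) b'(2) by (auto intro!: outcome_utility_bounds simp del: atLeastAtMost_iff)
      then have "outcome_utility mech A b be \<le> outcome_utility mech A b' be + 2 * ?n" by linarith
      then show ?thesis using True by simp
    next
      case False
      then have "outcome_utility mech A b be \<le> outcome_utility mech A b' be"
        by (intro outcome_utility_round_le b b' le) auto
      then show ?thesis using False by simp
    qed
  qed
  also have "\<dots> = coalition_utility mech A b' + 2 * ?n * measure_pmf.prob (ext_dist A) ?B"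
    unfolding coalition_utility_expectation by (simp add: int)
  also have "measure_pmf.prob (ext_dist A) ?B \<le> (\<Sum>i<?n. ext_prob (b' i) (b i))"
    by (intro measure_pmf.finite_measure_subadditive_finite) auto
  also have "(\<Sum>i<?n. ext_prob (b' i) (b i)) \<le> ?n * \<delta>"
    using sum_bounded_above[of "{..<?n}" _ \<delta>] close by simp
  finally have "coalition_utility mech A b \<le> coalition_utility mech A b' + 2 * ?n * (?n * \<delta>)"
    unfolding coalition_utility_expectation[of mech b] by (simp add: mult_left_mono)
  then show ?thesis by (simp add: power2_eq_square mult.assoc)
qed

section \<open>Randomized strategies\<close>

lemma space_bid_space: "space (bid_space A) = bid_vectors A"
  by (simp add: bid_space_def space_PiM space_restrict_space)

lemma measurable_bid: 
  assumes "i < n_col A"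
  shows "(\<lambda>b. b i) \<in> borel_measurable (bid_space A)"
proof -
  have "(\<lambda>b. b i) \<in> measurable (bid_space A) (restrict_space borel {0..1})"
    unfolding bid_space_def using assms by (intro measurable_component_singleton) simp
  then show ?thesis by (simp add: measurable_restrict_space2_iff)
qed

lemma measurable_agent_bid:
  assumes "y \<in> agents A"
  shows "(\<lambda>b. case_sum b be y) \<in> borel_measurable (bid_space A)"
  using assms measurable_bid by (cases y) (auto simp: agents_def)

text \<open>Ranks and level counts are cardinalities of this form, so measurability of outcomes
  reduces to comparisons of bids.\<close>

lemma measurable_card_Collect:
  assumes "finite Y" "\<And>y. y \<in> Y \<Longrightarrow> Measurable.pred M (\<lambda>b. P b y)"
  shows "(\<lambda>b. card {y \<in> Y. P b y}) \<in> measurable M (count_space UNIV)"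
proof -
  have "card {y \<in> Y. P b y} = (\<Sum>y\<in>Y. if P b y then 1 else 0)" for b
    using assms(1) by (simp add: sum.If_cases Int_def)
  then show ?thesis
    using assms by (simp cong: measurable_cong) measurable
qed

lemma finite_agents: "finite (agents A)"
  by (simp add: agents_def)

lemma measurable_rank_of:
  assumes "i < n_col A"
  shows "(\<lambda>b. rank_of A (case_sum b be) (Inl i)) \<in> measurable (bid_space A) (count_space UNIV)"
proof -
  have "(\<lambda>b. card {y \<in> agents A. outranks (case_sum b be) y (Inl i)})
      \<in> measurable (bid_space A) (count_space UNIV)"
  proof (intro measurable_card_Collect finite_agents)
    fix y assume "y \<in> agents A"
    note [measurable] = measurable_agent_bid[OF this] measurable_bid[OF assms]
    have "Measurable.pred (bid_space A) (\<lambda>b. b i < case_sum b be y)"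
      "Measurable.pred (bid_space A) (\<lambda>b. case_sum b be y < b i)"
      by measurable
    then show "Measurable.pred (bid_space A) (\<lambda>b. outranks (case_sum b be) y (Inl i))"
      \<comment> \<open>Equality of two bids is rewritten as the failure of both strict comparisons,
        whose measurability has just been shown.\<close>
      unfolding outranks_def sum.case order_eq_iff not_less[symmetric]
      by (cases "tie_before y (Inl i)") (auto intro: pred_intros_logic)
  qed
  then show ?thesis
    unfolding rank_of_def by (rule measurable_compose) simp
qed

lemma measurable_kth: "(\<lambda>b. kth A b be k) \<in> borel_measurable (bid_space A)"
proof (cases "1 \<le> k \<and> k \<le> n_col A + n_ext A")
  case True
  note [measurable] = measurable_agent_bid
  have eq: "z \<le> kth A b be k \<longleftrightarrow> k \<le> card {y \<in> agents A. z \<le> case_sum b be y}" for z b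
    using kth_ge_iff[of k A z b be] True by (simp add: card_agents_Collect num_ge_def)
  have [measurable]: "(\<lambda>b. card {y \<in> agents A. z \<le> case_sum b be y})
      \<in> measurable (bid_space A) (count_space UNIV)" for z
    by (intro measurable_card_Collect finite_agents) measurable
  show ?thesis
    unfolding borel_measurable_iff_ge eq by measurable
qed (simp add: kth_outside)

lemma measurable_revenue:
  assumes "i < n_col A"
  shows "(\<lambda>b. revenue A (case_sum b be) i) \<in> borel_measurable (bid_space A)"
  unfolding revenue_def
  by (rule measurable_compose[OF measurable_rank_of[OF assms]]) simp

text \<open>The rank takes countably many values, so it is enough to treat the payment at a fixed
  rank.\<close>

lemma measurable_payment:
  assumes "i < n_col A"
  shows "(\<lambda>b. payment mech A (case_sum b be) i) \<in> borel_measurable (bid_space A)"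
  unfolding payment_eq
proof (rule measurable_compose_countable[OF _ measurable_rank_of[OF assms]])
  fix k
  note [measurable] = measurable_kth
  show "(\<lambda>b. rank_payment mech A (kth A b be) k) \<in> borel_measurable (bid_space A)"
    by (cases mech) (simp_all, measurable)
qed

text \<open>Finite support makes the expectation a finite sum, and so measurability in the
  colluders' bids carries over from single outcomes.\<close>

lemma expectation_ext_dist:
  "measure_pmf.expectation (ext_dist A) f = (\<Sum>be\<in>set_pmf (ext_dist A). pmf (ext_dist A) be * f be)"
  for f :: "_ \<Rightarrow> real"
  by (subst integral_measure_pmf[OF finite_ext_support]) auto

lemma measurable_exp_revenue:
  "i < n_col A \<Longrightarrow> (\<lambda>b. exp_revenue A b i) \<in> borel_measurable (bid_space A)"
  unfolding exp_revenue_def expectation_ext_dist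
  by (intro borel_measurable_sum borel_measurable_times measurable_revenue) auto

lemma measurable_exp_payment:
  "i < n_col A \<Longrightarrow> (\<lambda>b. exp_payment mech A b i) \<in> borel_measurable (bid_space A)"
  unfolding exp_payment_def expectation_ext_dist
  by (intro borel_measurable_sum borel_measurable_times measurable_payment) auto

lemma expectation_ext_bounds:
  fixes f :: "_ \<Rightarrow> real"
  assumes "\<And>be. be \<in> set_pmf (ext_dist A) \<Longrightarrow> f be \<in> {0..1}"
  shows "measure_pmf.expectation (ext_dist A) f \<in> {0..1}"
proof -
  have "measure_pmf.expectation (ext_dist A) f \<le> measure_pmf.expectation (ext_dist A) (\<lambda>_. 1)"
    by (rule integral_mono_AE)
      (use assms in \<open>auto simp: AE_measure_pmf_iff intro!: integrable_measure_pmf_finite finite_ext_support\<close>)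
  moreover have "0 \<le> measure_pmf.expectation (ext_dist A) f"
    by (rule integral_nonneg_AE) (use assms in \<open>auto simp: AE_measure_pmf_iff\<close>)
  ultimately show ?thesis by simp
qed

lemma exp_bounds:
  assumes "b \<in> bid_vectors A" "i < n_col A"
  shows "exp_revenue A b i \<in> {0..1}" "exp_payment mech A b i \<in> {0..1}"
  unfolding exp_revenue_def exp_payment_def
  using assms by (auto intro!: expectation_ext_bounds outcome_bounds simp del: atLeastAtMost_iff)

lemma integrable_strategy:
  assumes "randomized_strategy A \<gamma>" "i < n_col A"
  shows "integrable \<gamma> (\<lambda>b. exp_revenue A b i)" "integrable \<gamma> (\<lambda>b. exp_payment mech A b i)"
proof -
  interpret prob_space \<gamma> using assms by (simp add: randomized_strategy_def)
  have s: "sets \<gamma> = sets (bid_space A)"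
    using assms by (simp add: randomized_strategy_def)
  then have sp: "space \<gamma> = bid_vectors A"
    using sets_eq_imp_space_eq space_bid_space by metis
  have m: "f \<in> borel_measurable \<gamma> \<longleftrightarrow> f \<in> borel_measurable (bid_space A)" for f :: "_ \<Rightarrow> real"
    using measurable_cong_sets[OF s refl] by blast
  show "integrable \<gamma> (\<lambda>b. exp_revenue A b i)"
    using exp_bounds(1)[OF _ assms(2)] measurable_exp_revenue[OF assms(2)]
    by (intro integrable_const_bound[of _ 1]) (auto simp: m sp intro!: AE_I2)
  show "integrable \<gamma> (\<lambda>b. exp_payment mech A b i)"
    using exp_bounds(2)[OF _ assms(2)] measurable_exp_payment[OF assms(2)]
    by (intro integrable_const_bound[of _ 1]) (auto simp: m sp intro!: AE_I2)
qed

text \<open>The value is an average of coalition utilities, so randomization cannot beat the best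
  single bid vector. Transfers do not occur in the objective, hence the bound applies to every
  feasible pair.\<close>

lemma agency_value_le:
  assumes "randomized_strategy A \<gamma>" "\<And>b. b \<in> bid_vectors A \<Longrightarrow> coalition_utility mech A b \<le> u"
  shows "agency_value mech A \<gamma> \<le> u"
proof -
  interpret prob_space \<gamma> using assms by (simp add: randomized_strategy_def)
  have sp: "space \<gamma> = bid_vectors A"
    using assms(1) sets_eq_imp_space_eq space_bid_space by (metis randomized_strategy_def)
  have int: "integrable \<gamma> (\<lambda>b. exp_revenue A b i - exp_payment mech A b i)" if "i < n_col A" for i
    using integrable_strategy[OF assms(1) that] by auto
  have "agency_value mech A \<gamma> = (LINT b|\<gamma>. coalition_utility mech A b)"
    unfolding agency_value_def coalition_utility_def
    by (rule Bochner_Integration.integral_sum[symmetric]) (use int in auto)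
  also have "\<dots> \<le> (LINT b|\<gamma>. u)"
    by (rule integral_mono) (use int assms(2) sp in \<open>auto simp: coalition_utility_def\<close>)
  finally show ?thesis by (simp add: prob_space)
qed

lemma point_mass:
  assumes "b \<in> bid_vectors A"
  shows "randomized_strategy A (return (bid_space A) b)"
    and "agency_value mech A (return (bid_space A) b) = coalition_utility mech A b"
    and "i < n_col A \<Longrightarrow> (LINT b'|return (bid_space A) b. exp_revenue A b' i) = exp_revenue A b i"
    and "i < n_col A \<Longrightarrow> (LINT b'|return (bid_space A) b. exp_payment mech A b' i) = exp_payment mech A b i"
proof -
  have b: "b \<in> space (bid_space A)" using assms by (simp add: space_bid_space)
  have i: "(LINT b'|return (bid_space A) b. f b') = f b" if "f \<in> borel_measurable (bid_space A)"
    for f :: "_ \<Rightarrow> real"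
    using integral_return[OF b that] .
  show "randomized_strategy A (return (bid_space A) b)"
    using b by (simp add: randomized_strategy_def prob_space_return)
  show "agency_value mech A (return (bid_space A) b) = coalition_utility mech A b"
    unfolding agency_value_def coalition_utility_def
    by (intro sum.cong refl i borel_measurable_diff measurable_exp_revenue measurable_exp_payment) auto
  show "i < n_col A \<Longrightarrow> (LINT b'|return (bid_space A) b. exp_revenue A b' i) = exp_revenue A b i"
    and "i < n_col A \<Longrightarrow> (LINT b'|return (bid_space A) b. exp_payment mech A b' i) = exp_payment mech A b i"
    by (auto intro!: i measurable_exp_revenue measurable_exp_payment)
qed

text \<open>
  A single bid vector with nearly maximal coalition utility is all that is needed: transfers can
  be chosen to make every IC constraint tight, and then IR only concerns the coalition utility.
\<close>

lemma point_mass_near_optimal: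
  assumes \<epsilon>: "0 < \<epsilon>"
    and feasible: "\<exists>b0\<in>bid_vectors A. \<forall>i<n_col A.
      of_rat (target A i) \<le> exp_revenue A b0 i - exp_payment mech A b0 i"
    and b: "b \<in> bid_vectors A"
    and opt: "\<And>b'. b' \<in> bid_vectors A \<Longrightarrow> coalition_utility mech A b' \<le> coalition_utility mech A b + \<epsilon>"
    and q: "\<And>i. i < n_col A \<Longrightarrow> q i = exp_revenue A b i - of_rat (target A i) + \<epsilon>"
  defines "\<gamma> \<equiv> return (bid_space A) b"
  shows "randomized_strategy A \<gamma>" "eps_IC A \<epsilon> \<gamma> q" "IR mech A \<gamma> q"
    "agency_value mech A \<gamma> \<ge> OPT mech A - \<epsilon>"
proof -
  let ?n = "n_col A" and ?U = "coalition_utility mech A"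
  obtain b0 where b0: "b0 \<in> bid_vectors A"
    "\<And>i. i < ?n \<Longrightarrow> of_rat (target A i) \<le> exp_revenue A b0 i - exp_payment mech A b0 i"
    using feasible by blast
  show "randomized_strategy A \<gamma>"
    unfolding \<gamma>_def by (rule point_mass[OF b])
  show "eps_IC A \<epsilon> \<gamma> q"
    unfolding eps_IC_def \<gamma>_def by (simp add: point_mass[OF b] q)
  have t: "(\<Sum>i<?n. of_rat (target A i)) \<le> ?U b0"
    unfolding coalition_utility_def using b0 by (intro sum_mono) auto
  show "IR mech A \<gamma> q"
  proof (cases "?n = 0")
    case False
    \<comment> \<open>The transfers contain \<open>?n\<close> copies of \<open>\<epsilon>\<close>,
      and one of them covers the loss in utility; this takes at least one colluder.\<close>
    have "1 * \<epsilon> \<le> ?n * \<epsilon>" using False \<epsilon> by (intro mult_right_mono) auto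
    then have "(\<Sum>i<?n. of_rat (target A i)) \<le> ?U b + ?n * \<epsilon>"
      using t opt[OF b0(1)] by linarith
    then show ?thesis
      unfolding IR_def \<gamma>_def
      by (simp add: point_mass[OF b] q coalition_utility_def sum.distrib sum_subtractf)
  qed (simp add: IR_def)
  \<comment> \<open>Tight transfers at \<open>b0\<close> are feasible, so the set whose supremum is
    \<open>OPT\<close> is nonempty, as \<open>cSup_least\<close> requires.\<close>
  let ?q0 = "\<lambda>i. exp_revenue A b0 i - of_rat (target A i)"
  have "randomized_strategy A (return (bid_space A) b0)"
    by (rule point_mass[OF b0(1)])
  moreover have "eps_IC A 0 (return (bid_space A) b0) ?q0"
    unfolding eps_IC_def by (simp add: point_mass[OF b0(1)])
  moreover have "IR mech A (return (bid_space A) b0) ?q0"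
    using t unfolding IR_def
    by (simp add: point_mass[OF b0(1)] coalition_utility_def sum.distrib sum_subtractf)
  ultimately have "OPT mech A \<le> ?U b + \<epsilon>"
    unfolding OPT_def by (intro cSup_least) (blast, use agency_value_le opt in blast)
  then show "agency_value mech A \<gamma> \<ge> OPT mech A - \<epsilon>"
    unfolding \<gamma>_def by (simp add: point_mass[OF b])
qed

text \<open>With a single atom of probability 1, the prescribed output format, an image of a point
  measure, is a Dirac measure.\<close>

lemma returns_point_mass:
  assumes "out_atoms s = 1" "out_prob s 0 = 1" "out_bids A s 0 \<in> bid_vectors A"
  shows "returns A s (return (bid_space A) (out_bids A s 0)) (rmem s ''transfer'' 0)"
proof -
  let ?P = "point_measure {..<1::nat} (\<lambda>k. ennreal (out_prob s k))"
  have m: "out_bids A s \<in> measurable ?P (bid_space A)"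
    using assms by (auto simp: measurable_point_measure_eq1 space_bid_space)
  have "distr ?P (bid_space A) (out_bids A s) = return (bid_space A) (out_bids A s 0)"
  proof (rule measure_eqI)
    fix X assume "X \<in> sets (distr ?P (bid_space A) (out_bids A s))"
    then have X: "X \<in> sets (bid_space A)" by simp
    have "emeasure (distr ?P (bid_space A) (out_bids A s)) X =
        emeasure ?P (out_bids A s -` X \<inter> space ?P)"
      by (rule emeasure_distr[OF m X])
    also have "\<dots> = (\<Sum>k\<in>out_bids A s -` X \<inter> {..<1}. ennreal (out_prob s k))"
      by (subst emeasure_point_measure_finite) (auto simp: space_point_measure)
    also have "out_bids A s -` X \<inter> {..<1} = (if out_bids A s 0 \<in> X then {0} else {})"
      by auto
    also have "(\<Sum>k\<in>(if out_bids A s 0 \<in> X then {0} else {}). ennreal (out_prob s k)) =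
        indicator X (out_bids A s 0)"
      using assms(2) by simp
    also have "\<dots> = emeasure (return (bid_space A) (out_bids A s 0)) X"
      using X by simp
    finally show "emeasure (distr ?P (bid_space A) (out_bids A s)) X =
        emeasure (return (bid_space A) (out_bids A s 0)) X" .
  qed simp
  then show ?thesis
    using assms by (simp add: returns_def)
qed

text \<open>Array rows of the program are total functions, whereas bid vectors and oracle calls are
  restricted to the colluders; outcomes read only those entries.\<close>

lemma exp_restrict:
  assumes "i < n_col A"
  shows "exp_revenue A (restrict b {..<n_col A}) i = exp_revenue A b i"
    "exp_payment mech A (restrict b {..<n_col A}) i = exp_payment mech A b i"
proof -
  have *: "kth A (restrict b {..<n_col A}) be = kth A b be" for be
  proof (rule ext, rule kth_eqI)
    fix k z
    have "num_ge A (restrict b {..<n_col A}) be z = num_ge A b be z"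
      by (rule num_ge_cong) simp
    then show "k \<le> num_ge A (restrict b {..<n_col A}) be z \<longleftrightarrow> k \<le> num_ge A b be z"
      by simp
  qed
  have **: "rank_of A (case_sum (restrict b {..<n_col A}) be) (Inl i) = rank_of A (case_sum b be) (Inl i)" for be
    using assms unfolding rank_of_colluder by (simp cong: conj_cong)
  show "exp_revenue A (restrict b {..<n_col A}) i = exp_revenue A b i"
    "exp_payment mech A (restrict b {..<n_col A}) i = exp_payment mech A b i"
    by (simp_all add: exp_revenue_def exp_payment_def revenue_def payment_eq * **)
qed

lemma coalition_utility_cong:
  assumes "\<And>i. i < n_col A \<Longrightarrow> b i = b' i"
  shows "coalition_utility mech A b = coalition_utility mech A b'"
proof -
  have r: "restrict b {..<n_col A} = restrict b' {..<n_col A}"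
    using assms by (auto simp: restrict_def)
  have "exp_revenue A b i - exp_payment mech A b i = exp_revenue A b' i - exp_payment mech A b' i"
    if "i < n_col A" for i
    using exp_restrict[OF that, where b = b] exp_restrict[OF that, where b = b'] unfolding r by simp
  then show ?thesis
    unfolding coalition_utility_def by (intro sum.cong) auto
qed

section \<open>Optimization over a grid of bids\<close>

text \<open>Sorting precedes rounding, because utilities before and after rounding are compared for
  decreasing profiles. Rounding goes to the largest grid point below, which is a monotone map and so
  keeps the order.\<close>

lemma round_to_grid:
  assumes D: "finite D" "D \<subseteq> {0..1}"
    and cover: "\<And>x. x \<in> {0..1} \<Longrightarrow> \<exists>d\<in>D. d \<le> x \<and> ext_prob d x \<le> \<delta>"
    and b: "\<And>i. i < n_col A \<Longrightarrow> b i \<in> {0..1}"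
  obtains b' where "decreasing_on (n_col A) b'" "\<And>i. i < n_col A \<Longrightarrow> b' i \<in> D"
    "coalition_utility mech A b \<le> coalition_utility mech A b' + 2 * (real (n_col A))\<^sup>2 * \<delta>"
proof -
  obtain c where c: "decreasing_on (n_col A) c" "\<And>i. i < n_col A \<Longrightarrow> c i \<in> b ` {..<n_col A}"
    "\<And>be. outcome_utility mech A b be \<le> outcome_utility mech A c be"
    using outcome_utility_sort[where b = b and mech = mech] by blast
  define r where "r x = Max {d \<in> D. d \<le> x}" for x
  have c01: "c i \<in> {0..1}" if "i < n_col A" for i
    using c(2)[OF that] b by auto
  have ne: "{d \<in> D. d \<le> x} \<noteq> {}" if "x \<in> {0..1}" for x
    using cover[OF that] by auto
  have r: "r x \<in> D" "r x \<le> x" if "x \<in> {0..1}" for x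
    using Max_in[OF _ ne[OF that]] D(1) by (auto simp: r_def)
  have mono: "r x \<le> r y" if "x \<in> {0..1}" "x \<le> y" for x y
    unfolding r_def using that D(1) ne[OF that(1)] by (intro Max_mono) auto
  have close: "ext_prob (r x) x \<le> \<delta>" if x: "x \<in> {0..1}" for x
  proof -
    obtain d where d: "d \<in> D" "d \<le> x" "ext_prob d x \<le> \<delta>" using cover[OF x] by blast
    \<comment> \<open>The nearest grid point is at least as good as the witness \<open>d\<close> of
      the cover, since its interval is contained in that of \<open>d\<close>.\<close>
    then have "d \<le> r x" using D(1) by (simp add: r_def)
    then have "ext_prob (r x) x \<le> ext_prob d x"
      by (intro measure_pmf.finite_measure_mono) force+
    with d show ?thesis by simp
  qed
  have "coalition_utility mech A b \<le> coalition_utility mech A c"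
    using c(3) by (rule coalition_utility_mono)
  also have "\<dots> \<le> coalition_utility mech A (r \<circ> c) + 2 * (real (n_col A))\<^sup>2 * \<delta>"
    using c(1) c01 r D(2) mono close by (intro coalition_utility_round) (auto simp del: atLeastAtMost_iff)
  finally show thesis
    using c(1) c01 r mono by (intro that[of "r \<circ> c"]) auto
qed

abbreviation step_gain :: "mechanism \<Rightarrow> nat \<Rightarrow> real \<Rightarrow> real \<Rightarrow> real" where
  "step_gain mech i x y \<equiv>
     coalition_utility mech A (step_bids i x y) - coalition_utility mech A (\<lambda>_. x)"

text \<open>One edge of the path: fixing one more bid lowers the whole constant tail from
  \<open>b (i - 1)\<close> to \<open>b i\<close>, to which the exchange identity applies.\<close>

lemma coalition_utility_prefix_Suc:
  assumes "decreasing_on (n_col A) b" "0 < i" "i < n_col A"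
  shows "coalition_utility mech A (\<lambda>j. if j < Suc i then b j else b i) =
    coalition_utility mech A (\<lambda>j. if j < i then b j else b (i - 1)) + step_gain mech i (b (i - 1)) (b i)"
proof -
  have "(\<lambda>j. if j < Suc i then b j else b i) = (\<lambda>j. if j < i then b j else b i)"
    by (auto simp: less_Suc_eq)
  then show ?thesis
    using coalition_utility_exchange[of i b "b (i - 1)" "b i" mech] assms by auto
qed

text \<open>
  \<open>V i a\<close> is the best coalition utility when the first \<open>i\<close> bids are chosen, the last of them being
  \<open>D a\<close>, and the remaining bids are \<open>D a\<close> as well; \<open>prv i a\<close> is the index of the preceding bid in
  an optimal choice.
\<close>

definition dp_entry ::
    "mechanism \<Rightarrow> (nat \<Rightarrow> real) \<Rightarrow> nat \<Rightarrow> (nat \<Rightarrow> nat \<Rightarrow> real) \<Rightarrow> (nat \<Rightarrow> nat \<Rightarrow> nat) \<Rightarrow> nat \<Rightarrow> nat \<Rightarrow> nat \<Rightarrow> bool"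
  where
  "dp_entry mech D K V prv i c m \<longleftrightarrow>
     (\<forall>a<m. D c \<le> D a \<longrightarrow> V i a + step_gain mech i (D a) (D c) \<le> V (Suc i) c) \<and>
     prv (Suc i) c < K \<and> D c \<le> D (prv (Suc i) c) \<and>
     V (Suc i) c = V i (prv (Suc i) c) + step_gain mech i (D (prv (Suc i) c)) (D c)"

text \<open>The last argument bounds the finished rows, as that of \<open>dp_entry\<close> bounds
  the candidates already compared; with these arguments both predicates serve as loop
  invariants.\<close>

definition dp_table ::
    "mechanism \<Rightarrow> (nat \<Rightarrow> real) \<Rightarrow> nat \<Rightarrow> (nat \<Rightarrow> nat \<Rightarrow> real) \<Rightarrow> (nat \<Rightarrow> nat \<Rightarrow> nat) \<Rightarrow> nat \<Rightarrow> bool" where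
  "dp_table mech D K V prv m \<longleftrightarrow>
     (\<forall>c<K. V 1 c = coalition_utility mech A (\<lambda>_. D c)) \<and>
     (\<forall>i c. 1 \<le> i \<and> i < m \<and> c < K \<longrightarrow> dp_entry mech D K V prv i c K)"

text \<open>Induction along the path: in every row the preceding bid of \<open>b\<close> is among
  the candidates over which the entry is a maximum.\<close>

lemma dp_table_upper:
  assumes tab: "dp_table mech D K V prv (n_col A)" and n: "0 < n_col A"
    and b: "decreasing_on (n_col A) b" "\<And>i. i < n_col A \<Longrightarrow> b i \<in> D ` {..<K}"
  shows "\<exists>c<K. coalition_utility mech A b \<le> V (n_col A) c"
proof -
  let ?n = "n_col A"
  have "\<forall>i\<in>{..<?n}. \<exists>a. a < K \<and> b i = D a"
    using b(2) by fastforce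
  from bchoice[OF this] obtain \<alpha> where \<alpha>: "\<And>i. i < ?n \<Longrightarrow> \<alpha> i < K \<and> b i = D (\<alpha> i)"
    by auto
  have "coalition_utility mech A (\<lambda>j. if j < Suc i then b j else b i) \<le> V (Suc i) (\<alpha> i)" if "i < ?n" for i
    using that
  proof (induction i)
    case 0
    have "coalition_utility mech A (\<lambda>j. if j < Suc 0 then b j else b 0) =
        coalition_utility mech A (\<lambda>_. D (\<alpha> 0))"
      using \<alpha> n by (intro coalition_utility_cong) auto
    then show ?case using tab \<alpha> n by (simp add: dp_table_def dp_entry_def)
  next
    case (Suc i)
    have "D (\<alpha> (Suc i)) \<le> D (\<alpha> i)"
      using b(1)[rule_format, of i "Suc i"] \<alpha>[of i] \<alpha>[of "Suc i"] Suc.prems by simp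
    then have "V (Suc i) (\<alpha> i) + step_gain mech (Suc i) (D (\<alpha> i)) (D (\<alpha> (Suc i))) \<le> V (Suc (Suc i)) (\<alpha> (Suc i))"
      using tab \<alpha> Suc.prems unfolding dp_table_def dp_entry_def
      by (metis Suc_le_mono Suc_lessD le0 One_nat_def)
    moreover have "b (Suc i) = D (\<alpha> (Suc i))" "b i = D (\<alpha> i)"
      using \<alpha> Suc.prems by auto
    ultimately have "V (Suc i) (\<alpha> i) + step_gain mech (Suc i) (b i) (b (Suc i)) \<le> V (Suc (Suc i)) (\<alpha> (Suc i))"
      by (simp only:)
    then show ?case
      using coalition_utility_prefix_Suc[OF b(1), of "Suc i" mech, unfolded diff_Suc_1] Suc by simp
  qed
  from this[of "?n - 1"] have "coalition_utility mech A (\<lambda>j. if j < ?n then b j else b (?n - 1)) \<le> V ?n (\<alpha> (?n - 1))"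
    using n by simp
  moreover have "coalition_utility mech A (\<lambda>j. if j < ?n then b j else b (?n - 1)) = coalition_utility mech A b"
    by (rule coalition_utility_cong) auto
  ultimately show ?thesis using \<alpha>[of "?n - 1"] n by auto
qed

text \<open>\<open>\<beta>\<close> is numbered from 1 like the rows, bids from 0. Membership in the
  grid is proved backwards from the last row, each index being obtained from its successor; the
  gains are then summed forwards.\<close>

lemma dp_table_chain:
  assumes tab: "dp_table mech D K V prv (n_col A)" and n: "0 < n_col A"
    and \<beta>: "\<beta> (n_col A) < K" "\<And>i. 1 \<le> i \<Longrightarrow> i < n_col A \<Longrightarrow> \<beta> i = prv (Suc i) (\<beta> (Suc i))"
    and b: "\<And>i. i < n_col A \<Longrightarrow> b i = D (\<beta> (Suc i))"
  shows "\<And>i. i < n_col A \<Longrightarrow> b i \<in> D ` {..<K}"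
    and "coalition_utility mech A b = V (n_col A) (\<beta> (n_col A))"
proof -
  let ?n = "n_col A"
  have "\<beta> (?n - k) < K" if "k < ?n" for k
    using that
  proof (induction k)
    case 0
    then show ?case using \<beta>(1) by simp
  next
    case (Suc k)
    let ?i = "?n - Suc k"
    have i: "1 \<le> ?i" "?i < ?n" "Suc ?i = ?n - k" using Suc.prems by auto
    have "\<beta> (Suc ?i) < K" using Suc i(3) by simp
    then have "prv (Suc ?i) (\<beta> (Suc ?i)) < K"
      using tab i(1,2) by (simp only: dp_table_def dp_entry_def)
    then show ?case using \<beta>(2)[OF i(1,2)] by simp
  qed
  from this[of "?n - Suc _"] have K: "\<beta> (Suc i) < K" if "i < ?n" for i
    using that by (metis Suc_leI diff_diff_cancel diff_less zero_less_Suc n)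
  then show "\<And>i. i < ?n \<Longrightarrow> b i \<in> D ` {..<K}" using b by simp
  have step: "b (Suc i) \<le> b i"
    "V (Suc (Suc i)) (\<beta> (Suc (Suc i))) = V (Suc i) (\<beta> (Suc i)) + step_gain mech (Suc i) (b i) (b (Suc i))"
    if "Suc i < ?n" for i
  proof -
    have e: "b (Suc i) = D (\<beta> (Suc (Suc i)))" "b i = D (prv (Suc (Suc i)) (\<beta> (Suc (Suc i))))"
      "\<beta> (Suc i) = prv (Suc (Suc i)) (\<beta> (Suc (Suc i)))"
      using that b[of "Suc i"] b[of i] \<beta>(2)[of "Suc i"] by simp_all
    show "b (Suc i) \<le> b i"
      "V (Suc (Suc i)) (\<beta> (Suc (Suc i))) = V (Suc i) (\<beta> (Suc i)) + step_gain mech (Suc i) (b i) (b (Suc i))"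
      by (simp_all only: e) (use tab K[OF that] that in \<open>simp_all add: dp_table_def dp_entry_def\<close>)
  qed
  have dec: "decreasing_on ?n b"
  proof (intro allI impI)
    fix i j assume ij: "i \<le> j \<and> j < ?n"
    then have "i \<le> j" by simp
    then have "j < ?n \<longrightarrow> b j \<le> b i"
      by (induction rule: dec_induct) (auto intro: order_trans[OF step(1)])
    with ij show "b j \<le> b i" by simp
  qed
  have "coalition_utility mech A (\<lambda>j. if j < Suc i then b j else b i) = V (Suc i) (\<beta> (Suc i))" if "i < ?n" for i
    using that
  proof (induction i)
    case 0
    have "coalition_utility mech A (\<lambda>j. if j < Suc 0 then b j else b 0) =
        coalition_utility mech A (\<lambda>_. D (\<beta> (Suc 0)))"
      using b n by (intro coalition_utility_cong) auto
    then show ?case using tab K n by (simp add: dp_table_def dp_entry_def)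
  next
    case (Suc i)
    then show ?case
      using coalition_utility_prefix_Suc[OF dec, of "Suc i" mech, unfolded diff_Suc_1] step(2)[of i]
      by simp
  qed
  from this[of "?n - 1"] have "coalition_utility mech A (\<lambda>j. if j < ?n then b j else b (?n - 1)) = V ?n (\<beta> ?n)"
    using n by simp
  moreover have "coalition_utility mech A (\<lambda>j. if j < ?n then b j else b (?n - 1)) = coalition_utility mech A b"
    by (rule coalition_utility_cong) auto
  ultimately show "coalition_utility mech A b = V ?n (\<beta> ?n)" by simp
qed

section \<open>Bisection of the bid interval\<close>

text \<open>The expected number of external bids in the interval: an additive majorant of
  \<open>ext_prob\<close>. It serves to count splits and is never computed by the program.\<close>

definition ext_mass :: "real \<Rightarrow> real \<Rightarrow> real" where
  "ext_mass \<alpha> \<beta> = (\<Sum>j<n_ext A. measure_pmf.prob (ext_dist A) {be. be j \<in> {\<alpha><..\<beta>}})"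

lemma ext_mass_nonneg: "0 \<le> ext_mass \<alpha> \<beta>"
  by (simp add: ext_mass_def sum_nonneg)

lemma ext_mass_le: "ext_mass \<alpha> \<beta> \<le> n_ext A"
  unfolding ext_mass_def using sum_bounded_above[of "{..<n_ext A}" _ "1::real"] by simp

lemma ext_prob_le_mass: "ext_prob \<alpha> \<beta> \<le> ext_mass \<alpha> \<beta>"
proof -
  have "{be. \<exists>j<n_ext A. be j \<in> {\<alpha><..\<beta>}} = (\<Union>j<n_ext A. {be. be j \<in> {\<alpha><..\<beta>}})"
    by auto
  then show ?thesis
    unfolding ext_mass_def by (auto intro!: measure_pmf.finite_measure_subadditive_finite)
qed

lemma ext_mass_split:
  assumes "\<alpha> \<le> x" "x \<le> \<beta>"
  shows "ext_mass \<alpha> \<beta> = ext_mass \<alpha> x + ext_mass x \<beta>"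
proof -
  have "{be. be j \<in> {\<alpha><..\<beta>}} = {be. be j \<in> {\<alpha><..x}} \<union> {be. be j \<in> {x<..\<beta>}}" for j :: nat
    using assms by auto
  then show ?thesis
    unfolding ext_mass_def sum.distrib[symmetric]
    by (intro sum.cong refl) (auto intro!: measure_pmf.finite_measure_Union)
qed

lemma ext_prob_mono: "\<beta> \<le> \<beta>' \<Longrightarrow> ext_prob \<alpha> \<beta> \<le> ext_prob \<alpha> \<beta>'"
  by (intro measure_pmf.finite_measure_mono) force+

text \<open>External bids are multiples of \<open>2^-M\<close>, and none lies strictly between two
  consecutive multiples.\<close>

lemma ext_prob_no_grid_point:
  assumes "\<alpha> = of_int z / 2 ^ precision A" "x < (of_int z + 1) / 2 ^ precision A"
  shows "ext_prob \<alpha> x = 0"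
proof -
  have "be j \<notin> {\<alpha><..x}" if be: "be \<in> set_pmf (ext_dist A)" "j < n_ext A" for be j
  proof
    assume j: "be j \<in> {\<alpha><..x}"
    from valid have "\<forall>be\<in>set_pmf (ext_dist A). \<forall>j<n_ext A. \<exists>z::int. be j = of_int z / 2 ^ precision A"
      by (simp add: valid_auction_def)
    with be obtain y :: int where y: "be j = of_int y / 2 ^ precision A"
      by blast
    have "of_int z / 2 ^ precision A < of_int y / (2 ^ precision A :: real)"
      "of_int y / 2 ^ precision A < (of_int z + 1) / (2 ^ precision A :: real)"
      using j y assms by auto
    then have "(of_int z :: real) < of_int y" "(of_int y :: real) < of_int (z + 1)"
      by (simp_all add: divide_less_cancel)
    then have "z < y" "y < z + 1"
      by (simp_all only: of_int_less_iff)
    then show False by simp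
  qed
  then show ?thesis
    by (auto simp: measure_pmf_zero_iff)
qed

text \<open>
  The intervals \<open>(lo k, hi k]\<close> form a queue whose entries \<open>h, \<dots>, t - 1\<close> are still to be processed;
  \<open>lo 0 = 1\<close> is an additional grid point. A split at level \<open>l\<close> happens only if the mass of the
  interval exceeds \<open>\<delta>\<close>, so it lowers the potential in the last conjunct by at least 1.
\<close>

definition bisection ::
    "real \<Rightarrow> nat \<Rightarrow> nat \<Rightarrow> (nat \<Rightarrow> real) \<Rightarrow> (nat \<Rightarrow> real) \<Rightarrow> (nat \<Rightarrow> nat) \<Rightarrow> bool" where
  "bisection \<delta> h t lo hi lev \<longleftrightarrow>
     1 \<le> h \<and> h \<le> t \<and> lo 0 = 1 \<and>
     (\<forall>k. 1 \<le> k \<and> k < t \<longrightarrow> lev k \<le> precision A \<and>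
        (\<exists>z::int. lo k = of_int z / 2 ^ lev k \<and> hi k = (of_int z + 1) / 2 ^ lev k \<and>
          0 \<le> z \<and> z + 1 \<le> 2 ^ lev k)) \<and>
     (\<forall>x. 0 \<le> x \<and> x < 1 \<longrightarrow>
        (\<exists>k. 1 \<le> k \<and> k < t \<and> lo k \<le> x \<and> x < hi k \<and> (k < h \<longrightarrow> ext_prob (lo k) x \<le> \<delta>))) \<and>
     real h + (\<Sum>k\<in>{h..<t}. 1 + 2 * (real (precision A) - real (lev k)) * (ext_mass (lo k) (hi k) / \<delta>))
       \<le> 2 + 2 * real (precision A) * real (n_ext A) / \<delta>"

text \<open>Origin of the bound on the potential: 1 for \<open>h\<close>, plus the term of one
  pending interval at level 0, whose mass is at most \<open>n_ext A\<close>.\<close>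

lemma bisection_init:
  assumes "0 < \<delta>" "lo 0 = 1" "lo 1 = 0" "hi 1 = 1" "lev 1 = 0"
  shows "bisection \<delta> 1 2 lo hi lev"
  unfolding bisection_def
proof (intro conjI allI impI)
  fix k :: nat assume "1 \<le> k \<and> k < 2"
  then have k: "k = 1" by simp
  show "lev k \<le> precision A" using assms(5) k by simp
  show "\<exists>z::int. lo k = of_int z / 2 ^ lev k \<and> hi k = (of_int z + 1) / 2 ^ lev k \<and>
      0 \<le> z \<and> z + 1 \<le> 2 ^ lev k"
    unfolding k assms(3-5) by (rule exI[of _ 0]) simp
next
  fix x :: real assume "0 \<le> x \<and> x < 1"
  then show "\<exists>k. 1 \<le> k \<and> k < 2 \<and> lo k \<le> x \<and> x < hi k \<and> (k < 1 \<longrightarrow> ext_prob (lo k) x \<le> \<delta>)"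
    using assms(3,4) by (intro exI[of _ 1]) simp
next
  have "real (precision A) * ext_mass 0 1 / \<delta> \<le> real (precision A) * real (n_ext A) / \<delta>"
    using assms(1) ext_mass_le by (intro divide_right_mono mult_left_mono) auto
  moreover have "{1..<2::nat} = {1}" by auto
  ultimately show "real 1 + (\<Sum>k\<in>{1..<2}. 1 + 2 * (real (precision A) - real (lev k)) * (ext_mass (lo k) (hi k) / \<delta>))
      \<le> 2 + 2 * real (precision A) * real (n_ext A) / \<delta>"
    using assms by simp
qed (use assms in auto)

lemma bisection_coverE:
  assumes "bisection \<delta> h t lo hi lev" "0 \<le> x" "x < 1"
  obtains k where "1 \<le> k" "k < t" "lo k \<le> x" "x < hi k" "k < h \<longrightarrow> ext_prob (lo k) x \<le> \<delta>"
proof -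
  from assms(1) have "\<forall>x. 0 \<le> x \<and> x < 1 \<longrightarrow>
      (\<exists>k. 1 \<le> k \<and> k < t \<and> lo k \<le> x \<and> x < hi k \<and> (k < h \<longrightarrow> ext_prob (lo k) x \<le> \<delta>))"
    unfolding bisection_def by (elim conjE)
  from this[rule_format, OF conjI, OF assms(2,3)] show thesis
    using that by (elim exE conjE) simp
qed

lemma bisection_dyadicE:
  assumes "bisection \<delta> h t lo hi lev" "1 \<le> k" "k < t"
  obtains z :: int where "lo k = of_int z / 2 ^ lev k" "hi k = (of_int z + 1) / 2 ^ lev k"
    "0 \<le> z" "z + 1 \<le> 2 ^ lev k" "lev k \<le> precision A"
proof -
  from assms(1) have "\<forall>k. 1 \<le> k \<and> k < t \<longrightarrow> lev k \<le> precision A \<and>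
        (\<exists>z::int. lo k = of_int z / 2 ^ lev k \<and> hi k = (of_int z + 1) / 2 ^ lev k \<and>
          0 \<le> z \<and> z + 1 \<le> 2 ^ lev k)"
    unfolding bisection_def by (elim conjE)
  from this[rule_format, OF conjI, OF assms(2,3)] show thesis
    using that by (elim exE conjE)
qed

lemma bisection_interval:
  assumes "bisection \<delta> h t lo hi lev" "1 \<le> k" "k < t"
  shows "0 \<le> lo k" "lo k < hi k" "hi k \<le> 1"
proof -
  obtain z :: int where z: "lo k = of_int z / 2 ^ lev k" "hi k = (of_int z + 1) / 2 ^ lev k"
    "0 \<le> z" "z + 1 \<le> 2 ^ lev k" "lev k \<le> precision A"
    using bisection_dyadicE[OF assms] .
  show "0 \<le> lo k" "lo k < hi k" using z by (auto simp: divide_strict_right_mono)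
  have "real_of_int (z + 1) \<le> of_int (2 ^ lev k)"
    using z(4) by (simp only: of_int_le_iff)
  then show "hi k \<le> 1" using z(2) by (simp add: divide_le_eq)
qed

text \<open>An interval is final for one of two reasons: at the finest level no external bid lies
  strictly inside it, and at a coarser level its probability is at most \<open>\<delta>\<close>. Its
  term in the potential is at least 1, which pays for advancing \<open>h\<close>.\<close>

lemma bisection_skip:
  assumes inv: "bisection \<delta> h t lo hi lev" and ht: "h < t" and \<delta>: "0 < \<delta>"
    and skip: "\<not> (lev h < precision A \<and> \<delta> < ext_prob (lo h) (hi h))"
  shows "bisection \<delta> (Suc h) t lo hi lev"
proof -
  have h: "1 \<le> h" and lev: "lev h \<le> precision A"
    using inv ht by (auto simp: bisection_def)
  have good: "ext_prob (lo h) x \<le> \<delta>" if "lo h \<le> x" "x < hi h" for x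
  proof (cases "lev h = precision A")
    case True
    obtain z :: int where "lo h = of_int z / 2 ^ lev h" "hi h = (of_int z + 1) / 2 ^ lev h"
      "0 \<le> z" "z + 1 \<le> 2 ^ lev h" "lev h \<le> precision A"
      using bisection_dyadicE[OF inv h ht] .
    with True that have "ext_prob (lo h) x = 0"
      by (intro ext_prob_no_grid_point) auto
    then show ?thesis using \<delta> by simp
  next
    case False
    then have "ext_prob (lo h) (hi h) \<le> \<delta>" using skip lev by auto
    moreover have "ext_prob (lo h) x \<le> ext_prob (lo h) (hi h)"
      using that by (intro ext_prob_mono) auto
    ultimately show ?thesis by simp
  qed
  have cover: "\<exists>k. 1 \<le> k \<and> k < t \<and> lo k \<le> x \<and> x < hi k \<and> (k < Suc h \<longrightarrow> ext_prob (lo k) x \<le> \<delta>)"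
    if x: "0 \<le> x" "x < 1" for x
  proof -
    obtain k where k: "1 \<le> k" "k < t" "lo k \<le> x" "x < hi k" "k < h \<longrightarrow> ext_prob (lo k) x \<le> \<delta>"
      using bisection_coverE[OF inv x] .
    then have "k < Suc h \<longrightarrow> ext_prob (lo k) x \<le> \<delta>"
      using good by (cases "k = h") auto
    with k(1-4) show ?thesis by (intro exI[of _ k] conjI)
  qed
  have "0 \<le> 2 * (real (precision A) - real (lev h)) * (ext_mass (lo h) (hi h) / \<delta>)"
    using lev \<delta> ext_mass_nonneg by simp
  then show ?thesis
    using inv cover ht unfolding bisection_def by (simp add: sum.atLeast_Suc_lessThan)
qed

lemma bisection_split:
  assumes inv: "bisection \<delta> h t lo hi lev" and ht: "h < t" and \<delta>: "0 < \<delta>"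
    and split: "lev h < precision A" "\<delta> < ext_prob (lo h) (hi h)"
  defines "m \<equiv> (lo h + hi h) / 2"
  shows "bisection \<delta> (Suc h) (Suc (Suc t)) (lo(t := lo h, Suc t := m)) (hi(t := m, Suc t := hi h))
    (lev(t := Suc (lev h), Suc t := Suc (lev h)))"
    (is "bisection _ _ _ ?lo ?hi ?lev")
proof -
  have h: "1 \<le> h" "0 < t" using inv ht by (auto simp: bisection_def)
  have lo: "lo h < m" "m < hi h"
    using bisection_interval[OF inv h(1) ht] by (auto simp: m_def)
  obtain z :: int where z: "lo h = of_int z / 2 ^ lev h" "hi h = (of_int z + 1) / 2 ^ lev h"
    "0 \<le> z" "z + 1 \<le> 2 ^ lev h" "lev h \<le> precision A"
    using bisection_dyadicE[OF inv h(1) ht] .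
  have dyadic: "?lev k \<le> precision A \<and>
      (\<exists>z::int. ?lo k = of_int z / 2 ^ ?lev k \<and> ?hi k = (of_int z + 1) / 2 ^ ?lev k \<and>
        0 \<le> z \<and> z + 1 \<le> 2 ^ ?lev k)" if k: "1 \<le> k" "k < Suc (Suc t)" for k
  proof -
    consider "k < t" | "k = t" | "k = Suc t" using k by linarith
    then show ?thesis
    proof cases
      case 1
      then show ?thesis using inv k by (simp add: bisection_def)
    next
      case 2
      then show ?thesis
        using z split(1) by (intro conjI exI[of _ "2 * z"]) (auto simp: m_def field_simps)
    next
      case 3
      then show ?thesis
        using z split(1) by (intro conjI exI[of _ "2 * z + 1"]) (auto simp: m_def field_simps)
    qed
  qed
  have cover: "\<exists>k. 1 \<le> k \<and> k < Suc (Suc t) \<and> ?lo k \<le> x \<and> x < ?hi k \<and>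
      (k < Suc h \<longrightarrow> ext_prob (?lo k) x \<le> \<delta>)" if x: "0 \<le> x" "x < 1" for x
  proof -
    obtain k where k: "1 \<le> k" "k < t" "lo k \<le> x" "x < hi k" "k < h \<longrightarrow> ext_prob (lo k) x \<le> \<delta>"
      using bisection_coverE[OF inv x] .
    consider "k \<noteq> h" | "k = h" "x < m" | "k = h" "m \<le> x" by linarith
    then show ?thesis
    proof cases
      case 1
      then show ?thesis using k by (intro exI[of _ k]) auto
    next
      case 2
      then show ?thesis using k h ht by (intro exI[of _ t]) auto
    next
      case 3
      then show ?thesis using k h ht by (intro exI[of _ "Suc t"]) auto
    qed
  qed
  let ?M = "real (precision A)" and ?L = "real (lev h)"
  define \<mu>1 \<mu>2 where "\<mu>1 = ext_mass (lo h) m / \<delta>" and "\<mu>2 = ext_mass m (hi h) / \<delta>"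
  have mass: "ext_mass (lo h) (hi h) / \<delta> = \<mu>1 + \<mu>2"
    using ext_mass_split[of "lo h" m "hi h"] lo by (simp add: \<mu>1_def \<mu>2_def add_divide_distrib)
  have "1 \<le> ext_mass (lo h) (hi h) / \<delta>"
    using split(2) ext_prob_le_mass[of "lo h" "hi h"] \<delta> by (simp add: le_divide_eq)
  then have big: "1 \<le> \<mu>1 + \<mu>2" by (simp add: mass)
  let ?\<phi> = "\<lambda>k. 1 + 2 * (?M - real (lev k)) * (ext_mass (lo k) (hi k) / \<delta>)"
  let ?\<phi>' = "\<lambda>k. 1 + 2 * (?M - real (?lev k)) * (ext_mass (?lo k) (?hi k) / \<delta>)"
  have "(\<Sum>k\<in>{Suc h..<Suc (Suc t)}. ?\<phi>' k) = (\<Sum>k\<in>{Suc h..<t}. ?\<phi>' k) + ?\<phi>' t + ?\<phi>' (Suc t)"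
    using ht by (simp add: sum.atLeastLessThan_Suc)
  also have "(\<Sum>k\<in>{Suc h..<t}. ?\<phi>' k) = (\<Sum>k\<in>{Suc h..<t}. ?\<phi> k)"
    by (intro sum.cong) auto
  also have "?\<phi>' t = 1 + 2 * (?M - ?L - 1) * \<mu>1"
    by (simp add: \<mu>1_def)
  also have "?\<phi>' (Suc t) = 1 + 2 * (?M - ?L - 1) * \<mu>2"
    by (simp add: \<mu>2_def)
  finally have new: "(\<Sum>k\<in>{Suc h..<Suc (Suc t)}. ?\<phi>' k) =
      (\<Sum>k\<in>{Suc h..<t}. ?\<phi> k) + (1 + 2 * (?M - ?L - 1) * \<mu>1) + (1 + 2 * (?M - ?L - 1) * \<mu>2)" .
  have old: "(\<Sum>k\<in>{h..<t}. ?\<phi> k) = (1 + 2 * (?M - ?L) * (\<mu>1 + \<mu>2)) + (\<Sum>k\<in>{Suc h..<t}. ?\<phi> k)"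
    using ht by (simp only: sum.atLeast_Suc_lessThan mass)
  have "real h + (\<Sum>k\<in>{h..<t}. ?\<phi> k) \<le> 2 + 2 * ?M * real (n_ext A) / \<delta>"
    using inv by (simp only: bisection_def)
  \<comment> \<open>Advancing \<open>h\<close> costs 1 and the two new entries cost 2, while the
    removed entry returns 1. Sinking by one level returns \<open>2 * (\<mu>1 + \<mu>2)\<close>, at
    least 2, which balances the account; hence the factor 2 in the potential.\<close>
  then have "real (Suc h) + (\<Sum>k\<in>{Suc h..<Suc (Suc t)}. ?\<phi>' k) \<le> 2 + 2 * ?M * real (n_ext A) / \<delta>"
    unfolding new old using big by (simp add: algebra_simps)
  then show ?thesis
    unfolding bisection_def using dyadic cover h ht inv by (simp add: bisection_def)
qed

text \<open>Each pending interval contributes at least 1 to the potential, so its bound covers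
  finished and pending entries together.\<close>

lemma bisection_tail_le:
  assumes "bisection \<delta> h t lo hi lev" "0 < \<delta>"
  shows "real t \<le> 2 + 2 * real (precision A) * real (n_ext A) / \<delta>"
proof -
  have "(\<Sum>k\<in>{h..<t}. 1) \<le>
      (\<Sum>k\<in>{h..<t}. 1 + 2 * (real (precision A) - real (lev k)) * (ext_mass (lo k) (hi k) / \<delta>))"
    using assms ext_mass_nonneg by (intro sum_mono) (auto simp: bisection_def)
  then show ?thesis using assms(1) by (simp add: bisection_def)
qed

lemma bisection_grid:
  assumes inv: "bisection \<delta> t t lo hi lev" and \<delta>: "0 < \<delta>"
  shows "lo ` {..<t} \<subseteq> {0..1}"
    and "x \<in> {0..1} \<Longrightarrow> \<exists>d\<in>lo ` {..<t}. d \<le> x \<and> ext_prob d x \<le> \<delta>"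
proof -
  have lo0: "lo 0 = 1" "1 \<le> t" using inv by (auto simp: bisection_def)
  have "lo k \<in> {0..1}" if "k < t" for k
    using bisection_interval[OF inv _ that] lo0 by (cases "k = 0") force+
  then show "lo ` {..<t} \<subseteq> {0..1}" by auto
  assume x: "x \<in> {0..1}"
  show "\<exists>d\<in>lo ` {..<t}. d \<le> x \<and> ext_prob d x \<le> \<delta>"
  proof (cases "x = 1")
    case True
    \<comment> \<open>The intervals cover only points below 1, since \<open>x < hi k\<close>; the
      point 1 is rounded to itself by entry 0.\<close>
    have "ext_prob 1 1 = 0" by simp
    then show ?thesis using True lo0 \<delta> by (intro bexI[of _ 1] image_eqI[of _ _ 0]) auto
  next
    case False
    then have x': "0 \<le> x" "x < 1" using x by auto
    obtain k where "1 \<le> k" "k < t" "lo k \<le> x" "x < hi k" "k < t \<longrightarrow> ext_prob (lo k) x \<le> \<delta>"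
      using bisection_coverE[OF inv x'] .
    then show ?thesis by (intro bexI[of _ "lo k"]) simp_all
  qed
qed

end

section \<open>Total correctness with running times\<close>

text \<open>A weakest precondition with a time budget. The claim about the rest of a program can be
  nested in the postcondition, so programs are executed symbolically from left to right.\<close>

definition halts :: "oracles \<Rightarrow> com \<Rightarrow> state \<Rightarrow> nat \<Rightarrow> (state \<Rightarrow> bool) \<Rightarrow> bool" where
  "halts W c s t Q \<longleftrightarrow> (\<exists>T s'. runs W c s T s' \<and> T \<le> t \<and> Q s')"

lemma halts_mono:
  "halts W c s t Q \<Longrightarrow> t \<le> t' \<Longrightarrow> (\<And>s'. Q s' \<Longrightarrow> Q' s') \<Longrightarrow> halts W c s t' Q'"
  unfolding halts_def by (meson order_trans)

lemma halts_time: "halts W c s t Q \<Longrightarrow> t \<le> t' \<Longrightarrow> halts W c s t' Q"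
  by (rule halts_mono)

lemma halts_Skip: "Q s \<Longrightarrow> halts W Skip s 1 Q"
  unfolding halts_def using runs_Skip by blast

lemma halts_NAssign:
  "Q (s\<lparr>nmem := update (nmem s) x (nval s e) (nval s f) (nval s g)\<rparr>) \<Longrightarrow>
   halts W (NAssign x e f g) s 1 Q"
  unfolding halts_def using runs_NAssign by blast

lemma halts_RAssign:
  "Q (s\<lparr>rmem := update (rmem s) x (nval s e) (nval s f) (rval W s g)\<rparr>) \<Longrightarrow>
   halts W (RAssign x e f g) s 1 Q"
  unfolding halts_def using runs_RAssign by blast

lemma halts_Seq:
  assumes "halts W c s t1 (\<lambda>s'. halts W d s' t2 Q)"
  shows "halts W (Seq c d) s (t1 + t2) Q"
  using assms unfolding halts_def by (meson add_mono runs_Seq)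

lemma halts_Seq_RAssign:
  "halts W d (s\<lparr>rmem := update (rmem s) x (nval s e) (nval s f) (rval W s g)\<rparr>) t Q \<Longrightarrow>
   halts W (Seq (RAssign x e f g) d) s (Suc t) Q"
  using halts_Seq[of W "RAssign x e f g" s 1 d t Q] halts_RAssign by simp

lemma halts_Seq_NAssign:
  "halts W d (s\<lparr>nmem := update (nmem s) x (nval s e) (nval s f) (nval s g)\<rparr>) t Q \<Longrightarrow>
   halts W (Seq (NAssign x e f g) d) s (Suc t) Q"
  using halts_Seq[of W "NAssign x e f g" s 1 d t Q] halts_NAssign by simp

lemma halts_Cond:
  assumes "bval W s b \<Longrightarrow> halts W c s t1 Q" "\<not> bval W s b \<Longrightarrow> halts W d s t2 Q"
  shows "halts W (Cond b c d) s (max t1 t2 + 1) Q"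
proof (cases "bval W s b")
  case True
  from assms(1)[OF this] obtain T s' where "runs W c s T s'" "T \<le> t1" "Q s'"
    unfolding halts_def by blast
  with runs_CondT[OF True this(1), of d] show ?thesis
    unfolding halts_def by (intro exI[of _ "T + 1"] exI[of _ s']) auto
next
  case False
  from assms(2)[OF this] obtain T s' where "runs W d s T s'" "T \<le> t2" "Q s'"
    unfolding halts_def by blast
  with runs_CondF[OF False this(1), of c] show ?thesis
    unfolding halts_def by (intro exI[of _ "T + 1"] exI[of _ s']) auto
qed

text \<open>\<open>m\<close> decreases in every round and so bounds their number; a round costs the
  body and one test, and the failing test costs 1 more.\<close>

lemma halts_While:
  assumes "I s"
    and "\<And>s. I s \<Longrightarrow> bval W s b \<Longrightarrow> halts W c s t (\<lambda>s'. I s' \<and> m s' < m s)"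
  shows "halts W (While b c) s (m s * (t + 1) + 1) (\<lambda>s. I s \<and> \<not> bval W s b)"
  using assms(1)
proof (induction "m s" arbitrary: s rule: less_induct)
  case less
  show ?case
  proof (cases "bval W s b")
    case True
    from assms(2)[OF less.prems True] obtain T s' where
      s': "runs W c s T s'" "T \<le> t" "I s'" "m s' < m s"
      unfolding halts_def by blast
    from less.hyps[OF s'(4,3)] obtain T' s'' where
      s'': "runs W (While b c) s' T' s''" "T' \<le> m s' * (t + 1) + 1" "I s''" "\<not> bval W s'' b"
      unfolding halts_def by blast
    have "Suc (m s') * (t + 1) \<le> m s * (t + 1)"
      using s'(4) by (intro mult_right_mono) auto
    then have "T + T' + 1 \<le> m s * (t + 1) + 1"
      using s'(2) s''(2) by simp
    with runs_WhileT[OF True s'(1) s''(1)] s''(3,4) show ?thesis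
      unfolding halts_def by blast
  next
    case False
    with runs_WhileF[OF False, of c] less.prems show ?thesis
      unfolding halts_def by (intro exI[of _ 1] exI[of _ s]) auto
  qed
qed

abbreviation nvar :: "name \<Rightarrow> nexp" where "nvar x \<equiv> NVar x (NConst 0) (NConst 0)"
abbreviation nset :: "name \<Rightarrow> nexp \<Rightarrow> com" where "nset x \<equiv> NAssign x (NConst 0) (NConst 0)"
abbreviation rvar :: "name \<Rightarrow> rexp" where "rvar x \<equiv> RVar x (NConst 0) (NConst 0)"
abbreviation rset :: "name \<Rightarrow> rexp \<Rightarrow> com" where "rset x \<equiv> RAssign x (NConst 0) (NConst 0)"
abbreviation nent :: "name \<Rightarrow> nexp \<Rightarrow> nexp" where "nent x \<equiv> NVar x (NConst 0)"
abbreviation rent :: "name \<Rightarrow> nexp \<Rightarrow> rexp" where "rent x \<equiv> RVar x (NConst 0)"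
abbreviation incr :: "nexp \<Rightarrow> nexp" where "incr e \<equiv> NAdd e (NConst 1)"

abbreviation For :: "name \<Rightarrow> nexp \<Rightarrow> com \<Rightarrow> com" where
  "For x e c \<equiv> While (NLess (nvar x) e) (Seq c (nset x (incr (nvar x))))"

text \<open>\<open>I k\<close> describes the state in which the counter is \<open>k\<close>. The
  body must preserve the counter and prepare \<open>I (Suc k)\<close> for the state after the
  increment. A round costs 2 besides the body, for increment and test. \<open>max k N\<close> covers
  a loop that starts at or beyond its bound.\<close>

lemma halts_For:
  assumes "I k s"
    and vars: "\<And>k s. I k s \<Longrightarrow> nmem s x 0 0 = k \<and> nval s e = N"
    and body: "\<And>k s. I k s \<Longrightarrow> k < N \<Longrightarrow> halts W c s t (\<lambda>s'. nmem s' x 0 0 = k \<and>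
      I (Suc k) (s'\<lparr>nmem := update (nmem s') x 0 0 (Suc k)\<rparr>))"
  shows "halts W (For x e c) s ((N - k) * (t + 2) + 1) (I (max k N))"
proof -
  let ?I = "\<lambda>s. \<exists>k'\<le>max k N. k \<le> k' \<and> I k' s" and ?m = "\<lambda>s. N - nmem s x 0 0"
  have "halts W (For x e c) s (?m s * (t + 1 + 1) + 1)
      (\<lambda>s. ?I s \<and> \<not> bval W s (NLess (nvar x) e))"
  proof (rule halts_While)
    show "?I s" using assms(1) by (intro exI[of _ k]) auto
    fix s assume "?I s" and b: "bval W s (NLess (nvar x) e)"
    then obtain l where l: "I l s" "l \<le> max k N" "k \<le> l" by blast
    with b vars[OF l(1)] have lN: "l < N" by simp
    show "halts W (Seq c (nset x (incr (nvar x)))) s (t + 1) (\<lambda>s'. ?I s' \<and> ?m s' < ?m s)"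
    proof (rule halts_Seq, rule halts_mono[OF body[OF l(1) lN] order_refl], rule halts_NAssign)
      fix s' assume s': "nmem s' x 0 0 = l \<and> I (Suc l) (s'\<lparr>nmem := update (nmem s') x 0 0 (Suc l)\<rparr>)"
      then show "?I (s'\<lparr>nmem := update (nmem s') x (nval s' (NConst 0)) (nval s' (NConst 0))
            (nval s' (incr (nvar x)))\<rparr>) \<and>
          ?m (s'\<lparr>nmem := update (nmem s') x (nval s' (NConst 0)) (nval s' (NConst 0))
            (nval s' (incr (nvar x)))\<rparr>) < ?m s"
        using lN l(3) vars[OF l(1)] by (auto simp: update_def intro!: exI[of _ "Suc l"])
    qed
  qed
  then show ?thesis
  proof (rule halts_mono)
    show "?m s * (t + 1 + 1) + 1 \<le> (N - k) * (t + 2) + 1"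
      using vars[OF assms(1)] by simp
  next
    fix s' assume "?I s' \<and> \<not> bval W s' (NLess (nvar x) e)"
    then obtain l where "l \<le> max k N" "k \<le> l" "I l s'" "\<not> nmem s' x 0 0 < nval s' e" by auto
    moreover have "l = max k N" using calculation vars[of l s'] by auto
    ultimately show "I (max k N) s'" by simp
  qed
qed

text \<open>Frame condition: \<open>X\<close> and \<open>Y\<close> name the arrays that may have
  been written.\<close>

definition unchanged :: "name set \<Rightarrow> name set \<Rightarrow> state \<Rightarrow> state \<Rightarrow> bool" where
  "unchanged X Y s s' \<longleftrightarrow>
     (\<forall>x. x \<notin> X \<longrightarrow> nmem s' x = nmem s x) \<and> (\<forall>x. x \<notin> Y \<longrightarrow> rmem s' x = rmem s x)"

lemma unchanged_refl: "unchanged X Y s s"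
  by (simp add: unchanged_def)

lemma unchanged_trans:
  "unchanged X Y s s' \<Longrightarrow> unchanged X' Y' s' s'' \<Longrightarrow> X' \<subseteq> X \<Longrightarrow> Y' \<subseteq> Y \<Longrightarrow> unchanged X Y s s''"
  unfolding unchanged_def by (metis subsetD)

lemma unchanged_mono:
  "unchanged X' Y' s s' \<Longrightarrow> X' \<subseteq> X \<Longrightarrow> Y' \<subseteq> Y \<Longrightarrow> unchanged X Y s s'"
  unfolding unchanged_def by (metis subsetD)

lemma unchanged_nmem: "unchanged X Y s s' \<Longrightarrow> x \<notin> X \<Longrightarrow> nmem s' x = nmem s x"
  and unchanged_rmem: "unchanged X Y s s' \<Longrightarrow> x \<notin> Y \<Longrightarrow> rmem s' x = rmem s x"
  by (simp_all add: unchanged_def)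

lemma unchanged_update:
  "x \<in> X \<Longrightarrow> unchanged X Y s (s'\<lparr>nmem := update f x i j a\<rparr>) \<longleftrightarrow> unchanged X Y s (s'\<lparr>nmem := f\<rparr>)"
  "y \<in> Y \<Longrightarrow> unchanged X Y s (s'\<lparr>rmem := update g y i j r\<rparr>) \<longleftrightarrow> unchanged X Y s (s'\<lparr>rmem := g\<rparr>)"
  by (auto simp: unchanged_def update_def)

lemma update_apply:
  "update m x i j a y = (if y = x then (m x)(i := (m x i)(j := a)) else m y)"
  by (simp add: update_def)

section \<open>The algorithm\<close>

text \<open>Doubling \<open>k\<close> while quartering \<open>delta\<close> keeps
  \<open>delta\<close> times the square of \<open>k\<close> equal to \<open>epsilon\<close>, which
  replaces a division. Stopping at the first power of two that is at least \<open>2 n\<close> keeps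
  \<open>k\<close> below \<open>max 1 (4 n)\<close> or equal to it, so \<open>1 / delta\<close>
  stays polynomial.\<close>

definition scale_prog :: com where
  "scale_prog = Seq (nset ''k'' (NConst 1)) (Seq (rset ''delta'' (rvar ''epsilon''))
     (While (NLess (nvar ''k'') (NAdd (nvar ''n_col'') (nvar ''n_col'')))
       (Seq (nset ''k'' (NAdd (nvar ''k'') (nvar ''k'')))
         (rset ''delta'' (RHalf (RHalf (rvar ''delta'')))))))"

lemma halts_scale:
  assumes n: "nmem s ''n_col'' 0 0 = n" and \<epsilon>: "rmem s ''epsilon'' 0 0 = \<epsilon>" "0 < \<epsilon>"
  shows "halts W scale_prog s (12 * n + 3) (\<lambda>s'. unchanged {''k''} {''delta''} s s' \<and>
    0 < rmem s' ''delta'' 0 0 \<and> 4 * (real n)\<^sup>2 * rmem s' ''delta'' 0 0 \<le> \<epsilon> \<and>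
    1 / rmem s' ''delta'' 0 0 \<le> (1 + 16 * (real n)\<^sup>2) / \<epsilon>)"
proof -
  define I where "I s' \<longleftrightarrow> unchanged {''k''} {''delta''} s s' \<and> 1 \<le> nmem s' ''k'' 0 0 \<and>
    nmem s' ''k'' 0 0 \<le> max 1 (4 * n) \<and>
    rmem s' ''delta'' 0 0 * (real (nmem s' ''k'' 0 0))\<^sup>2 = \<epsilon>" for s'
  let ?b = "NLess (nvar ''k'') (NAdd (nvar ''n_col'') (nvar ''n_col''))"
  have post: "unchanged {''k''} {''delta''} s s' \<and>
    0 < rmem s' ''delta'' 0 0 \<and> 4 * (real n)\<^sup>2 * rmem s' ''delta'' 0 0 \<le> \<epsilon> \<and>
    1 / rmem s' ''delta'' 0 0 \<le> (1 + 16 * (real n)\<^sup>2) / \<epsilon>" if I: "I s'" and b: "\<not> bval W s' ?b" for s'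
  proof -
    let ?k = "nmem s' ''k'' 0 0" and ?d = "rmem s' ''delta'' 0 0"
    have k: "1 \<le> ?k" "?k \<le> max 1 (4 * n)" "?d * (real ?k)\<^sup>2 = \<epsilon>" and u: "unchanged {''k''} {''delta''} s s'"
      using I by (simp_all add: I_def)
    have "nmem s' ''n_col'' = nmem s ''n_col''" by (rule unchanged_nmem[OF u]) simp
    then have "2 * n \<le> ?k" using b n by simp
    then have "(real (2 * n))\<^sup>2 \<le> (real ?k)\<^sup>2" by (intro power_mono) simp_all
    then have k1: "4 * (real n)\<^sup>2 \<le> (real ?k)\<^sup>2" by (simp add: power_mult_distrib)
    have kpos: "0 < (real ?k)\<^sup>2" using k(1) by simp
    then have d: "0 < ?d" using k(3) \<epsilon>(2) by (metis zero_less_mult_pos2)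
    have "4 * (real n)\<^sup>2 * ?d \<le> (real ?k)\<^sup>2 * ?d"
      using k1 d by (intro mult_right_mono) auto
    then have 1: "4 * (real n)\<^sup>2 * ?d \<le> \<epsilon>" using k(3) by (simp add: mult.commute)
    have "(real ?k)\<^sup>2 \<le> (real (max 1 (4 * n)))\<^sup>2"
      using k(2) by (intro power_mono) simp_all
    also have "\<dots> \<le> 1 + 16 * (real n)\<^sup>2"
      by (simp add: max_def power_mult_distrib)
    finally have "(real ?k)\<^sup>2 / \<epsilon> \<le> (1 + 16 * (real n)\<^sup>2) / \<epsilon>"
      using \<epsilon>(2) by (intro divide_right_mono) auto
    moreover have "(real ?k)\<^sup>2 / \<epsilon> = 1 / ?d"
      using k(3) d kpos \<epsilon>(2) by (simp add: field_simps)
    ultimately show ?thesis using u d 1 by simp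
  qed
  have loop: "halts W (While ?b (Seq (nset ''k'' (NAdd (nvar ''k'') (nvar ''k'')))
         (rset ''delta'' (RHalf (RHalf (rvar ''delta'')))))) s' (4 * n * (1 + 1 + 1) + 1)
      (\<lambda>s'. I s' \<and> \<not> bval W s' ?b)" if "I s'" for s'
  proof (rule halts_time[OF halts_While[where I = I and m = "\<lambda>s. 4 * n - nmem s ''k'' 0 0", OF that]])
    fix s1 assume I: "I s1" and b: "bval W s1 ?b"
    let ?k = "nmem s1 ''k'' 0 0"
    have "unchanged {''k''} {''delta''} s s1" using I by (simp add: I_def)
    then have "nmem s1 ''n_col'' = nmem s ''n_col''" by (rule unchanged_nmem) simp
    then have "?k < 2 * n" using b n by simp
    moreover have "rmem s1 ''delta'' 0 0 / 2 / 2 * (real (?k + ?k))\<^sup>2 = \<epsilon>"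
      using I by (simp add: I_def power2_eq_square algebra_simps)
    ultimately show "halts W (Seq (nset ''k'' (NAdd (nvar ''k'') (nvar ''k'')))
         (rset ''delta'' (RHalf (RHalf (rvar ''delta''))))) s1 (1 + 1)
       (\<lambda>s'. I s' \<and> 4 * n - nmem s' ''k'' 0 0 < 4 * n - nmem s1 ''k'' 0 0)"
      using I
      by (intro halts_Seq halts_NAssign halts_RAssign) (auto simp: I_def update_apply unchanged_update)
  qed simp
  show ?thesis
    unfolding scale_prog_def
  proof (rule halts_time)
    show "halts W (Seq (nset ''k'' (NConst 1)) (Seq (rset ''delta'' (rvar ''epsilon''))
     (While ?b
       (Seq (nset ''k'' (NAdd (nvar ''k'') (nvar ''k'')))
         (rset ''delta'' (RHalf (RHalf (rvar ''delta'')))))))) s (1 + (1 + (4 * n * (1 + 1 + 1) + 1)))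
     (\<lambda>s'. unchanged {''k''} {''delta''} s s' \<and>
    0 < rmem s' ''delta'' 0 0 \<and> 4 * (real n)\<^sup>2 * rmem s' ''delta'' 0 0 \<le> \<epsilon> \<and>
    1 / rmem s' ''delta'' 0 0 \<le> (1 + 16 * (real n)\<^sup>2) / \<epsilon>)"
      by (intro halts_Seq halts_NAssign halts_RAssign, rule halts_mono[OF loop order_refl post])
        (auto simp: I_def update_apply unchanged_update \<epsilon> unchanged_refl)
  qed simp
qed

definition split_prog :: com where
  "split_prog =
     Seq (RAssign ''lo'' (NConst 0) (nvar ''t'') (rent ''lo'' (nvar ''h'')))
    (Seq (RAssign ''hi'' (NConst 0) (nvar ''t'')
       (RHalf (RAdd (rent ''lo'' (nvar ''h'')) (rent ''hi'' (nvar ''h'')))))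
    (Seq (NAssign ''lev'' (NConst 0) (nvar ''t'') (incr (nent ''lev'' (nvar ''h''))))
    (Seq (RAssign ''lo'' (NConst 0) (incr (nvar ''t''))
       (RHalf (RAdd (rent ''lo'' (nvar ''h'')) (rent ''hi'' (nvar ''h'')))))
    (Seq (RAssign ''hi'' (NConst 0) (incr (nvar ''t'')) (rent ''hi'' (nvar ''h'')))
    (Seq (NAssign ''lev'' (NConst 0) (incr (nvar ''t'')) (incr (nent ''lev'' (nvar ''h''))))
      (nset ''t'' (incr (incr (nvar ''t'')))))))))"

definition bisect_prog :: com where
  "bisect_prog =
     Seq (RAssign ''lo'' (NConst 0) (NConst 0) ROne)
    (Seq (RAssign ''lo'' (NConst 0) (NConst 1) RZero)
    (Seq (RAssign ''hi'' (NConst 0) (NConst 1) ROne)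
    (Seq (NAssign ''lev'' (NConst 0) (NConst 1) (NConst 0))
    (Seq (nset ''h'' (NConst 1))
    (Seq (nset ''t'' (NConst 2))
      (While (NLess (nvar ''h'') (nvar ''t''))
        (Seq
          (Cond (BAnd (NLess (nent ''lev'' (nvar ''h'')) (nvar ''precision''))
              (RLess (rvar ''delta'') (AskProb (rent ''lo'' (nvar ''h'')) (rent ''hi'' (nvar ''h'')))))
            split_prog Skip)
          (nset ''h'' (incr (nvar ''h''))))))))))"

definition eval_prog :: com where
  "eval_prog =
     Seq (nset ''j'' (NConst 0))
    (Seq (For ''j'' (nvar ''n_col'')
      (Cond (NLess (nvar ''j'') (nvar ''i''))
        (RAssign ''bids'' (NConst 0) (nvar ''j'') (rent ''lo'' (nvar ''a'')))
        (RAssign ''bids'' (NConst 0) (nvar ''j'') (rent ''lo'' (nvar ''c'')))))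
    (Seq (rset ''u'' RZero)
    (Seq (nset ''j'' (NConst 0))
      (For ''j'' (nvar ''n_col'')
        (rset ''u'' (RAdd (rvar ''u'') (RSub (AskRevenue ''bids'' (NConst 0) (nvar ''j''))
          (AskPayment ''bids'' (NConst 0) (nvar ''j'')))))))))"

text \<open>With \<open>i = 0\<close> no bid is taken from \<open>a\<close>, so
  \<open>eval_prog\<close> computes the utility of the constant vector with entries
  \<open>lo c\<close>.\<close>

definition init_prog :: com where
  "init_prog =
     Seq (nset ''i'' (NConst 0)) (Seq (nset ''a'' (NConst 0)) (Seq (nset ''c'' (NConst 0))
       (For ''c'' (nvar ''t'')
         (Seq eval_prog (RAssign ''V'' (NConst 1) (nvar ''c'') (rvar ''u''))))))"

text \<open>Row 1 of \<open>V\<close> holds the utilities of the constant vectors, so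
  \<open>u - V 1 a\<close> is the step gain and one evaluation per edge is enough.\<close>

definition relax_prog :: com where
  "relax_prog =
     Cond (BNot (RLess (rent ''lo'' (nvar ''a'')) (rent ''lo'' (nvar ''c''))))
       (Seq eval_prog
       (Seq (rset ''x'' (RSub (RAdd (RVar ''V'' (nvar ''i'') (nvar ''a'')) (rvar ''u''))
           (RVar ''V'' (NConst 1) (nvar ''a''))))
         (Cond (RLess (RVar ''V'' (incr (nvar ''i'')) (nvar ''c'')) (rvar ''x''))
           (Seq (RAssign ''V'' (incr (nvar ''i'')) (nvar ''c'') (rvar ''x''))
             (NAssign ''prv'' (incr (nvar ''i'')) (nvar ''c'') (nvar ''a'')))
           Skip)))
       Skip"

text \<open>The initial candidate is \<open>c\<close> itself, whose step gain is 0, so the entry is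
  attained by its recorded predecessor from the start.\<close>

definition entry_prog :: com where
  "entry_prog =
     Seq (RAssign ''V'' (incr (nvar ''i'')) (nvar ''c'') (RVar ''V'' (nvar ''i'') (nvar ''c'')))
    (Seq (NAssign ''prv'' (incr (nvar ''i'')) (nvar ''c'') (nvar ''c''))
    (Seq (nset ''a'' (NConst 0))
      (For ''a'' (nvar ''t'') relax_prog)))"

definition dp_prog :: com where
  "dp_prog =
     Seq (nset ''i'' (NConst 1))
       (For ''i'' (nvar ''n_col'')
         (Seq (nset ''c'' (NConst 0)) (For ''c'' (nvar ''t'') entry_prog)))"

definition best_prog :: com where
  "best_prog =
     Seq (nset ''c'' (NConst 0)) (Seq (nset ''a'' (NConst 0))
       (For ''a'' (nvar ''t'')
         (Cond (RLess (RVar ''V'' (nvar ''n_col'') (nvar ''c'')) (RVar ''V'' (nvar ''n_col'') (nvar ''a'')))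
           (nset ''c'' (nvar ''a'')) Skip)))"

definition backtrack_prog :: com where
  "backtrack_prog =
     Seq (nset ''i'' (nvar ''n_col''))
       (While (NLess (NConst 0) (nvar ''i''))
         (Seq (RAssign ''bids'' (NConst 0) (NSub (nvar ''i'') (NConst 1)) (rent ''lo'' (nvar ''c'')))
         (Seq (nset ''c'' (NVar ''prv'' (nvar ''i'') (nvar ''c'')))
           (nset ''i'' (NSub (nvar ''i'') (NConst 1))))))"

definition transfer_prog :: com where
  "transfer_prog =
     Seq (nset ''j'' (NConst 0))
    (Seq (For ''j'' (nvar ''n_col'')
      (RAssign ''transfer'' (NConst 0) (nvar ''j'')
        (RAdd (RSub (AskRevenue ''bids'' (NConst 0) (nvar ''j'')) (rent ''target'' (nvar ''j'')))
          (rvar ''epsilon''))))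
    (Seq (rset ''prob'' ROne) (nset ''n_atoms'' (NConst 1))))"

text \<open>One program serves both mechanisms: payment rule, rates and valuations enter only
  through the oracle answers.\<close>

definition agency_prog :: com where
  "agency_prog =
     Seq scale_prog (Seq bisect_prog (Seq init_prog (Seq dp_prog
       (Seq best_prog (Seq backtrack_prog transfer_prog)))))"

section \<open>Correctness and running time of the phases\<close>

lemma halts_split:
  assumes "nmem s ''h'' 0 0 = h" "nmem s ''t'' 0 0 = t" "t \<noteq> h" "Suc t \<noteq> h"
    and "rmem s ''lo'' 0 = lo" "rmem s ''hi'' 0 = hi" "nmem s ''lev'' 0 = lev"
    and "\<And>s'. unchanged {''t'', ''lev''} {''lo'', ''hi''} s s' \<Longrightarrow> nmem s' ''t'' 0 0 = Suc (Suc t) \<Longrightarrow>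
      rmem s' ''lo'' 0 = lo(t := lo h, Suc t := (lo h + hi h) / 2) \<Longrightarrow>
      rmem s' ''hi'' 0 = hi(t := (lo h + hi h) / 2, Suc t := hi h) \<Longrightarrow>
      nmem s' ''lev'' 0 = lev(t := Suc (lev h), Suc t := Suc (lev h)) \<Longrightarrow> Q s'"
  shows "halts W split_prog s (Suc (Suc (Suc (Suc (Suc (Suc 1)))))) Q"
proof -
  note simps = update_apply assms(1-3,5-7) assms(3)[symmetric] assms(4)[symmetric]
  show ?thesis
    unfolding split_prog_def
    apply (rule halts_Seq_RAssign, simp add: simps)
    apply (rule halts_Seq_RAssign, simp add: simps)
    apply (rule halts_Seq_NAssign, simp add: simps)
    apply (rule halts_Seq_RAssign, simp add: simps)
    apply (rule halts_Seq_RAssign, simp add: simps)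
    apply (rule halts_Seq_NAssign, simp add: simps)
    apply (rule halts_NAssign[unfolded One_nat_def])
    apply (rule assms(8))
        apply (simp_all add: simps unchanged_update unchanged_refl)
    done
qed

lemma halts_bisect_start:
  assumes "\<And>s'. unchanged {''h'', ''t'', ''lev''} {''lo'', ''hi''} s s' \<Longrightarrow>
      nmem s' ''h'' 0 0 = 1 \<Longrightarrow> nmem s' ''t'' 0 0 = 2 \<Longrightarrow> rmem s' ''lo'' 0 0 = 1 \<Longrightarrow>
      rmem s' ''lo'' 0 1 = 0 \<Longrightarrow> rmem s' ''hi'' 0 1 = 1 \<Longrightarrow> nmem s' ''lev'' 0 1 = 0 \<Longrightarrow> halts W d s' m Q"
  shows "halts W
     (Seq (RAssign ''lo'' (NConst 0) (NConst 0) ROne)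
     (Seq (RAssign ''lo'' (NConst 0) (NConst 1) RZero)
     (Seq (RAssign ''hi'' (NConst 0) (NConst 1) ROne)
     (Seq (NAssign ''lev'' (NConst 0) (NConst 1) (NConst 0))
     (Seq (nset ''h'' (NConst 1))
     (Seq (nset ''t'' (NConst 2)) d)))))) s (Suc (Suc (Suc (Suc (Suc (Suc m)))))) Q"
  apply (rule halts_Seq_RAssign, simp add: update_apply)
  apply (rule halts_Seq_RAssign, simp add: update_apply)
  apply (rule halts_Seq_RAssign, simp add: update_apply)
  apply (rule halts_Seq_NAssign, simp add: update_apply)
  apply (rule halts_Seq_NAssign, simp add: update_apply)
  apply (rule halts_Seq_NAssign)
  apply (rule assms)
        apply (simp_all add: update_apply unchanged_update unchanged_refl)
  done

context valid_instance
begin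

lemma oracle_answers:
  assumes "\<And>i. i < n_col A \<Longrightarrow> b i \<in> {0..1}" "j < n_col A"
  shows "revenue_answer (auction_oracles mech A) b j = exp_revenue A b j"
    and "payment_answer (auction_oracles mech A) b j = exp_payment mech A b j"
proof -
  have "restrict b {..<n_col A} \<in> bid_vectors A" using assms(1) by auto
  then show "revenue_answer (auction_oracles mech A) b j = exp_revenue A b j"
    "payment_answer (auction_oracles mech A) b j = exp_payment mech A b j"
    using assms(2) by (simp_all add: auction_oracles_def exp_restrict)
qed

lemma prob_answer_eq:
  "0 \<le> \<alpha> \<Longrightarrow> \<alpha> \<le> \<beta> \<Longrightarrow> \<beta> \<le> 1 \<Longrightarrow> prob_answer (auction_oracles mech A) \<alpha> \<beta> = ext_prob \<alpha> \<beta>"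
  by (simp add: auction_oracles_def)

abbreviation bisection_state :: "real \<Rightarrow> state \<Rightarrow> bool" where
  "bisection_state \<delta> s \<equiv> bisection \<delta> (nmem s ''h'' 0 0) (nmem s ''t'' 0 0)
     (rmem s ''lo'' 0) (rmem s ''hi'' 0) (nmem s ''lev'' 0)"

text \<open>The potential gives termination: \<open>h\<close> stays at most \<open>t\<close> and
  \<open>t\<close> at most \<open>N\<close>, so \<open>N - h\<close> is a variant although the queue
  grows.\<close>

lemma halts_bisect:
  assumes M: "nmem s ''precision'' 0 0 = precision A" and \<delta>: "rmem s ''delta'' 0 0 = \<delta>" "0 < \<delta>"
    and N: "2 + 2 * real (precision A) * real (n_ext A) / \<delta> \<le> real N"
  shows "halts (auction_oracles mech A) bisect_prog s (11 * N + 7) (\<lambda>s'.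
    unchanged {''h'', ''t'', ''lev''} {''lo'', ''hi''} s s' \<and> nmem s' ''t'' 0 0 \<le> N \<and>
    bisection \<delta> (nmem s' ''t'' 0 0) (nmem s' ''t'' 0 0)
      (rmem s' ''lo'' 0) (rmem s' ''hi'' 0) (nmem s' ''lev'' 0))"
proof -
  let ?W = "auction_oracles mech A"
  define I where "I s' \<longleftrightarrow> unchanged {''h'', ''t'', ''lev''} {''lo'', ''hi''} s s' \<and>
    bisection_state \<delta> s'" for s'
  let ?b = "NLess (nvar ''h'') (nvar ''t'')"
  let ?c = "Seq (Cond (BAnd (NLess (nent ''lev'' (nvar ''h'')) (nvar ''precision''))
              (RLess (rvar ''delta'') (AskProb (rent ''lo'' (nvar ''h'')) (rent ''hi'' (nvar ''h'')))))
            split_prog Skip)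
          (nset ''h'' (incr (nvar ''h'')))"
  have tN: "nmem s' ''t'' 0 0 \<le> N" if "I s'" for s'
  proof -
    have "real (nmem s' ''t'' 0 0) \<le> real N"
      using bisection_tail_le[of \<delta>] that \<delta>(2) N unfolding I_def by (meson order_trans)
    then show ?thesis by simp
  qed
  have ht: "nmem s' ''h'' 0 0 \<le> nmem s' ''t'' 0 0" if "I s'" for s'
    using that by (simp add: I_def bisection_def)
  have loop: "halts ?W (While ?b ?c) s' (N * (10 + 1) + 1) (\<lambda>s'. I s' \<and> \<not> bval ?W s' ?b)" if "I s'" for s'
  proof (rule halts_time[OF halts_While[where I = I and m = "\<lambda>s. N - nmem s ''h'' 0 0", OF that]])
    fix s1 assume I: "I s1" and b: "bval ?W s1 ?b"
    let ?h = "nmem s1 ''h'' 0 0" and ?t = "nmem s1 ''t'' 0 0"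
    let ?lo = "rmem s1 ''lo'' 0" and ?hi = "rmem s1 ''hi'' 0" and ?lev = "nmem s1 ''lev'' 0"
    have u: "unchanged {''h'', ''t'', ''lev''} {''lo'', ''hi''} s s1"
      and inv: "bisection \<delta> ?h ?t ?lo ?hi ?lev"
      using I by (simp_all add: I_def)
    have "nmem s1 ''precision'' = nmem s ''precision''" "rmem s1 ''delta'' = rmem s ''delta''"
      using unchanged_nmem[OF u] unchanged_rmem[OF u] by simp_all
    then have vars: "nmem s1 ''precision'' 0 0 = precision A" "rmem s1 ''delta'' 0 0 = \<delta>"
      using M \<delta> by simp_all
    have h: "?h < ?t" "1 \<le> ?h" "?h < N"
      using b inv tN[OF I] by (auto simp: bisection_def)
    have "prob_answer ?W (?lo ?h) (?hi ?h) = ext_prob (?lo ?h) (?hi ?h)"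
      using bisection_interval[OF inv h(2,1)] by (intro prob_answer_eq) auto
    then have test: "bval ?W s1 (BAnd (NLess (nent ''lev'' (nvar ''h'')) (nvar ''precision''))
              (RLess (rvar ''delta'') (AskProb (rent ''lo'' (nvar ''h'')) (rent ''hi'' (nvar ''h''))))) \<longleftrightarrow>
        ?lev ?h < precision A \<and> \<delta> < ext_prob (?lo ?h) (?hi ?h)"
      using vars by simp
    have skip: "bisection \<delta> (Suc ?h) ?t ?lo ?hi ?lev"
      if "\<not> (?lev ?h < precision A \<and> \<delta> < ext_prob (?lo ?h) (?hi ?h))"
      using bisection_skip[OF inv h(1) \<delta>(2) that] .
    have split: "bisection \<delta> (Suc ?h) (Suc (Suc ?t)) (?lo(?t := ?lo ?h, Suc ?t := (?lo ?h + ?hi ?h) / 2))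
        (?hi(?t := (?lo ?h + ?hi ?h) / 2, Suc ?t := ?hi ?h))
        (?lev(?t := Suc (?lev ?h), Suc ?t := Suc (?lev ?h)))"
      if "?lev ?h < precision A \<and> \<delta> < ext_prob (?lo ?h) (?hi ?h)"
      using bisection_split[OF inv h(1) \<delta>(2)] that by blast
    have ne: "?t \<noteq> ?h" "Suc ?t \<noteq> ?h" using h by auto
    let ?Q = "\<lambda>s'. I s' \<and> N - nmem s' ''h'' 0 0 < N - nmem s1 ''h'' 0 0"
    have step: "halts ?W (nset ''h'' (incr (nvar ''h''))) s2 1 ?Q"
      if "unchanged {''t'', ''lev''} {''lo'', ''hi''} s1 s2"
        "bisection \<delta> (Suc ?h) (nmem s2 ''t'' 0 0) (rmem s2 ''lo'' 0) (rmem s2 ''hi'' 0) (nmem s2 ''lev'' 0)" for s2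
    proof (rule halts_NAssign)
      have "unchanged {''h'', ''t'', ''lev''} {''lo'', ''hi''} s s2"
        using unchanged_trans[OF u that(1)] by simp
      moreover have "nmem s2 ''h'' = nmem s1 ''h''"
        by (rule unchanged_nmem[OF that(1)]) simp
      ultimately show "?Q (s2\<lparr>nmem := update (nmem s2) ''h'' (nval s2 (NConst 0)) (nval s2 (NConst 0))
          (nval s2 (incr (nvar ''h'')))\<rparr>)"
        using that(2) h(3) by (simp add: I_def update_apply unchanged_update)
    qed
    have "halts ?W ?c s1 (max (Suc (Suc (Suc (Suc (Suc (Suc 1)))))) 1 + 1 + 1) ?Q"
    proof (rule halts_Seq, rule halts_Cond, unfold test)
      assume "?lev ?h < precision A \<and> \<delta> < ext_prob (?lo ?h) (?hi ?h)"
      from split[OF this] show "halts ?W split_prog s1 (Suc (Suc (Suc (Suc (Suc (Suc 1))))))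
          (\<lambda>s'. halts ?W (nset ''h'' (incr (nvar ''h''))) s' 1 ?Q)"
        by (intro halts_split[OF refl refl ne refl refl refl] step) simp_all
    next
      assume "\<not> (?lev ?h < precision A \<and> \<delta> < ext_prob (?lo ?h) (?hi ?h))"
      from skip[OF this] show "halts ?W Skip s1 1 (\<lambda>s'. halts ?W (nset ''h'' (incr (nvar ''h''))) s' 1 ?Q)"
        by (intro halts_Skip step unchanged_refl)
    qed
    then show "halts ?W ?c s1 10 ?Q"
      by (rule halts_time) simp
  qed simp
  have post: "unchanged {''h'', ''t'', ''lev''} {''lo'', ''hi''} s s' \<and> nmem s' ''t'' 0 0 \<le> N \<and>
    bisection \<delta> (nmem s' ''t'' 0 0) (nmem s' ''t'' 0 0)
      (rmem s' ''lo'' 0) (rmem s' ''hi'' 0) (nmem s' ''lev'' 0)" if "I s'" "\<not> bval ?W s' ?b" for s'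
  proof -
    have "nmem s' ''h'' 0 0 = nmem s' ''t'' 0 0" using that ht[OF that(1)] by simp
    then show ?thesis using that(1) tN[OF that(1)] by (simp add: I_def)
  qed
  have start: "I s'" if "unchanged {''h'', ''t'', ''lev''} {''lo'', ''hi''} s s'"
    "nmem s' ''h'' 0 0 = 1" "nmem s' ''t'' 0 0 = 2"
    "rmem s' ''lo'' 0 0 = 1" "rmem s' ''lo'' 0 1 = 0" "rmem s' ''hi'' 0 1 = 1" "nmem s' ''lev'' 0 1 = 0" for s'
    unfolding I_def using that bisection_init[OF \<delta>(2)] by metis
  show ?thesis
    unfolding bisect_prog_def
  proof (rule halts_time, rule halts_bisect_start)
    fix s' assume "unchanged {''h'', ''t'', ''lev''} {''lo'', ''hi''} s s'"
      "nmem s' ''h'' 0 0 = 1" "nmem s' ''t'' 0 0 = 2"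
      "rmem s' ''lo'' 0 0 = 1" "rmem s' ''lo'' 0 1 = 0" "rmem s' ''hi'' 0 1 = 1" "nmem s' ''lev'' 0 1 = 0"
    from loop[OF start[OF this]]
    show "halts ?W (While ?b ?c) s' (N * (10 + 1) + 1) (\<lambda>s'.
        unchanged {''h'', ''t'', ''lev''} {''lo'', ''hi''} s s' \<and> nmem s' ''t'' 0 0 \<le> N \<and>
        bisection \<delta> (nmem s' ''t'' 0 0) (nmem s' ''t'' 0 0)
          (rmem s' ''lo'' 0) (rmem s' ''hi'' 0) (nmem s' ''lev'' 0))"
      by (rule halts_mono[OF _ order_refl]) (rule post; blast)
  qed simp
qed

lemma halts_eval:
  assumes n: "nmem s ''n_col'' 0 0 = n_col A"
    and x: "rmem s ''lo'' 0 (nmem s ''a'' 0 0) = x" "x \<in> {0..1}"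
    and y: "rmem s ''lo'' 0 (nmem s ''c'' 0 0) = y" "y \<in> {0..1}"
    and i: "nmem s ''i'' 0 0 = i"
  shows "halts (auction_oracles mech A) eval_prog s (7 * n_col A + 5) (\<lambda>s'.
    unchanged {''j''} {''bids'', ''u''} s s' \<and>
    rmem s' ''u'' 0 0 = coalition_utility mech A (step_bids i x y))"
proof -
  let ?W = "auction_oracles mech A" and ?n = "n_col A"
  let ?b = "step_bids i x y"
  define I where "I k s' \<longleftrightarrow> unchanged {''j''} {''bids'', ''u''} s s' \<and> nmem s' ''j'' 0 0 = k \<and>
    (\<forall>l<k. rmem s' ''bids'' 0 l = ?b l)" for k s'
  define J where "J k s' \<longleftrightarrow> unchanged {''j''} {''bids'', ''u''} s s' \<and> nmem s' ''j'' 0 0 = k \<and>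
    (\<forall>l<?n. rmem s' ''bids'' 0 l = ?b l) \<and>
    rmem s' ''u'' 0 0 = (\<Sum>l<k. exp_revenue A ?b l - exp_payment mech A ?b l)" for k s'
  have vars: "nmem s' ''n_col'' 0 0 = ?n \<and> nmem s' ''i'' 0 0 = i \<and>
      rmem s' ''lo'' 0 (nmem s' ''a'' 0 0) = x \<and> rmem s' ''lo'' 0 (nmem s' ''c'' 0 0) = y"
    if "unchanged {''j''} {''bids'', ''u''} s s'" for s'
    using unchanged_nmem[OF that] unchanged_rmem[OF that] n x y i by simp
  let ?c1 = "Cond (NLess (nvar ''j'') (nvar ''i''))
        (RAssign ''bids'' (NConst 0) (nvar ''j'') (rent ''lo'' (nvar ''a'')))
        (RAssign ''bids'' (NConst 0) (nvar ''j'') (rent ''lo'' (nvar ''c'')))"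
  let ?c2 = "rset ''u'' (RAdd (rvar ''u'') (RSub (AskRevenue ''bids'' (NConst 0) (nvar ''j''))
          (AskPayment ''bids'' (NConst 0) (nvar ''j''))))"
  have fill: "halts ?W (For ''j'' (nvar ''n_col'') ?c1) s' ((?n - 0) * (max 1 1 + 1 + 2) + 1) (I (max 0 ?n))"
    if "I 0 s'" for s'
  proof (rule halts_For[where I = I, OF that])
    fix k s1 assume I: "I k s1"
    then have u: "unchanged {''j''} {''bids'', ''u''} s s1" by (simp add: I_def)
    show "nmem s1 ''j'' 0 0 = k \<and> nval s1 (nvar ''n_col'') = ?n"
      using I vars[OF u] by (simp add: I_def)
    assume "k < ?n"
    show "halts ?W ?c1 s1 (max 1 1 + 1) (\<lambda>s'. nmem s' ''j'' 0 0 = k \<and>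
        I (Suc k) (s'\<lparr>nmem := update (nmem s') ''j'' 0 0 (Suc k)\<rparr>))"
      using I vars[OF u]
      by (intro halts_Cond halts_RAssign) (auto simp: I_def update_apply unchanged_update less_Suc_eq)
  qed
  \<comment> \<open>The row in memory is known to agree with the step vector only at the colluders,
    so the answers are compared after restriction.\<close>
  have ans: "revenue_answer ?W b j = exp_revenue A ?b j" "payment_answer ?W b j = exp_payment mech A ?b j"
    if b: "\<forall>l<?n. b l = ?b l" and j: "j < ?n" for b j
  proof -
    have r: "restrict b {..<?n} = restrict ?b {..<?n}" using b by (auto simp: restrict_def)
    have "b l \<in> {0..1}" if "l < ?n" for l using b x y that by auto
    from oracle_answers[OF this j] show "revenue_answer ?W b j = exp_revenue A ?b j"
      "payment_answer ?W b j = exp_payment mech A ?b j"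
      using exp_restrict[OF j, where b = b] exp_restrict[OF j, where b = ?b]
      unfolding r by simp_all
  qed
  have total: "halts ?W (For ''j'' (nvar ''n_col'') ?c2) s' ((?n - 0) * (1 + 2) + 1) (J (max 0 ?n))"
    if "J 0 s'" for s'
  proof (rule halts_For[where I = J, OF that])
    fix k s1 assume J: "J k s1"
    then have u: "unchanged {''j''} {''bids'', ''u''} s s1" by (simp add: J_def)
    show "nmem s1 ''j'' 0 0 = k \<and> nval s1 (nvar ''n_col'') = ?n"
      using J vars[OF u] by (simp add: J_def)
    assume k: "k < ?n"
    have b: "\<forall>l<?n. rmem s1 ''bids'' 0 l = ?b l" and j: "nmem s1 ''j'' 0 0 = k"
      and sum: "rmem s1 ''u'' 0 0 = (\<Sum>l<k. exp_revenue A ?b l - exp_payment mech A ?b l)"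
      using J unfolding J_def by blast+
    have "rval ?W s1 (RAdd (rvar ''u'') (RSub (AskRevenue ''bids'' (NConst 0) (nvar ''j''))
          (AskPayment ''bids'' (NConst 0) (nvar ''j'')))) =
        (\<Sum>l<Suc k. exp_revenue A ?b l - exp_payment mech A ?b l)"
      by (simp add: j sum ans[OF b k])
    then show "halts ?W ?c2 s1 1 (\<lambda>s'. nmem s' ''j'' 0 0 = k \<and>
        J (Suc k) (s'\<lparr>nmem := update (nmem s') ''j'' 0 0 (Suc k)\<rparr>))"
      using u b j unfolding J_def
      by (intro halts_RAssign) (simp add: update_apply unchanged_update del: sum.lessThan_Suc rval.simps)
  qed
  have "halts ?W eval_prog s (1 + ((?n - 0) * (max 1 1 + 1 + 2) + 1 + (1 + (1 + ((?n - 0) * (1 + 2) + 1)))))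
    (J (max 0 ?n))"
    unfolding eval_prog_def
    apply (intro halts_Seq halts_NAssign)
    apply (rule halts_mono[OF fill order_refl])
     apply (simp add: I_def update_apply unchanged_update unchanged_refl)
    apply (intro halts_Seq halts_NAssign halts_RAssign)
    apply (rule total)
    apply (simp add: I_def J_def update_apply unchanged_update)
    done
  then show ?thesis
    by (rule halts_mono) (simp_all add: J_def coalition_utility_def)
qed

end

text \<open>The index reached from \<open>c\<close> in row \<open>n\<close> after \<open>k\<close>
  steps back along \<open>prv\<close>; it belongs to row \<open>n - k\<close>.\<close>

primrec chain :: "(nat \<Rightarrow> nat \<Rightarrow> nat) \<Rightarrow> nat \<Rightarrow> nat \<Rightarrow> nat \<Rightarrow> nat" where
  "chain prv n c 0 = c"
| "chain prv n c (Suc k) = prv (n - k) (chain prv n c k)"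

lemma halts_best:
  assumes n: "nmem s ''n_col'' 0 0 = n" and K: "nmem s ''t'' 0 0 = K" "0 < K" and V: "rmem s ''V'' n = v"
  shows "halts W best_prog s (4 * K + 3) (\<lambda>s'. unchanged {''a'', ''c''} {} s s' \<and>
    nmem s' ''c'' 0 0 < K \<and> (\<forall>a<K. v a \<le> v (nmem s' ''c'' 0 0)))"
proof -
  define I where "I k s' \<longleftrightarrow> unchanged {''a'', ''c''} {} s s' \<and> nmem s' ''a'' 0 0 = k \<and>
    nmem s' ''c'' 0 0 < K \<and> (\<forall>a<k. v a \<le> v (nmem s' ''c'' 0 0))" for k s'
  let ?c = "Cond (RLess (RVar ''V'' (nvar ''n_col'') (nvar ''c'')) (RVar ''V'' (nvar ''n_col'') (nvar ''a'')))
           (nset ''c'' (nvar ''a'')) Skip"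
  have loop: "halts W (For ''a'' (nvar ''t'') ?c) s' ((K - 0) * (max 1 1 + 1 + 2) + 1) (I (max 0 K))"
    if "I 0 s'" for s'
  proof (rule halts_For[where I = I, OF that])
    fix k s1 assume I: "I k s1"
    then have u: "unchanged {''a'', ''c''} {} s s1" by (simp add: I_def)
    have vars: "nmem s1 ''n_col'' 0 0 = n" "nmem s1 ''t'' 0 0 = K" "rmem s1 ''V'' n = v"
      using unchanged_nmem[OF u] unchanged_rmem[OF u] n K V by simp_all
    show "nmem s1 ''a'' 0 0 = k \<and> nval s1 (nvar ''t'') = K"
      using I vars by (simp add: I_def)
    assume k: "k < K"
    show "halts W ?c s1 (max 1 1 + 1) (\<lambda>s'. nmem s' ''a'' 0 0 = k \<and>
        I (Suc k) (s'\<lparr>nmem := update (nmem s') ''a'' 0 0 (Suc k)\<rparr>))"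
    proof (rule halts_Cond)
      assume "bval W s1 (RLess (RVar ''V'' (nvar ''n_col'') (nvar ''c'')) (RVar ''V'' (nvar ''n_col'') (nvar ''a'')))"
      then have "v (nmem s1 ''c'' 0 0) < v k" using I vars by (simp add: I_def)
      then have "v a \<le> v k" if "a < Suc k" for a
        using I that unfolding I_def by (metis less_Suc_eq less_imp_le order_refl order_trans)
      then show "halts W (nset ''c'' (nvar ''a'')) s1 1 (\<lambda>s'. nmem s' ''a'' 0 0 = k \<and>
          I (Suc k) (s'\<lparr>nmem := update (nmem s') ''a'' 0 0 (Suc k)\<rparr>))"
        using I k by (intro halts_NAssign) (simp add: I_def update_apply unchanged_update)
    next
      assume "\<not> bval W s1 (RLess (RVar ''V'' (nvar ''n_col'') (nvar ''c'')) (RVar ''V'' (nvar ''n_col'') (nvar ''a'')))"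
      then have "v k \<le> v (nmem s1 ''c'' 0 0)" using I vars by (simp add: I_def)
      then show "halts W Skip s1 1 (\<lambda>s'. nmem s' ''a'' 0 0 = k \<and>
          I (Suc k) (s'\<lparr>nmem := update (nmem s') ''a'' 0 0 (Suc k)\<rparr>))"
        using I by (intro halts_Skip) (auto simp: I_def update_apply unchanged_update less_Suc_eq)
    qed
  qed
  have "halts W best_prog s (1 + (1 + ((K - 0) * (max 1 1 + 1 + 2) + 1))) (I (max 0 K))"
    unfolding best_prog_def using K(2)
    by (intro halts_Seq halts_NAssign loop) (simp add: I_def update_apply unchanged_update unchanged_refl)
  then show ?thesis by (rule halts_mono) (simp_all add: I_def)
qed

lemma halts_backtrack:
  assumes n: "nmem s ''n_col'' 0 0 = n" and lo: "rmem s ''lo'' 0 = D" and prv: "nmem s ''prv'' = prv"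
    and c: "nmem s ''c'' 0 0 = c"
  shows "halts W backtrack_prog s (4 * n + 2) (\<lambda>s'. unchanged {''i'', ''c''} {''bids''} s s' \<and>
    (\<forall>l<n. rmem s' ''bids'' 0 l = D (chain prv n c (n - Suc l))))"
proof -
  define I where "I s' \<longleftrightarrow> unchanged {''i'', ''c''} {''bids''} s s' \<and> nmem s' ''i'' 0 0 \<le> n \<and>
    nmem s' ''c'' 0 0 = chain prv n c (n - nmem s' ''i'' 0 0) \<and>
    (\<forall>l. nmem s' ''i'' 0 0 \<le> l \<and> l < n \<longrightarrow> rmem s' ''bids'' 0 l = D (chain prv n c (n - Suc l)))" for s'
  let ?b = "NLess (NConst 0) (nvar ''i'')"
  let ?c = "Seq (RAssign ''bids'' (NConst 0) (NSub (nvar ''i'') (NConst 1)) (rent ''lo'' (nvar ''c'')))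
         (Seq (nset ''c'' (NVar ''prv'' (nvar ''i'') (nvar ''c'')))
           (nset ''i'' (NSub (nvar ''i'') (NConst 1))))"
  have loop: "halts W (While ?b ?c) s' (nmem s' ''i'' 0 0 * (1 + (1 + 1) + 1) + 1) (\<lambda>s'. I s' \<and> \<not> bval W s' ?b)"
    if "I s'" for s'
  proof (rule halts_While[where I = I, OF that])
    fix s1 assume I: "I s1" and b: "bval W s1 ?b"
    then have u: "unchanged {''i'', ''c''} {''bids''} s s1" by (simp add: I_def)
    have vars: "rmem s1 ''lo'' 0 = D" "nmem s1 ''prv'' = prv"
      using unchanged_nmem[OF u] unchanged_rmem[OF u] lo prv by simp_all
    obtain i where i: "nmem s1 ''i'' 0 0 = Suc i" using b by (cases "nmem s1 ''i'' 0 0") auto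
    have "Suc i \<le> n" using I i by (simp add: I_def)
    then have "n - i = Suc (n - Suc i)" "n - (n - Suc i) = Suc i"
      by simp_all
    then have "prv (Suc i) (chain prv n c (n - Suc i)) = chain prv n c (n - i)"
      by simp
    moreover have "rmem s1 ''bids'' 0 l = D (chain prv n c (n - Suc l))" if "i < l" "l < n" for l
      using I i that by (simp add: I_def)
    ultimately show "halts W ?c s1 (1 + (1 + 1)) (\<lambda>s'. I s' \<and> nmem s' ''i'' 0 0 < nmem s1 ''i'' 0 0)"
      using I i vars
      by (intro halts_Seq halts_NAssign halts_RAssign)
        (auto simp: I_def update_apply unchanged_update le_less)
  qed
  have "halts W (While ?b ?c) (s\<lparr>nmem := update (nmem s) ''i'' 0 0 n\<rparr>) (4 * n + 1)
      (\<lambda>s'. I s' \<and> \<not> bval W s' ?b)"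
    by (rule halts_time[OF loop]) (simp_all add: I_def update_apply unchanged_update unchanged_refl c)
  then have "halts W backtrack_prog s (1 + (4 * n + 1)) (\<lambda>s'. I s' \<and> \<not> bval W s' ?b)"
    unfolding backtrack_prog_def by (intro halts_Seq halts_NAssign) (simp add: n)
  then show ?thesis by (rule halts_mono) (auto simp: I_def)
qed

context valid_instance
begin

lemma halts_init:
  assumes n: "nmem s ''n_col'' 0 0 = n_col A" and K: "nmem s ''t'' 0 0 = K" "0 < K"
    and D: "rmem s ''lo'' 0 = D" "\<And>a. a < K \<Longrightarrow> D a \<in> {0..1}"
  shows "halts (auction_oracles mech A) init_prog s (K * (7 * n_col A + 8) + 4) (\<lambda>s'.
    unchanged {''i'', ''a'', ''c'', ''j''} {''bids'', ''u'', ''V''} s s' \<and>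
    (\<forall>c<K. rmem s' ''V'' 1 c = coalition_utility mech A (\<lambda>_. D c)))"
proof -
  let ?W = "auction_oracles mech A"
  let ?X = "{''i'', ''a'', ''c'', ''j''}" and ?Y = "{''bids'', ''u'', ''V''}"
  define I where "I k s' \<longleftrightarrow> unchanged ?X ?Y s s' \<and>
    nmem s' ''i'' 0 0 = 0 \<and> nmem s' ''a'' 0 0 = 0 \<and> nmem s' ''c'' 0 0 = k \<and>
    (\<forall>c<k. rmem s' ''V'' 1 c = coalition_utility mech A (\<lambda>_. D c))" for k s'
  let ?c = "Seq eval_prog (RAssign ''V'' (NConst 1) (nvar ''c'') (rvar ''u''))"
  have loop: "halts ?W (For ''c'' (nvar ''t'') ?c) s' ((K - 0) * (7 * n_col A + 5 + 1 + 2) + 1) (I (max 0 K))"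
    if "I 0 s'" for s'
  proof (rule halts_For[where I = I, OF that])
    fix k s1 assume I: "I k s1"
    then have u: "unchanged ?X ?Y s s1" by (simp add: I_def)
    have vars: "nmem s1 ''n_col'' 0 0 = n_col A" "nmem s1 ''t'' 0 0 = K" "rmem s1 ''lo'' 0 = D"
      using unchanged_nmem[OF u] unchanged_rmem[OF u] n K D by simp_all
    show "nmem s1 ''c'' 0 0 = k \<and> nval s1 (nvar ''t'') = K"
      using I vars by (simp add: I_def)
    assume k: "k < K"
    have regs: "nmem s1 ''i'' 0 0 = 0" "nmem s1 ''a'' 0 0 = 0" "nmem s1 ''c'' 0 0 = k"
      using I by (simp_all add: I_def)
    show "halts ?W ?c s1 (7 * n_col A + 5 + 1) (\<lambda>s'. nmem s' ''c'' 0 0 = k \<and>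
        I (Suc k) (s'\<lparr>nmem := update (nmem s') ''c'' 0 0 (Suc k)\<rparr>))"
    proof (rule halts_Seq, rule halts_mono[OF halts_eval order_refl])
      fix s2 assume s2: "unchanged {''j''} {''bids'', ''u''} s1 s2 \<and>
        rmem s2 ''u'' 0 0 = coalition_utility mech A (step_bids 0 (D 0) (D k))"
      then have u2: "unchanged {''j''} {''bids'', ''u''} s1 s2" by simp
      have "unchanged ?X ?Y s s2" using unchanged_trans[OF u u2] by simp
      moreover have "nmem s2 ''i'' 0 0 = 0" "nmem s2 ''a'' 0 0 = 0" "nmem s2 ''c'' 0 0 = k"
        "rmem s2 ''V'' = rmem s1 ''V''"
        using unchanged_nmem[OF u2] unchanged_rmem[OF u2] regs by simp_all
      ultimately show "halts ?W (RAssign ''V'' (NConst 1) (nvar ''c'') (rvar ''u'')) s2 1 (\<lambda>s'.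
          nmem s' ''c'' 0 0 = k \<and> I (Suc k) (s'\<lparr>nmem := update (nmem s') ''c'' 0 0 (Suc k)\<rparr>))"
        using I s2 by (intro halts_RAssign) (simp add: I_def update_apply unchanged_update less_Suc_eq)
    qed (use vars regs D k K in auto)
  qed
  have "halts ?W init_prog s (1 + (1 + (1 + ((K - 0) * (7 * n_col A + 5 + 1 + 2) + 1)))) (I (max 0 K))"
    unfolding init_prog_def
    by (intro halts_Seq halts_NAssign loop) (simp add: I_def update_apply unchanged_update unchanged_refl)
  then show ?thesis by (rule halts_mono) (simp_all add: I_def)
qed

lemma dp_entry_cong:
  assumes "V' i = V i" "V' (Suc i) c = V (Suc i) c" "prv' (Suc i) c = prv (Suc i) c"
  shows "dp_entry mech D K V' prv' i c m \<longleftrightarrow> dp_entry mech D K V prv i c m"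
  unfolding dp_entry_def assms ..

lemma dp_entry_Suc:
  assumes "dp_entry mech D K V prv i c a"
    and "D c \<le> D a \<Longrightarrow> V i a + step_gain mech i (D a) (D c) \<le> V (Suc i) c"
  shows "dp_entry mech D K V prv i c (Suc a)"
  using assms unfolding dp_entry_def less_Suc_eq by blast

text \<open>Earlier candidates are bounded by the old entry and hence by the strictly larger new
  one.\<close>

lemma dp_entry_improve:
  assumes "dp_entry mech D K V prv i c a" "a < K" "D c \<le> D a"
    and x: "x = V i a + step_gain mech i (D a) (D c)" "V (Suc i) c < x"
    and "V' i = V i" "V' (Suc i) c = x" "prv' (Suc i) c = a"
  shows "dp_entry mech D K V' prv' i c (Suc a)"
proof -
  have "V i a' + step_gain mech i (D a') (D c) \<le> x" if "a' < Suc a" "D c \<le> D a'" for a'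
  proof (cases "a' = a")
    case False
    then have "a' < a" using that(1) by simp
    then have "V i a' + step_gain mech i (D a') (D c) \<le> V (Suc i) c"
      using assms(1) that(2) unfolding dp_entry_def by blast
    then show ?thesis using x(2) by simp
  qed (simp only: x(1) order_refl)
  then show ?thesis
    using assms(2,3) x(1) unfolding dp_entry_def assms(6-8) by simp
qed

abbreviation same_except ::
    "nat \<Rightarrow> nat \<Rightarrow> state \<Rightarrow> state \<Rightarrow> bool" where
  "same_except i c s s' \<equiv> \<forall>i' c'. i' \<noteq> i \<or> c' \<noteq> c \<longrightarrow>
     rmem s' ''V'' i' c' = rmem s ''V'' i' c' \<and> nmem s' ''prv'' i' c' = nmem s ''prv'' i' c'"

lemma halts_relax:
  assumes n: "nmem s ''n_col'' 0 0 = n_col A"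
    and D: "rmem s ''lo'' 0 = D" "\<And>a. a < K \<Longrightarrow> D a \<in> {0..1}"
    and i: "nmem s ''i'' 0 0 = i" and a: "nmem s ''a'' 0 0 = a" "a < K" and c: "nmem s ''c'' 0 0 = c" "c < K"
    and V1: "rmem s ''V'' 1 a = coalition_utility mech A (\<lambda>_. D a)"
    and entry: "dp_entry mech D K (rmem s ''V'') (nmem s ''prv'') i c a"
  shows "halts (auction_oracles mech A) relax_prog s (7 * n_col A + 10) (\<lambda>s'.
    unchanged {''j'', ''prv''} {''bids'', ''u'', ''x'', ''V''} s s' \<and>
    dp_entry mech D K (rmem s' ''V'') (nmem s' ''prv'') i c (Suc a) \<and> same_except (Suc i) c s s')"
    (is "halts ?W _ _ _ ?Q")
proof -
  let ?x = "rmem s ''V'' i a + step_gain mech i (D a) (D c)"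
  let ?upd = "Seq (RAssign ''V'' (incr (nvar ''i'')) (nvar ''c'') (rvar ''x''))
             (NAssign ''prv'' (incr (nvar ''i'')) (nvar ''c'') (nvar ''a''))"
  let ?rest = "Seq (rset ''x'' (RSub (RAdd (RVar ''V'' (nvar ''i'') (nvar ''a'')) (rvar ''u''))
           (RVar ''V'' (NConst 1) (nvar ''a''))))
         (Cond (RLess (RVar ''V'' (incr (nvar ''i'')) (nvar ''c'')) (rvar ''x'')) ?upd Skip)"
  have upd: "halts ?W ?upd s2 (1 + 1) ?Q"
    if u: "unchanged {''j''} {''bids'', ''u'', ''x''} s s2" and x: "rmem s2 ''x'' 0 0 = ?x"
      and le: "D c \<le> D a" and less: "rmem s ''V'' (Suc i) c < ?x" for s2
  proof -
    have regs: "nmem s2 ''i'' 0 0 = i" "nmem s2 ''a'' 0 0 = a" "nmem s2 ''c'' 0 0 = c"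
      "rmem s2 ''V'' = rmem s ''V''" "nmem s2 ''prv'' = nmem s ''prv''"
      using unchanged_nmem[OF u] unchanged_rmem[OF u] i a c by simp_all
    have u': "unchanged {''j'', ''prv''} {''bids'', ''u'', ''x'', ''V''} s s2"
      using u by (rule unchanged_mono) auto
    have e: "dp_entry mech D K V' prv' i c (Suc a)"
      if "V' = (rmem s ''V'')(Suc i := (rmem s ''V'' (Suc i))(c := ?x))"
        "prv' = (nmem s ''prv'')(Suc i := (nmem s ''prv'' (Suc i))(c := a))" for V' prv'
      by (rule dp_entry_improve[OF entry a(2) le refl less]) (simp_all add: that)
    show ?thesis
      by (intro halts_Seq halts_RAssign halts_NAssign)
        (simp add: update_apply unchanged_update regs x u' e)
  qed
  have rest: "halts ?W ?rest s1 (1 + (max (1 + 1) 1 + 1)) ?Q"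
    if u: "unchanged {''j''} {''bids'', ''u''} s s1" and le: "D c \<le> D a"
      and val: "rmem s1 ''u'' 0 0 = coalition_utility mech A (step_bids i (D a) (D c))" for s1
  proof (rule halts_Seq, rule halts_RAssign)
    let ?s = "s1\<lparr>rmem := update (rmem s1) ''x'' (nval s1 (NConst 0)) (nval s1 (NConst 0))
      (rval ?W s1 (RSub (RAdd (RVar ''V'' (nvar ''i'') (nvar ''a'')) (rvar ''u''))
           (RVar ''V'' (NConst 1) (nvar ''a''))))\<rparr>"
    have regs: "nmem s1 ''i'' 0 0 = i" "nmem s1 ''a'' 0 0 = a" "nmem s1 ''c'' 0 0 = c"
      "rmem s1 ''V'' = rmem s ''V''"
      using unchanged_nmem[OF u] unchanged_rmem[OF u] i a c by simp_all
    have x: "rmem ?s ''x'' 0 0 = ?x"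
      using val V1 by (simp add: update_apply regs)
    have "unchanged {''j''} {''bids'', ''u'', ''x''} s s1"
      using u by (rule unchanged_mono) auto
    then have u2: "unchanged {''j''} {''bids'', ''u'', ''x''} s ?s"
      by (simp add: unchanged_update)
    have test: "bval ?W ?s (RLess (RVar ''V'' (incr (nvar ''i'')) (nvar ''c'')) (rvar ''x'')) \<longleftrightarrow>
        rmem s ''V'' (Suc i) c < ?x"
      using x unchanged_nmem[OF u2] unchanged_rmem[OF u2] i c by simp
    show "halts ?W (Cond (RLess (RVar ''V'' (incr (nvar ''i'')) (nvar ''c'')) (rvar ''x'')) ?upd Skip) ?s
        (max (1 + 1) 1 + 1) ?Q"
    proof (rule halts_Cond, unfold test)
      assume "rmem s ''V'' (Suc i) c < ?x"
      then show "halts ?W ?upd ?s (1 + 1) ?Q" by (rule upd[OF u2 x le])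
    next
      assume "\<not> rmem s ''V'' (Suc i) c < ?x"
      then have "dp_entry mech D K (rmem s ''V'') (nmem s ''prv'') i c (Suc a)"
        by (intro dp_entry_Suc[OF entry]) simp
      moreover have "rmem ?s ''V'' = rmem s ''V''" "nmem ?s ''prv'' = nmem s ''prv''"
        using unchanged_nmem[OF u2] unchanged_rmem[OF u2] by simp_all
      moreover have "unchanged {''j'', ''prv''} {''bids'', ''u'', ''x'', ''V''} s ?s"
        using u2 by (rule unchanged_mono) auto
      ultimately show "halts ?W Skip ?s 1 ?Q"
        by (intro halts_Skip) (simp only: simp_thms)
    qed
  qed
  have "halts ?W relax_prog s (max (7 * n_col A + 5 + (1 + (max (1 + 1) 1 + 1))) 1 + 1) ?Q"
    unfolding relax_prog_def
  proof (rule halts_Cond, rule halts_Seq)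
    assume "bval ?W s (BNot (RLess (rent ''lo'' (nvar ''a'')) (rent ''lo'' (nvar ''c''))))"
    then have le: "D c \<le> D a" using D a c by simp
    show "halts ?W eval_prog s (7 * n_col A + 5) (\<lambda>s'. halts ?W ?rest s' (1 + (max (1 + 1) 1 + 1)) ?Q)"
    proof (rule halts_mono[OF halts_eval order_refl])
      show "nmem s ''n_col'' 0 0 = n_col A" "nmem s ''i'' 0 0 = i"
        "rmem s ''lo'' 0 (nmem s ''a'' 0 0) = D a" "rmem s ''lo'' 0 (nmem s ''c'' 0 0) = D c"
        "D a \<in> {0..1}" "D c \<in> {0..1}"
        using n i a c D by simp_all
    qed (use rest le in blast)
  next
    assume "\<not> bval ?W s (BNot (RLess (rent ''lo'' (nvar ''a'')) (rent ''lo'' (nvar ''c''))))"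
    then have "D a < D c" using D a c by simp
    then have "dp_entry mech D K (rmem s ''V'') (nmem s ''prv'') i c (Suc a)"
      by (intro dp_entry_Suc[OF entry]) simp
    then show "halts ?W Skip s 1 ?Q"
      by (intro halts_Skip) (simp add: unchanged_refl)
  qed
  then show ?thesis by (rule halts_time) simp
qed

lemma halts_entry:
  assumes n: "nmem s ''n_col'' 0 0 = n_col A" and K: "nmem s ''t'' 0 0 = K"
    and D: "rmem s ''lo'' 0 = D" "\<And>a. a < K \<Longrightarrow> D a \<in> {0..1}"
    and i: "nmem s ''i'' 0 0 = i" "1 \<le> i" and c: "nmem s ''c'' 0 0 = c" "c < K"
    and V1: "\<And>a. a < K \<Longrightarrow> rmem s ''V'' 1 a = coalition_utility mech A (\<lambda>_. D a)"
  shows "halts (auction_oracles mech A) entry_prog s (K * (7 * n_col A + 12) + 4) (\<lambda>s'.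
    unchanged {''a'', ''j'', ''prv''} {''bids'', ''u'', ''x'', ''V''} s s' \<and>
    dp_entry mech D K (rmem s' ''V'') (nmem s' ''prv'') i c K \<and> same_except (Suc i) c s s')"
proof -
  let ?W = "auction_oracles mech A"
  let ?X = "{''a'', ''j'', ''prv''}" and ?Y = "{''bids'', ''u'', ''x'', ''V''}"
  define I where "I k s' \<longleftrightarrow> unchanged ?X ?Y s s' \<and> nmem s' ''a'' 0 0 = k \<and>
    dp_entry mech D K (rmem s' ''V'') (nmem s' ''prv'') i c k \<and> same_except (Suc i) c s s'" for k s'
  have loop: "halts ?W (For ''a'' (nvar ''t'') relax_prog) s' ((K - 0) * (7 * n_col A + 10 + 2) + 1) (I (max 0 K))"
    if "I 0 s'" for s'
  proof (rule halts_For[where I = I, OF that])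
    fix k s1 assume I: "I k s1"
    then have u: "unchanged ?X ?Y s s1" by (simp add: I_def)
    have vars: "nmem s1 ''n_col'' 0 0 = n_col A" "nmem s1 ''t'' 0 0 = K" "rmem s1 ''lo'' 0 = D"
      "nmem s1 ''i'' 0 0 = i" "nmem s1 ''c'' 0 0 = c"
      using unchanged_nmem[OF u] unchanged_rmem[OF u] n K D i c by simp_all
    show "nmem s1 ''a'' 0 0 = k \<and> nval s1 (nvar ''t'') = K"
      using I vars by (simp add: I_def)
    assume k: "k < K"
    have a: "nmem s1 ''a'' 0 0 = k" and entry: "dp_entry mech D K (rmem s1 ''V'') (nmem s1 ''prv'') i c k"
      and same: "same_except (Suc i) c s s1"
      using I unfolding I_def by blast+
    have V: "rmem s1 ''V'' 1 k = coalition_utility mech A (\<lambda>_. D k)"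
      using same i(2) V1[OF k] by simp
    show "halts ?W relax_prog s1 (7 * n_col A + 10) (\<lambda>s'. nmem s' ''a'' 0 0 = k \<and>
        I (Suc k) (s'\<lparr>nmem := update (nmem s') ''a'' 0 0 (Suc k)\<rparr>))"
    proof (rule halts_mono[OF halts_relax[OF vars(1,3) D(2) vars(4) a k vars(5) c(2) V entry] order_refl])
      fix s2 assume s2: "unchanged {''j'', ''prv''} {''bids'', ''u'', ''x'', ''V''} s1 s2 \<and>
        dp_entry mech D K (rmem s2 ''V'') (nmem s2 ''prv'') i c (Suc k) \<and> same_except (Suc i) c s1 s2"
      have "unchanged ?X ?Y s s2" using s2 by (intro unchanged_trans[OF u]) auto
      moreover have "nmem s2 ''a'' = nmem s1 ''a''"
        using s2 by (intro unchanged_nmem[of "{''j'', ''prv''}"]) auto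
      moreover have "same_except (Suc i) c s s2"
        using s2 same by simp
      ultimately show "nmem s2 ''a'' 0 0 = k \<and> I (Suc k) (s2\<lparr>nmem := update (nmem s2) ''a'' 0 0 (Suc k)\<rparr>)"
        using s2 a by (simp add: I_def update_apply unchanged_update)
    qed
  qed
  have start: "dp_entry mech D K V' prv' i c 0"
    if "V' (Suc i) c = V' i c" "prv' (Suc i) c = c" for V' prv'
    using c(2) unfolding dp_entry_def that by simp
  have "halts ?W entry_prog s (1 + (1 + (1 + ((K - 0) * (7 * n_col A + 10 + 2) + 1)))) (I (max 0 K))"
    unfolding entry_prog_def
    by (intro halts_Seq halts_NAssign halts_RAssign loop)
      (simp add: I_def update_apply unchanged_update unchanged_refl start i c)
  then show ?thesis by (rule halts_mono) (simp_all add: I_def)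
qed

text \<open>Processing column \<open>c\<close> for row \<open>m\<close> writes only the entry of row
  \<open>Suc m\<close> in that column. Finished rows end at \<open>m\<close>, and the other entries
  of row \<open>Suc m\<close> lie in other columns, so both parts of the inner invariant
  survive.\<close>

lemma halts_dp:
  assumes n: "nmem s ''n_col'' 0 0 = n_col A" and K: "nmem s ''t'' 0 0 = K"
    and D: "rmem s ''lo'' 0 = D" "\<And>a. a < K \<Longrightarrow> D a \<in> {0..1}"
    and V1: "\<And>a. a < K \<Longrightarrow> rmem s ''V'' 1 a = coalition_utility mech A (\<lambda>_. D a)"
  shows "halts (auction_oracles mech A) dp_prog s
    (n_col A * (K * (K * (7 * n_col A + 12) + 6) + 4) + 2) (\<lambda>s'.
    unchanged {''i'', ''c'', ''a'', ''j'', ''prv''} {''bids'', ''u'', ''x'', ''V''} s s' \<and>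
    dp_table mech D K (rmem s' ''V'') (nmem s' ''prv'') (n_col A))"
proof -
  let ?W = "auction_oracles mech A"
  let ?X = "{''i'', ''c'', ''a'', ''j'', ''prv''}" and ?Y = "{''bids'', ''u'', ''x'', ''V''}"
  let ?tab = "\<lambda>s. dp_table mech D K (rmem s ''V'') (nmem s ''prv'')"
  let ?ent = "\<lambda>s. dp_entry mech D K (rmem s ''V'') (nmem s ''prv'')"
  define I where "I m s' \<longleftrightarrow> unchanged ?X ?Y s s' \<and> nmem s' ''i'' 0 0 = m \<and> 1 \<le> m \<and> ?tab s' m" for m s'
  define J where "J m k s' \<longleftrightarrow> unchanged ?X ?Y s s' \<and> nmem s' ''i'' 0 0 = m \<and> nmem s' ''c'' 0 0 = k \<and>
    1 \<le> m \<and> ?tab s' m \<and> (\<forall>c<k. ?ent s' m c K)" for m k s'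
  have vars: "nmem s' ''n_col'' 0 0 = n_col A" "nmem s' ''t'' 0 0 = K" "rmem s' ''lo'' 0 = D"
    if "unchanged ?X ?Y s s'" for s'
    using unchanged_nmem[OF that] unchanged_rmem[OF that] n K D by simp_all
  have inner: "halts ?W (For ''c'' (nvar ''t'') entry_prog) s'
      ((K - 0) * (K * (7 * n_col A + 12) + 4 + 2) + 1) (J m (max 0 K))" if "J m 0 s'" for m s'
  proof (rule halts_For[where I = "J m", OF that])
    fix k s1 assume J: "J m k s1"
    have u: "unchanged ?X ?Y s s1" and i: "nmem s1 ''i'' 0 0 = m" "1 \<le> m" and c: "nmem s1 ''c'' 0 0 = k"
      and tab: "?tab s1 m" and ent: "\<And>c. c < k \<Longrightarrow> ?ent s1 m c K"
      using J unfolding J_def by blast+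
    show "nmem s1 ''c'' 0 0 = k \<and> nval s1 (nvar ''t'') = K"
      using c vars[OF u] by simp
    assume k: "k < K"
    have V: "rmem s1 ''V'' 1 a = coalition_utility mech A (\<lambda>_. D a)" if "a < K" for a
      using tab that unfolding dp_table_def by blast
    show "halts ?W entry_prog s1 (K * (7 * n_col A + 12) + 4) (\<lambda>s'. nmem s' ''c'' 0 0 = k \<and>
        J m (Suc k) (s'\<lparr>nmem := update (nmem s') ''c'' 0 0 (Suc k)\<rparr>))"
    proof (rule halts_mono[OF halts_entry[OF vars[OF u] D(2) i c k V] order_refl])
      fix s2 assume s2: "unchanged {''a'', ''j'', ''prv''} {''bids'', ''u'', ''x'', ''V''} s1 s2 \<and>
        ?ent s2 m k K \<and> same_except (Suc m) k s1 s2"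
      then have u2: "unchanged {''a'', ''j'', ''prv''} {''bids'', ''u'', ''x'', ''V''} s1 s2"
        and same: "same_except (Suc m) k s1 s2" by blast+
      have rows: "rmem s2 ''V'' i' = rmem s1 ''V'' i'" "nmem s2 ''prv'' i' = nmem s1 ''prv'' i'" if "i' \<le> m" for i'
        using same that by auto
      have "?ent s2 i' c' K" if "1 \<le> i'" "i' < m" "c' < K" for i' c'
      proof -
        have "?ent s1 i' c' K" using tab that unfolding dp_table_def by blast
        then show ?thesis
          using that rows by (subst dp_entry_cong[where V = "rmem s1 ''V''" and prv = "nmem s1 ''prv''"]) simp_all
      qed
      then have tab2: "?tab s2 m"
        unfolding dp_table_def using V rows i(2) by simp
      have "?ent s2 m c' K" if "c' < k" for c'
        using ent[OF that] rows same that
        by (subst dp_entry_cong[where V = "rmem s1 ''V''" and prv = "nmem s1 ''prv''"]) simp_all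
      then have ent2: "\<forall>c'<Suc k. ?ent s2 m c' K"
        using s2 by (simp add: less_Suc_eq)
      have "unchanged ?X ?Y s s2" using u2 by (intro unchanged_trans[OF u]) auto
      moreover have "nmem s2 ''c'' = nmem s1 ''c''" "nmem s2 ''i'' = nmem s1 ''i''"
        using unchanged_nmem[OF u2] by simp_all
      ultimately show "nmem s2 ''c'' 0 0 = k \<and> J m (Suc k) (s2\<lparr>nmem := update (nmem s2) ''c'' 0 0 (Suc k)\<rparr>)"
        using c i tab2 ent2 by (simp add: J_def update_apply unchanged_update)
    qed
  qed
  let ?c = "Seq (nset ''c'' (NConst 0)) (For ''c'' (nvar ''t'') entry_prog)"
  let ?T = "1 + ((K - 0) * (K * (7 * n_col A + 12) + 4 + 2) + 1)"
  have loop: "halts ?W (For ''i'' (nvar ''n_col'') ?c) s' ((n_col A - 1) * (?T + 2) + 1) (I (max 1 (n_col A)))"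
    if "I 1 s'" for s'
  proof (rule halts_For[where I = I, OF that])
    fix m s1 assume I: "I m s1"
    then have u: "unchanged ?X ?Y s s1" by (simp add: I_def)
    show "nmem s1 ''i'' 0 0 = m \<and> nval s1 (nvar ''n_col'') = n_col A"
      using I vars[OF u] by (simp add: I_def)
    have "halts ?W ?c s1 ?T (J m (max 0 K))"
      using I by (intro halts_Seq halts_NAssign inner) (simp add: I_def J_def update_apply unchanged_update)
    then show "halts ?W ?c s1 ?T (\<lambda>s'. nmem s' ''i'' 0 0 = m \<and>
        I (Suc m) (s'\<lparr>nmem := update (nmem s') ''i'' 0 0 (Suc m)\<rparr>))"
    proof (rule halts_mono[OF _ order_refl])
      fix s2 assume J: "J m (max 0 K) s2"
      then have "?tab s2 m" "\<forall>c<K. ?ent s2 m c K" unfolding J_def by simp_all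
      then have "?tab s2 (Suc m)"
        unfolding dp_table_def less_Suc_eq by blast
      with J show "nmem s2 ''i'' 0 0 = m \<and> I (Suc m) (s2\<lparr>nmem := update (nmem s2) ''i'' 0 0 (Suc m)\<rparr>)"
        by (simp add: I_def J_def update_apply unchanged_update)
    qed
  qed
  have "?tab s 1" using V1 by (simp add: dp_table_def)
  then have "halts ?W dp_prog s (1 + ((n_col A - 1) * (?T + 2) + 1)) (I (max 1 (n_col A)))"
    unfolding dp_prog_def
    by (intro halts_Seq halts_NAssign loop) (simp add: I_def update_apply unchanged_update unchanged_refl)
  then show ?thesis
  proof (rule halts_mono)
    have "(n_col A - 1) * (?T + 2) \<le> n_col A * (?T + 2)" by (intro mult_right_mono) simp_all
    then show "1 + ((n_col A - 1) * (?T + 2) + 1) \<le> n_col A * (K * (K * (7 * n_col A + 12) + 6) + 4) + 2"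
      by (simp add: algebra_simps)
  next
    fix s' assume I: "I (max 1 (n_col A)) s'"
    \<comment> \<open>Without colluders the counter ends at 1, not at \<open>n_col A\<close>; a
      table for more rows is also one for fewer.\<close>
    have "?tab s' (n_col A)"
      using I unfolding I_def dp_table_def by (meson less_max_iff_disj)
    then show "unchanged ?X ?Y s s' \<and> ?tab s' (n_col A)" using I by (simp add: I_def)
  qed
qed

lemma halts_transfer:
  assumes n: "nmem s ''n_col'' 0 0 = n_col A" and \<epsilon>: "rmem s ''epsilon'' 0 0 = \<epsilon>"
    and t: "\<And>j. j < n_col A \<Longrightarrow> rmem s ''target'' 0 j = of_rat (target A j)"
    and b: "\<And>j. j < n_col A \<Longrightarrow> rmem s ''bids'' 0 j \<in> {0..1}"
  shows "halts (auction_oracles mech A) transfer_prog s (3 * n_col A + 4) (\<lambda>s'.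
    unchanged {''j'', ''n_atoms''} {''transfer'', ''prob''} s s' \<and>
    nmem s' ''n_atoms'' 0 0 = 1 \<and> rmem s' ''prob'' 0 0 = 1 \<and>
    (\<forall>j<n_col A. rmem s' ''transfer'' 0 j = exp_revenue A (rmem s ''bids'' 0) j - of_rat (target A j) + \<epsilon>))"
proof -
  let ?W = "auction_oracles mech A" and ?n = "n_col A"
  let ?X = "{''j'', ''n_atoms''}" and ?Y = "{''transfer'', ''prob''}"
  define I where "I k s' \<longleftrightarrow> unchanged ?X ?Y s s' \<and> nmem s' ''j'' 0 0 = k \<and>
    (\<forall>j<k. rmem s' ''transfer'' 0 j = exp_revenue A (rmem s ''bids'' 0) j - of_rat (target A j) + \<epsilon>)" for k s'
  let ?c = "RAssign ''transfer'' (NConst 0) (nvar ''j'')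
        (RAdd (RSub (AskRevenue ''bids'' (NConst 0) (nvar ''j'')) (rent ''target'' (nvar ''j'')))
          (rvar ''epsilon''))"
  have loop: "halts ?W (For ''j'' (nvar ''n_col'') ?c) s' ((?n - 0) * (1 + 2) + 1) (I (max 0 ?n))"
    if "I 0 s'" for s'
  proof (rule halts_For[where I = I, OF that])
    fix k s1 assume I: "I k s1"
    then have u: "unchanged ?X ?Y s s1" by (simp add: I_def)
    have vars: "nmem s1 ''n_col'' 0 0 = ?n" "rmem s1 ''epsilon'' 0 0 = \<epsilon>"
      "rmem s1 ''bids'' = rmem s ''bids''" "rmem s1 ''target'' = rmem s ''target''"
      using unchanged_nmem[OF u] unchanged_rmem[OF u] n \<epsilon> by simp_all
    show "nmem s1 ''j'' 0 0 = k \<and> nval s1 (nvar ''n_col'') = ?n"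
      using I vars by (simp add: I_def)
    assume k: "k < ?n"
    have ans: "revenue_answer ?W (rmem s ''bids'' 0) k = exp_revenue A (rmem s ''bids'' 0) k"
      using b k by (rule oracle_answers)
    show "halts ?W ?c s1 1 (\<lambda>s'. nmem s' ''j'' 0 0 = k \<and>
        I (Suc k) (s'\<lparr>nmem := update (nmem s') ''j'' 0 0 (Suc k)\<rparr>))"
      using I t[OF k]
      by (intro halts_RAssign) (auto simp: I_def update_apply unchanged_update vars ans less_Suc_eq)
  qed
  have "halts ?W transfer_prog s (1 + ((?n - 0) * (1 + 2) + 1 + (1 + 1)))
    (\<lambda>s'. unchanged ?X ?Y s s' \<and>
    nmem s' ''n_atoms'' 0 0 = 1 \<and> rmem s' ''prob'' 0 0 = 1 \<and>
    (\<forall>j<?n. rmem s' ''transfer'' 0 j = exp_revenue A (rmem s ''bids'' 0) j - of_rat (target A j) + \<epsilon>))"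
    unfolding transfer_prog_def
    apply (intro halts_Seq halts_NAssign)
    apply (rule halts_mono[OF loop order_refl])
     apply (simp add: I_def update_apply unchanged_update unchanged_refl)
    apply (intro halts_Seq halts_NAssign halts_RAssign)
    apply (simp add: I_def update_apply unchanged_update)
    done
  then show ?thesis by (rule halts_time) simp
qed

end

section \<open>Overall running time and the complete algorithm\<close>

definition agency_time :: "nat \<Rightarrow> nat \<Rightarrow> nat" where
  "agency_time n N = (12 * n + 3) + ((11 * N + 7) + ((N * (7 * n + 8) + 4) +
     ((n * (N * (N * (7 * n + 12) + 6) + 4) + 2) + ((4 * N + 3) + ((4 * n + 2) + (3 * n + 4))))))"

lemma agency_time_le:
  assumes "n \<le> Z" "N \<le> Z" "1 \<le> Z"
  shows "agency_time n N \<le> 200 * Z ^ 4"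
proof -
  have Z4: "Z ^ 4 = Z * Z * Z * Z" by (simp add: power4_eq_xxxx)
  have "1 * 1 * 1 * 1 \<le> Z * Z * Z * Z" "n * 1 * 1 * 1 \<le> Z * Z * Z * Z" "N * 1 * 1 * 1 \<le> Z * Z * Z * Z"
    "n * N * 1 * 1 \<le> Z * Z * Z * Z" "n * N * N * 1 \<le> Z * Z * Z * Z" "n * N * N * n \<le> Z * Z * Z * Z"
    using assms by (intro mult_le_mono; simp)+
  \<comment> \<open>The coefficients sum to 103, well below 200. The leading term stems from at most
    \<open>n * N * N\<close> edges, each with one evaluation of length linear in
    \<open>n\<close>.\<close>
  moreover have "agency_time n N = 7 * (n * N * N * n) + 12 * (n * N * N) + 13 * (n * N) + 23 * n + 23 * N + 25"
    by (simp add: agency_time_def algebra_simps)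
  ultimately show ?thesis unfolding Z4 by linarith
qed

context valid_instance
begin

text \<open>All time bounds are monotone in the grid size, so the actual size \<open>K\<close>,
  known only at run time, is replaced by its bound \<open>N\<close>.\<close>

lemma halts_search:
  assumes n: "nmem s ''n_col'' 0 0 = n_col A" and K: "nmem s ''t'' 0 0 = K" "0 < K" "K \<le> N"
    and D: "rmem s ''lo'' 0 = D" "\<And>a. a < K \<Longrightarrow> D a \<in> {0..1}"
    and \<epsilon>: "rmem s ''epsilon'' 0 0 = \<epsilon>"
    and t: "\<And>j. j < n_col A \<Longrightarrow> rmem s ''target'' 0 j = of_rat (target A j)"
  shows "halts (auction_oracles mech A)
    (Seq init_prog (Seq dp_prog (Seq best_prog (Seq backtrack_prog transfer_prog)))) s
    ((N * (7 * n_col A + 8) + 4) + ((n_col A * (N * (N * (7 * n_col A + 12) + 6) + 4) + 2) +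
      ((4 * N + 3) + ((4 * n_col A + 2) + (3 * n_col A + 4)))))
    (\<lambda>s'. nmem s' ''n_atoms'' 0 0 = 1 \<and> rmem s' ''prob'' 0 0 = 1 \<and>
      (\<forall>i<n_col A. rmem s' ''bids'' 0 i \<in> {0..1}) \<and>
      (\<forall>j<n_col A. rmem s' ''transfer'' 0 j = exp_revenue A (rmem s' ''bids'' 0) j - of_rat (target A j) + \<epsilon>) \<and>
      (\<forall>b. decreasing_on (n_col A) b \<and> (\<forall>i<n_col A. b i \<in> D ` {..<K}) \<longrightarrow>
        coalition_utility mech A b \<le> coalition_utility mech A (rmem s' ''bids'' 0)))"
    (is "halts ?W _ _ _ ?Q")
proof -
  let ?n = "n_col A"
  have KN: "K * (7 * ?n + 8) + 4 \<le> N * (7 * ?n + 8) + 4" "4 * K + 3 \<le> 4 * N + 3"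
    "?n * (K * (K * (7 * ?n + 12) + 6) + 4) + 2 \<le> ?n * (N * (N * (7 * ?n + 12) + 6) + 4) + 2"
    using K(3) by (auto intro!: mult_le_mono add_le_mono)
  show ?thesis
  proof (rule halts_Seq, rule halts_mono[OF halts_init[OF n K(1,2) D] KN(1)])
    fix s1
    assume s1: "unchanged {''i'', ''a'', ''c'', ''j''} {''bids'', ''u'', ''V''} s s1 \<and>
      (\<forall>c<K. rmem s1 ''V'' 1 c = coalition_utility mech A (\<lambda>_. D c))"
    then have u1: "unchanged {''i'', ''a'', ''c'', ''j''} {''bids'', ''u'', ''V''} s s1"
      and V1: "\<And>c. c < K \<Longrightarrow> rmem s1 ''V'' 1 c = coalition_utility mech A (\<lambda>_. D c)"
      by blast+
    have v1: "nmem s1 ''n_col'' 0 0 = ?n" "nmem s1 ''t'' 0 0 = K" "rmem s1 ''lo'' 0 = D"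
      "rmem s1 ''epsilon'' 0 0 = \<epsilon>" "rmem s1 ''target'' = rmem s ''target''"
      using unchanged_nmem[OF u1] unchanged_rmem[OF u1] n K D \<epsilon> by simp_all
    show "halts ?W (Seq dp_prog (Seq best_prog (Seq backtrack_prog transfer_prog))) s1
      ((?n * (N * (N * (7 * ?n + 12) + 6) + 4) + 2) + ((4 * N + 3) + ((4 * ?n + 2) + (3 * ?n + 4)))) ?Q"
    proof (rule halts_Seq, rule halts_mono[OF halts_dp[OF v1(1-3) D(2) V1] KN(3)])
      fix s2
      assume s2: "unchanged {''i'', ''c'', ''a'', ''j'', ''prv''} {''bids'', ''u'', ''x'', ''V''} s1 s2 \<and>
        dp_table mech D K (rmem s2 ''V'') (nmem s2 ''prv'') ?n"
      then have u2: "unchanged {''i'', ''c'', ''a'', ''j'', ''prv''} {''bids'', ''u'', ''x'', ''V''} s1 s2"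
        and tab: "dp_table mech D K (rmem s2 ''V'') (nmem s2 ''prv'') ?n"
        by blast+
      have v2: "nmem s2 ''n_col'' 0 0 = ?n" "nmem s2 ''t'' 0 0 = K" "rmem s2 ''lo'' 0 = D"
        "rmem s2 ''epsilon'' 0 0 = \<epsilon>" "rmem s2 ''target'' = rmem s ''target''"
        using unchanged_nmem[OF u2] unchanged_rmem[OF u2] v1 by simp_all
      show "halts ?W (Seq best_prog (Seq backtrack_prog transfer_prog)) s2
        ((4 * N + 3) + ((4 * ?n + 2) + (3 * ?n + 4))) ?Q"
      proof (rule halts_Seq, rule halts_mono[OF halts_best[OF v2(1,2) K(2) refl] KN(2)])
        fix s3
        assume s3: "unchanged {''a'', ''c''} {} s2 s3 \<and> nmem s3 ''c'' 0 0 < K \<and>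
          (\<forall>a<K. rmem s2 ''V'' ?n a \<le> rmem s2 ''V'' ?n (nmem s3 ''c'' 0 0))"
        let ?c = "nmem s3 ''c'' 0 0" and ?prv = "nmem s2 ''prv''"
        have u3: "unchanged {''a'', ''c''} {} s2 s3" using s3 by blast
        have v3: "nmem s3 ''n_col'' 0 0 = ?n" "rmem s3 ''lo'' 0 = D" "nmem s3 ''prv'' = ?prv"
          "rmem s3 ''epsilon'' 0 0 = \<epsilon>" "rmem s3 ''target'' = rmem s ''target''"
          using unchanged_nmem[OF u3] unchanged_rmem[OF u3] v2 by simp_all
        show "halts ?W (Seq backtrack_prog transfer_prog) s3 ((4 * ?n + 2) + (3 * ?n + 4)) ?Q"
        proof (rule halts_Seq, rule halts_mono[OF halts_backtrack[OF v3(1-3) refl] order_refl])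
          fix s4
          assume s4: "unchanged {''i'', ''c''} {''bids''} s3 s4 \<and>
            (\<forall>l<?n. rmem s4 ''bids'' 0 l = D (chain ?prv ?n ?c (?n - Suc l)))"
          let ?b = "rmem s4 ''bids'' 0"
          define \<beta> where "\<beta> i = chain ?prv ?n ?c (?n - i)" for i
          have u4: "unchanged {''i'', ''c''} {''bids''} s3 s4" using s4 by blast
          have v4: "nmem s4 ''n_col'' 0 0 = ?n" "rmem s4 ''epsilon'' 0 0 = \<epsilon>"
            "rmem s4 ''target'' = rmem s ''target''"
            using unchanged_nmem[OF u4] unchanged_rmem[OF u4] v3 by simp_all
          have b: "?b l = D (\<beta> (Suc l))" if "l < ?n" for l
            using s4 that by (simp add: \<beta>_def)
          have chain: "\<beta> i = ?prv (Suc i) (\<beta> (Suc i))" if "i < ?n" for i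
          proof -
            have "?n - i = Suc (?n - Suc i)" "?n - (?n - Suc i) = Suc i" using that by simp_all
            then show ?thesis by (simp add: \<beta>_def)
          qed
          have opt: "(\<forall>i<?n. ?b i \<in> {0..1}) \<and> (\<forall>b. decreasing_on ?n b \<and> (\<forall>i<?n. b i \<in> D ` {..<K}) \<longrightarrow>
              coalition_utility mech A b \<le> coalition_utility mech A ?b)"
          \<comment> \<open>The table says nothing about row 0, but without colluders all utilities
            are empty sums.\<close>
          proof (cases "?n = 0")
            case False
            then have n0: "0 < ?n" by simp
            have \<beta>n: "\<beta> ?n < K" using s3 by (simp add: \<beta>_def)
            have grid: "?b i \<in> D ` {..<K}" if "i < ?n" for i
            proof (rule dp_table_chain(1)[where \<beta> = \<beta> and b = ?b, OF tab n0 \<beta>n])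
              show "\<beta> i = ?prv (Suc i) (\<beta> (Suc i))" if "1 \<le> i" "i < ?n" for i
                using that(2) by (rule chain)
            qed (fact b, fact that)
            have "?b i \<in> {0..1}" if "i < ?n" for i
              using grid[OF that] D(2) by (elim imageE) (simp only: lessThan_iff)
            moreover have U: "coalition_utility mech A ?b = rmem s2 ''V'' ?n (\<beta> ?n)"
            proof (rule dp_table_chain(2)[where \<beta> = \<beta> and b = ?b, OF tab n0 \<beta>n])
              show "\<beta> i = ?prv (Suc i) (\<beta> (Suc i))" if "1 \<le> i" "i < ?n" for i
                using that(2) by (rule chain)
            qed (fact b)
            moreover have "coalition_utility mech A b \<le> coalition_utility mech A ?b"
              if b': "decreasing_on ?n b" "\<forall>i<?n. b i \<in> D ` {..<K}" for b
            proof -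
              obtain c where "c < K" "coalition_utility mech A b \<le> rmem s2 ''V'' ?n c"
                using dp_table_upper[OF tab n0 b'(1)] b'(2) by blast
              moreover have "rmem s2 ''V'' ?n c \<le> rmem s2 ''V'' ?n ?c"
                using s3 \<open>c < K\<close> by blast
              ultimately show ?thesis using U by (simp add: \<beta>_def)
            qed
            ultimately show ?thesis by blast
          qed (simp add: coalition_utility_def)
          show "halts ?W transfer_prog s4 (3 * ?n + 4) ?Q"
          proof (rule halts_mono[OF halts_transfer order_refl])
            show "nmem s4 ''n_col'' 0 0 = ?n" "rmem s4 ''epsilon'' 0 0 = \<epsilon>" by fact+
            show "rmem s4 ''target'' 0 j = of_rat (target A j)" if "j < ?n" for j
              using v4(3) t[OF that] by simp
            show "?b j \<in> {0..1}" if "j < ?n" for j using opt that by blast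
            fix s5
            assume s5: "unchanged {''j'', ''n_atoms''} {''transfer'', ''prob''} s4 s5 \<and>
              nmem s5 ''n_atoms'' 0 0 = 1 \<and> rmem s5 ''prob'' 0 0 = 1 \<and>
              (\<forall>j<?n. rmem s5 ''transfer'' 0 j = exp_revenue A ?b j - of_rat (target A j) + \<epsilon>)"
            have "rmem s5 ''bids'' = rmem s4 ''bids''"
              using s5 by (intro unchanged_rmem[of "{''j'', ''n_atoms''}" "{''transfer'', ''prob''}"]) auto
            then show "?Q s5"
              using s5 opt by (simp only:) (elim conjE, intro conjI refl)
          qed
        qed
      qed
    qed
  qed
qed

text \<open>The hypothesis on \<open>N\<close> is the queue bound with \<open>1 / \<delta>\<close>
  replaced by its estimate from the scaling phase, so that it refers to the instance alone.\<close>

lemma halts_agency: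
  assumes \<epsilon>: "0 < \<epsilon>"
    and N: "2 + 2 * real (precision A) * real (n_ext A) * ((1 + 16 * (real (n_col A))\<^sup>2) / \<epsilon>) \<le> real N"
  shows "halts (auction_oracles mech A) agency_prog (input_state A \<epsilon>) (agency_time (n_col A) N)
    (\<lambda>s'. nmem s' ''n_atoms'' 0 0 = 1 \<and> rmem s' ''prob'' 0 0 = 1 \<and>
      (\<forall>i<n_col A. rmem s' ''bids'' 0 i \<in> {0..1}) \<and>
      (\<forall>j<n_col A. rmem s' ''transfer'' 0 j = exp_revenue A (rmem s' ''bids'' 0) j - of_rat (target A j) + \<epsilon>) \<and>
      (\<forall>b. (\<forall>i<n_col A. b i \<in> {0..1}) \<longrightarrow>
        coalition_utility mech A b \<le> coalition_utility mech A (rmem s' ''bids'' 0) + \<epsilon>))"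
    (is "halts ?W _ ?s _ ?Q")
proof -
  let ?n = "n_col A"
  have v0: "nmem ?s ''n_col'' 0 0 = ?n" "nmem ?s ''precision'' 0 0 = precision A"
    "rmem ?s ''epsilon'' 0 0 = \<epsilon>" "\<And>j. j < ?n \<Longrightarrow> rmem ?s ''target'' 0 j = of_rat (target A j)"
    by (simp_all add: input_state_def)
  show ?thesis
    unfolding agency_prog_def agency_time_def
  proof (rule halts_Seq, rule halts_mono[OF halts_scale[OF v0(1,3) \<epsilon>] order_refl])
    fix s1
    assume s1: "unchanged {''k''} {''delta''} ?s s1 \<and> 0 < rmem s1 ''delta'' 0 0 \<and>
      4 * (real ?n)\<^sup>2 * rmem s1 ''delta'' 0 0 \<le> \<epsilon> \<and>
      1 / rmem s1 ''delta'' 0 0 \<le> (1 + 16 * (real ?n)\<^sup>2) / \<epsilon>"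
    define \<delta> where "\<delta> = rmem s1 ''delta'' 0 0"
    have u1: "unchanged {''k''} {''delta''} ?s s1" and \<delta>: "0 < \<delta>" "4 * (real ?n)\<^sup>2 * \<delta> \<le> \<epsilon>"
      "1 / \<delta> \<le> (1 + 16 * (real ?n)\<^sup>2) / \<epsilon>"
      using s1 by (simp_all add: \<delta>_def)
    have v1: "nmem s1 ''n_col'' 0 0 = ?n" "nmem s1 ''precision'' 0 0 = precision A"
      "rmem s1 ''epsilon'' 0 0 = \<epsilon>" "rmem s1 ''target'' = rmem ?s ''target''"
      using unchanged_nmem[OF u1] unchanged_rmem[OF u1] v0 by simp_all
    have "2 * real (precision A) * real (n_ext A) * (1 / \<delta>) \<le>
        2 * real (precision A) * real (n_ext A) * ((1 + 16 * (real ?n)\<^sup>2) / \<epsilon>)"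
      using \<delta>(3) by (intro mult_left_mono) simp_all
    then have N\<delta>: "2 + 2 * real (precision A) * real (n_ext A) / \<delta> \<le> real N"
      using N by simp
    show "halts ?W (Seq bisect_prog (Seq init_prog (Seq dp_prog (Seq best_prog
        (Seq backtrack_prog transfer_prog))))) s1
      ((11 * N + 7) + ((N * (7 * ?n + 8) + 4) +
     ((?n * (N * (N * (7 * ?n + 12) + 6) + 4) + 2) + ((4 * N + 3) + ((4 * ?n + 2) + (3 * ?n + 4)))))) ?Q"
    proof (rule halts_Seq, rule halts_mono[OF halts_bisect[OF v1(2) \<delta>_def[symmetric] \<delta>(1) N\<delta>] order_refl])
      fix s2
      assume s2: "unchanged {''h'', ''t'', ''lev''} {''lo'', ''hi''} s1 s2 \<and> nmem s2 ''t'' 0 0 \<le> N \<and>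
        bisection \<delta> (nmem s2 ''t'' 0 0) (nmem s2 ''t'' 0 0)
          (rmem s2 ''lo'' 0) (rmem s2 ''hi'' 0) (nmem s2 ''lev'' 0)"
      let ?K = "nmem s2 ''t'' 0 0" and ?D = "rmem s2 ''lo'' 0"
      have u2: "unchanged {''h'', ''t'', ''lev''} {''lo'', ''hi''} s1 s2" and K: "?K \<le> N"
        and inv: "bisection \<delta> ?K ?K ?D (rmem s2 ''hi'' 0) (nmem s2 ''lev'' 0)"
        using s2 by blast+
      have v2: "nmem s2 ''n_col'' 0 0 = ?n" "rmem s2 ''epsilon'' 0 0 = \<epsilon>"
        "rmem s2 ''target'' = rmem ?s ''target''"
        using unchanged_nmem[OF u2] unchanged_rmem[OF u2] v1 by simp_all
      have K0: "0 < ?K" using inv by (simp add: bisection_def)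
      have D: "?D a \<in> {0..1}" if "a < ?K" for a
        using bisection_grid(1)[OF inv \<delta>(1)] that by blast
      have t: "rmem s2 ''target'' 0 j = of_rat (target A j)" if "j < ?n" for j
        using v0(4)[OF that] v2(3) by simp
      show "halts ?W (Seq init_prog (Seq dp_prog (Seq best_prog (Seq backtrack_prog transfer_prog)))) s2
        ((N * (7 * ?n + 8) + 4) + ((?n * (N * (N * (7 * ?n + 12) + 6) + 4) + 2) +
          ((4 * N + 3) + ((4 * ?n + 2) + (3 * ?n + 4))))) ?Q"
      proof (rule halts_mono[OF halts_search[OF v2(1) refl K0 K refl D v2(2) t] order_refl])
        fix s' :: state
        let ?b = "rmem s' ''bids'' 0"
        assume s': "nmem s' ''n_atoms'' 0 0 = 1 \<and> rmem s' ''prob'' 0 0 = 1 \<and>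
          (\<forall>i<?n. ?b i \<in> {0..1}) \<and>
          (\<forall>j<?n. rmem s' ''transfer'' 0 j = exp_revenue A ?b j - of_rat (target A j) + \<epsilon>) \<and>
          (\<forall>b. decreasing_on ?n b \<and> (\<forall>i<?n. b i \<in> ?D ` {..<?K}) \<longrightarrow>
            coalition_utility mech A b \<le> coalition_utility mech A ?b)"
        have "coalition_utility mech A b \<le> coalition_utility mech A ?b + \<epsilon>"
          if b: "\<forall>i<?n. b i \<in> {0..1}" for b
        proof -
          obtain b' where b': "decreasing_on ?n b'" "\<And>i. i < ?n \<Longrightarrow> b' i \<in> ?D ` {..<?K}"
            "coalition_utility mech A b \<le> coalition_utility mech A b' + 2 * (real ?n)\<^sup>2 * \<delta>"
            using round_to_grid[where D = "?D ` {..<?K}" and \<delta> = \<delta> and b = b and mech = mech]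
              bisection_grid[OF inv \<delta>(1)] b by blast
          have "0 \<le> (real ?n)\<^sup>2 * \<delta>" using \<delta>(1) by simp
          moreover have "coalition_utility mech A b' \<le> coalition_utility mech A ?b"
            using s' b' by blast
          ultimately show ?thesis using b'(3) \<delta>(2) by linarith
        qed
        with s' show "?Q s'" by blast
      qed
    qed
  qed
qed

end

theorem theorem3:
  fixes mech :: mechanism
  shows "\<exists>(prog :: com) (C :: real) (d :: nat). \<forall>(A :: auction) (\<epsilon> :: real).
    valid_auction A \<longrightarrow>
    (\<exists>bc \<in> bid_vectors A. \<forall>i<n_col A.
       exp_revenue A bc i - exp_payment mech A bc i \<ge> of_rat (target A i)) \<longrightarrow>
    \<epsilon> > 0 \<longrightarrow>
    (\<exists>T s \<gamma> q.
       runs (auction_oracles mech A) prog (input_state A \<epsilon>) T s \<and>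
       real T \<le> C * (1 + real (instance_size A) + 1 / \<epsilon>) ^ d \<and>
       returns A s \<gamma> q \<and> randomized_strategy A \<gamma> \<and>
       eps_IC A \<epsilon> \<gamma> q \<and> IR mech A \<gamma> q \<and>
       agency_value mech A \<gamma> \<ge> OPT mech A - \<epsilon>)"
proof (rule exI[of _ agency_prog], rule exI[of _ "200 * 39 ^ 4"], rule exI[of _ 20], intro allI impI)
  fix A :: auction and \<epsilon> :: real
  assume valid: "valid_auction A" and \<epsilon>: "\<epsilon> > 0"
    and feasible: "\<exists>bc \<in> bid_vectors A. \<forall>i<n_col A.
       exp_revenue A bc i - exp_payment mech A bc i \<ge> of_rat (target A i)"
  interpret valid_instance A by unfold_locales (rule valid)
  let ?n = "n_col A" and ?X = "1 + real (instance_size A) + 1 / \<epsilon>"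
  define B where "B = 2 + 2 * real (precision A) * real (n_ext A) * ((1 + 16 * (real ?n)\<^sup>2) / \<epsilon>)"
  define N where "N = nat \<lceil>B\<rceil>"
  have B: "2 \<le> B" using \<epsilon> by (simp add: B_def)
  then have N: "B \<le> real N" "real N \<le> B + 1" unfolding N_def by linarith+
  obtain T s where T: "runs (auction_oracles mech A) agency_prog (input_state A \<epsilon>) T s"
    "T \<le> agency_time ?n N"
    and s: "out_atoms s = 1" "out_prob s 0 = 1" "\<forall>i<?n. rmem s ''bids'' 0 i \<in> {0..1}"
    "\<forall>j<?n. rmem s ''transfer'' 0 j = exp_revenue A (rmem s ''bids'' 0) j - of_rat (target A j) + \<epsilon>"
    "\<forall>b. (\<forall>i<?n. b i \<in> {0..1}) \<longrightarrow>
        coalition_utility mech A b \<le> coalition_utility mech A (rmem s ''bids'' 0) + \<epsilon>"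
    using halts_agency[OF \<epsilon> N(1)[unfolded B_def], of mech] unfolding halts_def by blast
  let ?b = "out_bids A s 0" and ?q = "rmem s ''transfer'' 0"
  have b: "?b \<in> bid_vectors A" using s(3) by auto
  have Ub: "coalition_utility mech A ?b = coalition_utility mech A (rmem s ''bids'' 0)"
    by (rule coalition_utility_cong) simp
  have opt: "coalition_utility mech A b' \<le> coalition_utility mech A ?b + \<epsilon>" if "b' \<in> bid_vectors A" for b'
    using s(5) that unfolding Ub by (auto simp: PiE_iff)
  have q: "?q i = exp_revenue A ?b i - of_rat (target A i) + \<epsilon>" if "i < ?n" for i
    using s(4) that by (simp add: exp_restrict)
  have X: "1 \<le> ?X" "real ?n \<le> ?X" "real (n_ext A) \<le> ?X" "real (precision A) \<le> ?X" "1 / \<epsilon> \<le> ?X"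
  proof -
    have "?n \<le> instance_size A" "n_ext A \<le> instance_size A" "precision A \<le> instance_size A"
      by (simp_all add: instance_size_def)
    then have "real ?n \<le> instance_size A" "real (n_ext A) \<le> instance_size A"
      "real (precision A) \<le> instance_size A" "0 < 1 / \<epsilon>"
      using \<epsilon> by simp_all
    then show "1 \<le> ?X" "real ?n \<le> ?X" "real (n_ext A) \<le> ?X" "real (precision A) \<le> ?X" "1 / \<epsilon> \<le> ?X"
      by linarith+
  qed
  have p: "?X ^ i \<le> ?X ^ j" if "i \<le> j" for i j
    using X(1) that by (intro power_increasing) simp_all
  have "1 + 16 * (real ?n)\<^sup>2 \<le> 17 * ?X ^ 2"
    using power_mono[OF X(2), of 2] p[of 0 2] by simp
  then have split: "(1 + 16 * (real ?n)\<^sup>2) * (1 / \<epsilon>) \<le> 17 * ?X ^ 2 * ?X"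
    using X(1,5) \<epsilon> by (intro mult_mono) simp_all
  have grid: "real (precision A) * real (n_ext A) \<le> ?X * ?X"
    using X by (intro mult_mono) simp_all
  have "real (precision A) * real (n_ext A) * ((1 + 16 * (real ?n)\<^sup>2) * (1 / \<epsilon>)) \<le>
      ?X * ?X * (17 * ?X ^ 2 * ?X)"
    by (rule mult_mono[OF grid split]) (use X(1) \<epsilon> in simp_all)
  also have "\<dots> = 17 * ?X ^ 5" by (simp add: eval_nat_numeral)
  finally have "B \<le> 2 + 34 * ?X ^ 5" by (simp add: B_def)
  \<comment> \<open>\<open>N + ?n\<close> is at most \<open>3 + 34 * ?X ^ 5 + ?X\<close>, and both 1
    and \<open>?X\<close> are at most \<open>?X ^ 5\<close>; 39 leaves a margin. The final exponent
    20 is this degree 5 times the degree 4 of the running time.\<close>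
  then have "real (max 1 (N + ?n)) \<le> 39 * ?X ^ 5"
    using N X(1,2) p[of 0 5] p[of 1 5] by simp
  then have Z: "real (max 1 (N + ?n)) ^ 4 \<le> (39 * ?X ^ 5) ^ 4"
    by (intro power_mono) simp_all
  have "agency_time ?n N \<le> 200 * max 1 (N + ?n) ^ 4"
    by (rule agency_time_le) auto
  with T(2) have "T \<le> 200 * max 1 (N + ?n) ^ 4"
    by (rule order_trans)
  then have "real T \<le> 200 * real (max 1 (N + ?n)) ^ 4"
    by (metis of_nat_le_iff of_nat_mult of_nat_numeral of_nat_power)
  also have "\<dots> \<le> 200 * (39 * ?X ^ 5) ^ 4" using Z by simp
  also have "\<dots> = 200 * 39 ^ 4 * ?X ^ 20" by (simp add: power_mult_distrib flip: power_mult)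
  finally have time: "real T \<le> 200 * 39 ^ 4 * ?X ^ 20" .
  show "\<exists>T s \<gamma> q.
       runs (auction_oracles mech A) agency_prog (input_state A \<epsilon>) T s \<and>
       real T \<le> 200 * 39 ^ 4 * ?X ^ 20 \<and>
       returns A s \<gamma> q \<and> randomized_strategy A \<gamma> \<and>
       eps_IC A \<epsilon> \<gamma> q \<and> IR mech A \<gamma> q \<and>
       agency_value mech A \<gamma> \<ge> OPT mech A - \<epsilon>"
    using T(1) time returns_point_mass[OF s(1,2) b] point_mass_near_optimal[OF \<epsilon> feasible b opt q]
    by blast
qed

end
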